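(* Let $K$ be the Sierpiński gasket with standard energy form $(\mathcal E,\mathcal C)$ and boundary $B=V_0=\{q_0,q_1,q_2\}$. Suppose that either (i) $h\in\mathcal C$ is the harmonic function on $K\setminus V_0$ with boundary values $h(q_0)=0$, $h(q_1)=h(q_2)=1$, and $\Theta:H_-\to H_+$ is the linear contraction $\Theta(0,x_1,x_2,w)=\big(-\tfrac12(x_1+x_2),0,0,w\big)$; or (ii) $h\in\mathcal C$ is the harmonic function on $K\setminus V_0$ with boundary values $h(q_0)=\frac12$, $h(q_1)=0$, $h(q_2)=1$, and $\Theta:H_-\to H_+$ is the restriction to $H_-$ of the map $(x_0,x_1,x_2,w)\mapsto(x_0,-x_2,-x_1,w)$. Here $b=\partial h$, $H_\pm$ are the boundary spaces associated with $(K,\mathcal E,\mathcal C,V_0,\partial h)$, whose elements are written $(x_0,x_1,x_2,w)$ with $x_i\in\mathbb R$ the component at $q_i$ and $w\in\ker\partial^\bot$, and $(T^\Theta(t))_{t\ge0}$ is the strongly continuous contraction semigroup on $L^2(K,\nu_{\partial h})$ generated by $A^\Theta$. Then for any $\mathring V\in C^1(S^1)$ (viewed as a $1$-periodic $C^1$ function on $\mathbb R$) and any $w\in\ker\partial^\bot$ we have $\mathring V\circ h+w\in\mathcal D(A^\Theta)$ and $$T^\Theta(t)(\mathring V\circ h+w)=\mathring V(h-t)+w,\qquad t\ge0.$$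
   Context: **Sierpiński gasket.** $q_0,q_1,q_2$ are the vertices of an equilateral triangle in $\mathbb R^2$, $F_i(x)=\frac12(x-q_i)+q_i$; $K$ is the unique nonempty compact set with $K=\bigcup_{i=0}^2F_i(K)$. $V_0=\{q_0,q_1,q_2\}$, $V_{n+1}=\bigcup_iF_i(V_n)$. The standard energy form is $\mathcal E(u)=\lim_n\mathcal E_{V_n}(u)$ with $\mathcal E_{V_n}(u)=\frac12(\frac53)^n\sum_{x\in V_n}\sum_{y\in V_n,\,y\sim_nx}(u(x)-u(y))^2$, $\sim_n$ denoting neighbors in the $n$-th level graph (distinct points of some $F_{\alpha}(V_0)$, $|\alpha|=n$), extended by polarization; $\mathcal C$ is the algebra of continuous $u$ on $K$ with $\lim_n\mathcal E_{V_n}(u)<\infty$. $h\in\mathcal C$ is harmonic on $K\setminus V_0$ if $\mathcal E(h,\varphi)=0$ for all $\varphi\in\mathcal C$ with $\varphi|_{V_0}=0$. Known facts: $(\mathcal E,\mathcal C)$ has martingale dimension one, and every nonconstant harmonic $h$ is minimal energy-dominant (i.e. its energy measure $\nu_h$ dominates all energy measures $\nu_f$, $f\in\mathcal C$, and is absolutely continuous w.r.t. any measure that does). **First order structure** ($X=K$). For $f_1,f_2\in\mathcal C$, $\nu_{f_1,f_2}$ is the unique finite signed Radon measure with $\int g\,d\nu_{f_1,f_2}=\frac12\{\mathcal E(f_1g,f_2)+\mathcal E(f_1,f_2g)-\mathcal E(f_1f_2,g)\}$, $g\in\mathcal C$; $\nu_f=\nu_{f,f}$. Put $d_uf(x,y)=f(x)-f(y)$,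 $\overline g(x,y)=\frac12(g(x)+g(y))$. $\mathcal H$ is the Hilbert space obtained from the span of all $\overline g\,d_uf$ ($g\in C(X)$, $f\in\mathcal C$) with $\langle\overline g_1d_uf_1,\overline g_2d_uf_2\rangle_{\mathcal H}=\int g_1g_2\,d\nu_{f_1,f_2}$ by factoring out null elements and completing; $\partial f$ is the class of $d_uf$, $g\,\partial f$ that of $\overline g\,d_uf$. $\nu_{\partial h}=\nu_h$. With $b=\partial h$, $\star_b:L^2(X,\nu_b)\to\mathcal H$, $\star_bg=gb$ (extended isometrically from $g\in C(X)$), is an isometric isomorphism. **Operators.** $B=V_0$, $\mathcal C_B=\{f\in\mathcal C:f|_B=0\}$, $\partial_B=\partial|_{\mathcal C_B}$. $\partial^\ast,\partial_B^\ast$ are the adjoints (from $\mathcal H$ to $L^2(X,\nu_b)$) of the densely defined operators $(\partial,\mathcal C)$, $(\partial_B,\mathcal C_B)$ from $L^2(X,\nu_b)$ to $\mathcal H$. $\mathcal D(\partial^\bot)=\star_b^{-1}\mathcal D(\partial^\ast)$, $\partial^\bot f=-\partial^\ast\star_bf$; $\mathcal D(\partial_B^\bot)=\star_b^{-1}\mathcal D(\partial_B^\ast)$, $\partial_B^\bot f=-\partial_B^\ast\star_bf$. **Normal parts.** For $v\in\mathcal D(\partial_B^\ast)$ and $q\in B$, $n_Bv(q):=\langle v,\partial\psi_q\rangle_{\mathcal H}-\int_X(\partial_B^\ast v)\psi_q\,d\nu_b$, where $\psi_q\in\mathcal C$ is harmonic on $K\setminus V_0$ with $\psi_q(q)=1$,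 $\psi_q=0$ on $B\setminus\{q\}$. $u\in\mathcal C$ is in $\mathcal D(\Delta_B)$ with $\Delta_Bu=f\in L^2(X,\nu_b)$ if $\mathcal E(u,\varphi)=-\int f\varphi\,d\nu_b$ for all $\varphi\in\mathcal C_B$; then $(du)_B:=n_B\partial u$. $u$ is a weak solution of $\Delta_Bu=f$ on $X\setminus B$, $(du)_B=G\in\ell(B)$ on $B$ if $\mathcal E(u,\varphi)=\sum_{q\in B}G(q)\varphi(q)-\int f\varphi\,d\nu_b$ for all $\varphi\in\mathcal C$. In case (i), $n_Bb=(dh)_B=(-2,1,1)$ at $(q_0,q_1,q_2)$; in case (ii), $(dh)_B=(0,-\frac32,\frac32)$. **Canonical representation** of $f\in\mathcal D(\partial_B^\bot)$: $f=g+\star_b^{-1}\partial u+w$ with $g\in\mathcal C$ such that $z:=\partial_B^\bot f-\star_b^{-1}\partial g\in\ker\partial^\bot$, $w\in\ker\partial^\bot$, $u$ a weak solution of $\Delta_Bu=z$ on $X\setminus B$, $(du)_B=n_B(fb)-g\,n_Bb$ on $B$. It exists and is unique up to $g\mapsto g+c$, $\partial u\mapsto\partial u-c\,\partial h$, $c\in\mathbb R$. **Boundary spaces and maps.** $\mathring B,\check B,\hat B\subset B$ are the sets where $n_Bb$ is $=0$, $<0$, $>0$. $\widetilde H_\pm=\ell(\mathring B)\oplus\ell(\check B,|n_Bb|)\oplus\ell(\hat B,|n_Bb|)\oplus\ker\partial^\bot$, with counting measure on $\mathring B$, weights $|n_Bb|$ on $\check B,\hat B$, and the $L^2(X,\nu_b)$-scalar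 product on $\ker\partial^\bot$. $H_-$ is the orthogonal complement of $(\frac{\mathbf 1}{\sqrt2},\mathbf 1,0,0)$, $H_+$ that of $(\frac{\mathbf 1}{\sqrt2},0,-\mathbf 1,0)$, with projections $P_-,P_+$ (trivial summands omitted: in case (i) $\mathring B=\emptyset$, $\check B=\{q_0\}$, $\hat B=\{q_1,q_2\}$, so $H_-=\{x_0=0\}$; in case (ii) $\mathring B=\{q_0\}$, $\check B=\{q_1\}$, $\hat B=\{q_2\}$). $G_-f=P_-\big(\frac1{\sqrt2}(g+n_B(fb)),\frac{(du)_B}{|n_Bb|},\frac{n_B(fb)}{|n_Bb|},\frac1{\sqrt2}(w+z)\big)$, $G_+f=P_+\big(\frac1{\sqrt2}(g-n_B(fb)),\frac{n_B(fb)}{|n_Bb|},\frac{(du)_B}{|n_Bb|},\frac1{\sqrt2}(w-z)\big)$, the first three components restricted to $\mathring B,\check B,\hat B$. For a linear contraction $\Theta:H_-\to H_+$, $\mathcal D(A^\Theta)=\{f\in\mathcal D(\partial_B^\bot):\Theta G_-f=G_+f\}$, $A^\Theta f=-\partial_B^\bot f$; this operator generates a strongly continuous contraction semigroup on $L^2(X,\nu_b)$. *)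

theory Defs
  imports "HOL-Analysis.Analysis"
begin

section \<open>Square integrable functions and semigroups\<close>

text \<open>
  Elements of $L^2(M)$ are represented by functions, and two representatives are identified when
  they agree almost everywhere. \<open>L2_norm\<close> is meaningful on \<open>L2\<close> only.
\<close>

definition L2 :: "'a measure \<Rightarrow> ('a \<Rightarrow> real) set" where
  "L2 M = {f \<in> borel_measurable M. integrable M (\<lambda>x. (f x)\<^sup>2)}"

definition L2_norm :: "'a measure \<Rightarrow> ('a \<Rightarrow> real) \<Rightarrow> real" where
  "L2_norm M f = sqrt (\<integral>x. (f x)\<^sup>2 \<partial>M)"

text \<open>
  That \<open>T t\<close> respects almost everywhere equality follows from linearity and contractivity.
\<close>

definition contraction_semigroup ::
  "'a measure \<Rightarrow> (real \<Rightarrow> ('a \<Rightarrow> real) \<Rightarrow> 'a \<Rightarrow> real) \<Rightarrow> bool" where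
  "contraction_semigroup M T \<longleftrightarrow>
     (\<forall>t\<ge>0. \<forall>f\<in>L2 M. T t f \<in> L2 M) \<and>
     (\<forall>t\<ge>0. \<forall>f\<in>L2 M. \<forall>g\<in>L2 M. \<forall>c.
        AE x in M. T t (\<lambda>x. f x + c * g x) x = T t f x + c * T t g x) \<and>
     (\<forall>t\<ge>0. \<forall>f\<in>L2 M. L2_norm M (T t f) \<le> L2_norm M f) \<and>
     (\<forall>f\<in>L2 M. AE x in M. T 0 f x = f x) \<and>
     (\<forall>s\<ge>0. \<forall>t\<ge>0. \<forall>f\<in>L2 M. AE x in M. T (s + t) f x = T s (T t f) x) \<and>
     (\<forall>f\<in>L2 M. ((\<lambda>t. L2_norm M (\<lambda>x. T t f x - f x)) \<longlongrightarrow> 0) (at_right 0))"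

definition is_generator ::
  "'a measure \<Rightarrow> ('a \<Rightarrow> real) set \<Rightarrow> (('a \<Rightarrow> real) \<Rightarrow> 'a \<Rightarrow> real)
     \<Rightarrow> (real \<Rightarrow> ('a \<Rightarrow> real) \<Rightarrow> 'a \<Rightarrow> real) \<Rightarrow> bool" where
  "is_generator M D A T \<longleftrightarrow>
     D \<subseteq> L2 M \<and>
     (\<forall>f\<in>L2 M. \<forall>k\<in>L2 M.
        (f \<in> D \<and> (AE x in M. k x = A f x)) \<longleftrightarrow>
        ((\<lambda>t. L2_norm M (\<lambda>x. (T t f x - f x) / t - k x)) \<longlongrightarrow> 0) (at_right 0))"


section \<open>The Sierpinski gasket and its energy form\<close>

type_synonym pt = "real^2"

text \<open>
  The indices $0,1,2$ of the vertices are the elements of the three-element type \<open>3\<close>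
  (arithmetic modulo three). Functions on the gasket are total functions on the plane of which
  only the values on the gasket matter.
\<close>

definition equilateral :: "(3 \<Rightarrow> pt) \<Rightarrow> bool" where
  "equilateral q \<longleftrightarrow> q 0 \<noteq> q 1 \<and> dist (q 0) (q 1) = dist (q 1) (q 2)
     \<and> dist (q 1) (q 2) = dist (q 2) (q 0)"

context
  fixes q :: "3 \<Rightarrow> pt"
begin

definition F :: "3 \<Rightarrow> pt \<Rightarrow> pt" where
  "F i x = (1/2) *\<^sub>R (x - q i) + q i"

definition gasket :: "pt set" where
  "gasket = (THE K. compact K \<and> K \<noteq> {} \<and> K = (\<Union>i. F i ` K))"

primrec V :: "nat \<Rightarrow> pt set" where
  "V 0 = range q"
| "V (Suc n) = (\<Union>i. F i ` V n)"

primrec F_word :: "3 list \<Rightarrow> pt \<Rightarrow> pt" where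
  "F_word [] = id"
| "F_word (i # \<alpha>) = F i \<circ> F_word \<alpha>"

definition neighbors :: "nat \<Rightarrow> pt \<Rightarrow> pt \<Rightarrow> bool" where
  "neighbors n x y \<longleftrightarrow>
     x \<noteq> y \<and> (\<exists>\<alpha>. length \<alpha> = n \<and> x \<in> F_word \<alpha> ` V 0 \<and> y \<in> F_word \<alpha> ` V 0)"

definition graph_energy :: "nat \<Rightarrow> (pt \<Rightarrow> real) \<Rightarrow> real" where
  "graph_energy n u =
     (1/2) * (5/3)^n * (\<Sum>x\<in>V n. \<Sum>y\<in>{y \<in> V n. neighbors n x y}. (u x - u y)\<^sup>2)"

text \<open>The graph energies are nondecreasing in \<open>n\<close>, so convergence means a finite limit.\<close>

definition \<C> :: "(pt \<Rightarrow> real) set" where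
  "\<C> = {u. continuous_on gasket u \<and> convergent (\<lambda>n. graph_energy n u)}"

definition energy1 :: "(pt \<Rightarrow> real) \<Rightarrow> real" where
  "energy1 u = lim (\<lambda>n. graph_energy n u)"

definition energy :: "(pt \<Rightarrow> real) \<Rightarrow> (pt \<Rightarrow> real) \<Rightarrow> real" where
  "energy u v = (energy1 (\<lambda>x. u x + v x) - energy1 (\<lambda>x. u x - v x)) / 4"

definition \<C>\<^sub>B :: "(pt \<Rightarrow> real) set" where
  "\<C>\<^sub>B = {u \<in> \<C>. \<forall>x\<in>V 0. u x = 0}"

definition harmonic :: "(pt \<Rightarrow> real) \<Rightarrow> bool" where
  "harmonic h \<longleftrightarrow> h \<in> \<C> \<and> (\<forall>\<phi>\<in>\<C>\<^sub>B. energy h \<phi> = 0)"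

definition harmonic_basis :: "3 \<Rightarrow> pt \<Rightarrow> real" where
  "harmonic_basis i = (SOME \<psi>. harmonic \<psi> \<and> (\<forall>j. \<psi> (q j) = (if j = i then 1 else 0)))"


section \<open>Energy measures and the Hilbert space of one-forms\<close>

text \<open>
  A finite signed Radon measure on the (compact) gasket is given as a difference \<open>M - N\<close> of finite
  Borel measures; only the difference is uniquely determined by \<open>f1\<close> and \<open>f2\<close>. For \<open>f1 = f2\<close> it is
  nonnegative, so that one can take \<open>N = 0\<close>, which makes \<open>M\<close> unique.
\<close>

definition is_energy_measure ::
  "(pt \<Rightarrow> real) \<Rightarrow> (pt \<Rightarrow> real) \<Rightarrow> pt measure \<Rightarrow> pt measure \<Rightarrow> bool" where
  "is_energy_measure f1 f2 M N \<longleftrightarrow>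
     finite_measure M \<and> finite_measure N \<and>
     sets M = sets (restrict_space borel gasket) \<and> sets N = sets (restrict_space borel gasket) \<and>
     (\<forall>g\<in>\<C>. (\<integral>x. g x \<partial>M) - (\<integral>x. g x \<partial>N) =
        (energy (\<lambda>x. f1 x * g x) f2 + energy f1 (\<lambda>x. f2 x * g x)
           - energy (\<lambda>x. f1 x * f2 x) g) / 2)"

definition nu :: "(pt \<Rightarrow> real) \<Rightarrow> pt measure" where
  "nu f = (THE M. is_energy_measure f f M (null_measure (restrict_space borel gasket)))"

text \<open>\<open>nu_integral f1 f2 g\<close> is $\int g\,d\nu_{f_1,f_2}$ for continuous $g$.\<close>

definition nu_integral :: "(pt \<Rightarrow> real) \<Rightarrow> (pt \<Rightarrow> real) \<Rightarrow> (pt \<Rightarrow> real) \<Rightarrow> real" where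
  "nu_integral f1 f2 g =
     (case SOME MN. is_energy_measure f1 f2 (fst MN) (snd MN) of
        (M, N) \<Rightarrow> (\<integral>x. g x \<partial>M) - (\<integral>x. g x \<partial>N))"

definition d_u :: "(pt \<Rightarrow> real) \<Rightarrow> pt \<times> pt \<Rightarrow> real" where
  "d_u f = (\<lambda>(x, y). f x - f y)"

definition avg :: "(pt \<Rightarrow> real) \<Rightarrow> pt \<times> pt \<Rightarrow> real" where
  "avg g = (\<lambda>(x, y). (g x + g y) / 2)"

text \<open>
  A list of pairs $(g_k,f_k)$ represents $\sum_k \overline{g_k}\,d_u f_k$; scalar coefficients can
  be absorbed into $g_k$.
\<close>

definition form_of :: "((pt \<Rightarrow> real) \<times> (pt \<Rightarrow> real)) list \<Rightarrow> pt \<times> pt \<Rightarrow> real" where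
  "form_of xs = (\<lambda>p. \<Sum>(g, f)\<leftarrow>xs. avg g p * d_u f p)"

definition represents :: "((pt \<Rightarrow> real) \<times> (pt \<Rightarrow> real)) list \<Rightarrow> (pt \<times> pt \<Rightarrow> real) \<Rightarrow> bool" where
  "represents xs a \<longleftrightarrow> set xs \<subseteq> {g. continuous_on gasket g} \<times> \<C> \<and> a = form_of xs"

definition simple_forms :: "(pt \<times> pt \<Rightarrow> real) set" where
  "simple_forms = {a. \<exists>xs. represents xs a}"

definition simple_inner :: "(pt \<times> pt \<Rightarrow> real) \<Rightarrow> (pt \<times> pt \<Rightarrow> real) \<Rightarrow> real" where
  "simple_inner a a' = (THE c. \<exists>xs ys. represents xs a \<and> represents ys a' \<and>
     c = (\<Sum>(g1, f1)\<leftarrow>xs. \<Sum>(g2, f2)\<leftarrow>ys. nu_integral f1 f2 (\<lambda>x. g1 x * g2 x)))"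

definition simple_norm :: "(pt \<times> pt \<Rightarrow> real) \<Rightarrow> real" where
  "simple_norm a = sqrt (simple_inner a a)"

text \<open>
  The completion: elements of \<open>\<H>\<close> are represented by Cauchy sequences of simple forms, and two
  such sequences represent the same element if \<open>\<H>_eq\<close> holds. Simple forms embed as constant
  sequences.
\<close>

type_synonym form_seq = "nat \<Rightarrow> pt \<times> pt \<Rightarrow> real"

definition \<H> :: "form_seq set" where
  "\<H> = {v. (\<forall>n. v n \<in> simple_forms) \<and>
      (\<forall>e>0. \<exists>N. \<forall>m\<ge>N. \<forall>n\<ge>N. simple_norm (\<lambda>p. v m p - v n p) < e)}"

definition \<H>_inner :: "form_seq \<Rightarrow> form_seq \<Rightarrow> real" where
  "\<H>_inner v v' = lim (\<lambda>n. simple_inner (v n) (v' n))"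

definition \<H>_dist :: "form_seq \<Rightarrow> form_seq \<Rightarrow> real" where
  "\<H>_dist v v' = sqrt (\<H>_inner (\<lambda>n p. v n p - v' n p) (\<lambda>n p. v n p - v' n p))"

definition \<H>_eq :: "form_seq \<Rightarrow> form_seq \<Rightarrow> bool" where
  "\<H>_eq v v' \<longleftrightarrow> \<H>_dist v v' = 0"

text \<open>\<open>mult_deriv g f\<close> is $g\,\partial f$ for continuous $g$.\<close>

definition mult_deriv :: "(pt \<Rightarrow> real) \<Rightarrow> (pt \<Rightarrow> real) \<Rightarrow> form_seq" where
  "mult_deriv g f = (\<lambda>n p. avg g p * d_u f p)"

definition deriv1 :: "(pt \<Rightarrow> real) \<Rightarrow> form_seq" where
  "deriv1 f = (\<lambda>n. d_u f)"


section \<open>Operators associated with $b = \partial h$\<close>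

context
  fixes h :: "pt \<Rightarrow> real"
begin

text \<open>
  \<open>star\<close> is the isometric extension of $g \mapsto g\,\partial h$ from continuous $g$ to
  $L^2(\nu_h)$, determined up to \<open>\<H>_eq\<close>.
\<close>

definition star :: "(pt \<Rightarrow> real) \<Rightarrow> form_seq" where
  "star g = (SOME v. v \<in> \<H> \<and> (\<exists>gs. (\<forall>n. continuous_on gasket (gs n)) \<and>
     (\<lambda>n. L2_norm (nu h) (\<lambda>x. gs n x - g x)) \<longlonglongrightarrow> 0 \<and>
     (\<lambda>n. \<H>_dist (mult_deriv (gs n) h) v) \<longlonglongrightarrow> 0))"

definition star_inv :: "form_seq \<Rightarrow> pt \<Rightarrow> real" where
  "star_inv v = (SOME g. g \<in> L2 (nu h) \<and> \<H>_eq (star g) v)"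

text \<open>
  \<open>adj D\<close> is the adjoint of $(\partial, D)$ and \<open>perp D\<close> the associated $\partial^\bot$; the cases
  \<open>D = \<C>\<close> and \<open>D = \<C>\<^sub>B\<close> give $\partial^\ast$, $\partial^\bot$ and $\partial_B^\ast$,
  $\partial_B^\bot$.
\<close>

definition is_adj :: "(pt \<Rightarrow> real) set \<Rightarrow> form_seq \<Rightarrow> (pt \<Rightarrow> real) \<Rightarrow> bool" where
  "is_adj D v f \<longleftrightarrow> f \<in> L2 (nu h) \<and>
     (\<forall>\<phi>\<in>D. \<H>_inner v (deriv1 \<phi>) = (\<integral>x. f x * \<phi> x \<partial>nu h))"

definition adj_dom :: "(pt \<Rightarrow> real) set \<Rightarrow> form_seq set" where
  "adj_dom D = {v \<in> \<H>. \<exists>f. is_adj D v f}"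

definition adj :: "(pt \<Rightarrow> real) set \<Rightarrow> form_seq \<Rightarrow> pt \<Rightarrow> real" where
  "adj D v = (SOME f. is_adj D v f)"

definition perp_dom :: "(pt \<Rightarrow> real) set \<Rightarrow> (pt \<Rightarrow> real) set" where
  "perp_dom D = {f \<in> L2 (nu h). star f \<in> adj_dom D}"

definition perp :: "(pt \<Rightarrow> real) set \<Rightarrow> (pt \<Rightarrow> real) \<Rightarrow> pt \<Rightarrow> real" where
  "perp D f = (\<lambda>x. - adj D (star f) x)"

definition ker_perp :: "(pt \<Rightarrow> real) set" where
  "ker_perp = {f \<in> perp_dom \<C>. AE x in nu h. perp \<C> f x = 0}"

text \<open>Functions on the boundary are indexed: the value at \<open>i\<close> is the one at the vertex \<open>q i\<close>.\<close>

definition nB :: "form_seq \<Rightarrow> 3 \<Rightarrow> real" where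
  "nB v i = \<H>_inner v (deriv1 (harmonic_basis i))
     - (\<integral>x. adj \<C>\<^sub>B v x * harmonic_basis i x \<partial>nu h)"

definition nb :: "3 \<Rightarrow> real" where
  "nb = nB (deriv1 h)"

definition weak_solution :: "(pt \<Rightarrow> real) \<Rightarrow> (pt \<Rightarrow> real) \<Rightarrow> (3 \<Rightarrow> real) \<Rightarrow> bool" where
  "weak_solution u f G \<longleftrightarrow> u \<in> \<C> \<and>
     (\<forall>\<phi>\<in>\<C>. energy u \<phi> = (\<Sum>i\<in>UNIV. G i * \<phi> (q i)) - (\<integral>x. f x * \<phi> x \<partial>nu h))"

definition z_part :: "(pt \<Rightarrow> real) \<Rightarrow> (pt \<Rightarrow> real) \<Rightarrow> pt \<Rightarrow> real" where
  "z_part f g = (\<lambda>x. perp \<C>\<^sub>B f x - star_inv (deriv1 g) x)"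

definition canonical_rep ::
  "(pt \<Rightarrow> real) \<Rightarrow> (pt \<Rightarrow> real) \<Rightarrow> (pt \<Rightarrow> real) \<Rightarrow> (pt \<Rightarrow> real) \<Rightarrow> bool" where
  "canonical_rep f g u w \<longleftrightarrow>
     g \<in> \<C> \<and> z_part f g \<in> ker_perp \<and> w \<in> ker_perp \<and>
     weak_solution u (z_part f g) (\<lambda>i. nB (star f) i - g (q i) * nb i) \<and>
     (AE x in nu h. f x = g x + star_inv (deriv1 u) x + w x)"

text \<open>
  In $(x, w)$ the function $x$ collects the components in the first three summands of
  $\widetilde H_\pm$, which belong to the vertices where $n_B b$ is zero, negative and positive,
  respectively.
\<close>

type_synonym bdry = "(3 \<Rightarrow> real) \<times> (pt \<Rightarrow> real)"

definition bdry_weight :: "3 \<Rightarrow> real" where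
  "bdry_weight i = (if nb i = 0 then 1 else \<bar>nb i\<bar>)"

definition bdry_inner :: "bdry \<Rightarrow> bdry \<Rightarrow> real" where
  "bdry_inner X Y = (\<Sum>i\<in>UNIV. bdry_weight i * fst X i * fst Y i)
     + (\<integral>y. snd X y * snd Y y \<partial>nu h)"

definition bdry_eq :: "bdry \<Rightarrow> bdry \<Rightarrow> bool" where
  "bdry_eq X Y \<longleftrightarrow> fst X = fst Y \<and> (AE y in nu h. snd X y = snd Y y)"

definition e_minus :: bdry where
  "e_minus = ((\<lambda>i. if nb i = 0 then 1 / sqrt 2 else if nb i < 0 then 1 else 0), (\<lambda>y. 0))"

definition e_plus :: bdry where
  "e_plus = ((\<lambda>i. if nb i = 0 then 1 / sqrt 2 else if nb i < 0 then 0 else -1), (\<lambda>y. 0))"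

definition orth_compl :: "bdry \<Rightarrow> bdry set" where
  "orth_compl e = {X. snd X \<in> ker_perp \<and> bdry_inner X e = 0}"

definition H_minus :: "bdry set" where
  "H_minus = orth_compl e_minus"

definition H_plus :: "bdry set" where
  "H_plus = orth_compl e_plus"

text \<open>The orthogonal projection onto the complement of \<open>e\<close>.\<close>

definition orth_proj :: "bdry \<Rightarrow> bdry \<Rightarrow> bdry" where
  "orth_proj e X = (let c = bdry_inner X e / bdry_inner e e in
     ((\<lambda>i. fst X i - c * fst e i), (\<lambda>y. snd X y - c * snd e y)))"

text \<open>
  The boundary maps $G_\pm f$ in terms of a canonical representation of $f$. They do not depend on
  its choice: the constant by which \<open>g\<close> and \<open>u\<close> may be changed is removed by the projection.
\<close>

definition G_minus ::
  "(pt \<Rightarrow> real) \<Rightarrow> (pt \<Rightarrow> real) \<Rightarrow> (pt \<Rightarrow> real) \<Rightarrow> (pt \<Rightarrow> real) \<Rightarrow> bdry" where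
  "G_minus f g u w = orth_proj e_minus
     ((\<lambda>i. if nb i = 0 then (g (q i) + nB (star f) i) / sqrt 2
           else if nb i < 0 then nB (deriv1 u) i / \<bar>nb i\<bar>
           else nB (star f) i / \<bar>nb i\<bar>),
      (\<lambda>y. (w y + z_part f g y) / sqrt 2))"

definition G_plus ::
  "(pt \<Rightarrow> real) \<Rightarrow> (pt \<Rightarrow> real) \<Rightarrow> (pt \<Rightarrow> real) \<Rightarrow> (pt \<Rightarrow> real) \<Rightarrow> bdry" where
  "G_plus f g u w = orth_proj e_plus
     ((\<lambda>i. if nb i = 0 then (g (q i) - nB (star f) i) / sqrt 2
           else if nb i < 0 then nB (star f) i / \<bar>nb i\<bar>
           else nB (deriv1 u) i / \<bar>nb i\<bar>),
      (\<lambda>y. (w y - z_part f g y) / sqrt 2))"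

text \<open>Only the values of \<open>\<Theta>\<close> on \<open>H_minus\<close> enter.\<close>

definition A_dom :: "(bdry \<Rightarrow> bdry) \<Rightarrow> (pt \<Rightarrow> real) set" where
  "A_dom \<Theta> = {f \<in> perp_dom \<C>\<^sub>B. \<exists>g u w. canonical_rep f g u w \<and>
     bdry_eq (\<Theta> (G_minus f g u w)) (G_plus f g u w)}"

definition A_op :: "(pt \<Rightarrow> real) \<Rightarrow> pt \<Rightarrow> real" where
  "A_op f = (\<lambda>x. - perp \<C>\<^sub>B f x)"

end

end

end

theory Submission
  imports Defs
begin

text \<open>
  On the gasket the scalar product of one-forms is the limit of the discrete scalar products
  $\frac12(\frac53)^n\sum a(x,y)\,a'(x,y)$ over the edges of level $n$; so the chain rule
  $\partial(V\circ h) = V'(h)\,\partial h$ is the trapezoidal rule. For harmonic $h$ the Leibniz rule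
  turns $\langle V(h)\,\partial h, \partial\varphi\rangle$ into a boundary term minus
  $\int V'(h)\varphi\,d\nu_h$. Hence $f = V\circ h + w$ satisfies $\partial_B^\bot f = V'(h)$ and has the
  canonical representation with $g = V\circ h$, $u = 0$, and $z = 0$, and its
  boundary values are those of $V\circ h$ at the vertices. In both cases the boundary condition given
  by $\Theta$ reduces to $V(0) = V(1)$. The class of these functions is invariant under translation of
  $V$, and $V(h-t)+w$ solves the abstract Cauchy problem, whose solution is unique.
\<close>

section \<open>Geometry of the gasket\<close>

text \<open>Most objects here are given by choice: \<open>gasket\<close>, \<open>nu\<close> and
  \<open>simple_inner\<close> by definite descriptions, \<open>star\<close>, \<open>star_inv\<close>
  and \<open>adj\<close> by \<open>SOME\<close>. Each therefore needs an existence and a uniqueness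
  argument, and the operators are known only almost everywhere. The delicate case is the adjoint on
  \<open>\<C>\<^sub>B\<close>. It determines a function only if \<open>\<C>\<^sub>B\<close> is dense
  in L2, so the boundary must carry no energy. This is obtained from the stronger fact that the
  energy measure of \<open>h\<close> gives no mass to level sets of \<open>h\<close>. Since
  energies, energy measures and scalar products of forms are all limits of the same kind of edge
  sum, their algebraic relations are verified on a single edge before passing to the limit.
  Harmonicity enters through one formula: the energy of \<open>h\<close> with any function only sees
  the three boundary values of that function. The sign and direction of the transport come from
  \<open>A_op\<close>, which sends V(h) + w to -V'(h), the time derivative of V(h - t) + w at t = 0.
  The part w is orthogonal to all gradients and so does not move.\<close>

lemma UNIV_3': "(UNIV :: 3 set) = {0, 1, 2}"
  using UNIV_3 by (auto simp: insert_commute)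

lemma forall_3': "(\<forall>i::3. P i) \<longleftrightarrow> P 0 \<and> P 1 \<and> P 2"
  by (metis UNIV_3' UNIV_I insertE empty_iff)

lemma sum_3': "(\<Sum>i\<in>(UNIV::3 set). f i) = f 0 + f 1 + f 2"
proof -
  have "(3::3) = 0" by simp
  then show ?thesis by (simp only: sum_3 ac_simps)
qed

lemma exhaust_3': "(i::3) = 0 \<or> i = 1 \<or> i = 2"
  using UNIV_3' by auto

lemma half_powers_lim: "(\<lambda>n. c / 2 ^ n) \<longlonglongrightarrow> (0 :: real)"
  using tendsto_mult[OF tendsto_const[of c] LIMSEQ_realpow_zero[of "1/2"]]
  by (simp add: power_divide)

locale triangle =
  fixes q :: "3 \<Rightarrow> pt"
  assumes equilateral: "equilateral q"
begin

abbreviation "K \<equiv> gasket q"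

section \<open>Barycentric coordinates of the triangle\<close>

definition center :: pt where
  "center = (1/3) *\<^sub>R (q 0 + q 1 + q 2)"

text \<open>
  With side length $r$, the vectors from the center to the vertices have squared length $r^2/3$ and
  mutual inner products $-r^2/6$; this determines the coefficients of the barycentric coordinates.
\<close>

definition bary :: "3 \<Rightarrow> pt \<Rightarrow> real" where
  "bary i x = 1/3 + 2 / ((q 0 - q 1) \<bullet> (q 0 - q 1)) * ((x - center) \<bullet> (q i - center))"

lemma side_inner:
  "(q 0 - q 1) \<bullet> (q 0 - q 1) \<noteq> 0"
  "(q 1 - q 2) \<bullet> (q 1 - q 2) = (q 0 - q 1) \<bullet> (q 0 - q 1)"
  "(q 0 - q 2) \<bullet> (q 0 - q 2) = (q 0 - q 1) \<bullet> (q 0 - q 1)"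
proof -
  have "q 0 \<noteq> q 1" "norm (q 0 - q 1) = norm (q 1 - q 2)" "norm (q 0 - q 1) = norm (q 0 - q 2)"
    using equilateral by (auto simp: equilateral_def dist_norm norm_minus_commute)
  then show "(q 0 - q 1) \<bullet> (q 0 - q 1) \<noteq> 0"
    "(q 1 - q 2) \<bullet> (q 1 - q 2) = (q 0 - q 1) \<bullet> (q 0 - q 1)"
    "(q 0 - q 2) \<bullet> (q 0 - q 2) = (q 0 - q 1) \<bullet> (q 0 - q 1)"
    unfolding dot_square_norm by auto
qed

lemma bary_q: "bary i (q j) = (if i = j then 1 else 0)"
proof -
  let ?r = "(q 0 - q 1) \<bullet> (q 0 - q 1)"
  define d where "d i j = (q i - center) \<bullet> (q j - center)" for i j
  define p where "p i j = q i \<bullet> q j" for i j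
  have p: "p 1 0 = p 0 1" "p 2 0 = p 0 2" "p 2 1 = p 1 2"
    by (simp_all add: p_def inner_commute)
  \<comment> \<open>In terms of the Gram matrix \<open>p\<close> the equal side lengths are linear
    equations, so all nine values of \<open>d\<close> follow by linear arithmetic.\<close>
  have d': "d i j = p i j - (p i 0 + p i 1 + p i 2) / 3 - (p 0 j + p 1 j + p 2 j) / 3
      + (p 0 0 + p 1 1 + p 2 2 + 2 * p 0 1 + 2 * p 0 2 + 2 * p 1 2) / 9" for i j
    unfolding d_def center_def p_def
    by (simp add: inner_diff_left inner_diff_right inner_add_left inner_add_right)
       (simp add: inner_commute field_simps)
  have r: "?r = p 0 0 + p 1 1 - 2 * p 0 1" "p 1 1 + p 2 2 - 2 * p 1 2 = ?r" "p 0 0 + p 2 2 - 2 * p 0 2 = ?r"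
    using side_inner(2,3) unfolding p_def
    by (simp_all add: inner_diff_left inner_diff_right inner_commute)
  have "d 0 0 = ?r / 3" "d 1 1 = ?r / 3" "d 2 2 = ?r / 3" "d 0 1 = - ?r / 6" "d 1 0 = - ?r / 6"
    "d 0 2 = - ?r / 6" "d 2 0 = - ?r / 6" "d 1 2 = - ?r / 6" "d 2 1 = - ?r / 6"
    unfolding d' r(1) p using r(2,3)[unfolded r(1)] by argo+
  then have d: "d i i = ?r / 3 \<and> (i \<noteq> j \<longrightarrow> d i j = - ?r / 6)" for i j
    using exhaust_3'[of i] exhaust_3'[of j] by (elim disjE) simp_all
  show ?thesis
    using side_inner(1) d[of i j] d[of j i] unfolding bary_def d_def[symmetric]
    by (auto simp: field_simps)
qed

lemma F_alt: "F q i x = (1/2) *\<^sub>R x + (1/2) *\<^sub>R q i"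
proof -
  have "q i = (1/2) *\<^sub>R q i + (1/2) *\<^sub>R q i"
    by (simp flip: scaleR_add_left)
  then show ?thesis unfolding F_def by (simp add: scaleR_diff_right)
qed

text \<open>\<open>bary i\<close> is affine and \<open>F q j\<close> maps a point to its midpoint
  with \<open>q j\<close>. Through this rule incidence questions about cells become inequalities
  between coordinates.\<close>

lemma bary_F: "bary i (F q j x) = (bary i x + (if i = j then 1 else 0)) / 2"
proof -
  have *: "1/3 + c * ((1/2) * (a + b)) = ((1/3 + c * a) + (1/3 + c * b)) / 2" for a b c :: real
    by (simp add: algebra_simps add_divide_distrib)
  have "F q j x - center = (1/2) *\<^sub>R ((x - center) + (q j - center))"
    using scaleR_left.add[of "1/2" "1/2" center]
    by (simp add: F_alt scaleR_add_right scaleR_diff_right)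
  then have "bary i (F q j x) = (bary i x + bary i (q j)) / 2"
    unfolding bary_def by (simp only: inner_scaleR_left inner_add_left *)
  then show ?thesis by (simp add: bary_q)
qed

lemma bary_sum: "bary 0 x + bary 1 x + bary 2 x = 1"
proof -
  have "(x - center) \<bullet> (q 0 - center) + (x - center) \<bullet> (q 1 - center) + (x - center) \<bullet> (q 2 - center)
      = (x - center) \<bullet> (q 0 + q 1 + q 2 - 3 *\<^sub>R center)"
    by (simp add: inner_simps algebra_simps)
  also have "\<dots> = 0"
    by (simp add: center_def)
  finally have *: "(x - center) \<bullet> (q 0 - center) + (x - center) \<bullet> (q 1 - center) + (x - center) \<bullet> (q 2 - center) = 0" .
  have "1/3 + c * a + (1/3 + c * b) + (1/3 + c * d) = 1 + c * (a + b + d)" for a b c d :: real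
    by (simp add: algebra_simps)
  then show ?thesis unfolding bary_def by (simp only: *)
qed

lemma continuous_bary: "continuous_on S (bary i)"
  unfolding bary_def by (intro continuous_intros)

lemma inj_q: "q i = q j \<longleftrightarrow> i = j"
  using bary_q[of i i] bary_q[of i j] by (auto split: if_splits)

lemma dist_F: "dist (F q i x) (F q i y) = dist x y / 2"
  by (simp add: F_def dist_norm flip: scaleR_diff_right)

lemma F_eq_iff [simp]: "F q i x = F q i y \<longleftrightarrow> x = y"
  by (simp add: F_def)

lemma F_q [simp]: "F q i (q i) = q i"
  by (simp add: F_def)

lemma F_q_commute: "F q i (q j) = F q j (q i)"
  by (simp add: F_alt add.commute)

lemma continuous_F: "continuous_on S (F q i)"
  unfolding F_def by (intro continuous_intros)

section \<open>Vertex sets; existence and uniqueness of the gasket\<close>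

lemma V_subset_Suc: "V q n \<subseteq> V q (Suc n)"
proof (induction n)
  case 0
  have "q i \<in> (\<Union>i. F q i ` range q)" for i
    by (intro UN_I[of i] image_eqI[of _ _ "q i"]) auto
  then show ?case by auto
next
  case (Suc n)
  then show ?case unfolding V.simps(2)[of q "Suc n"] V.simps(2)[of q n] by fast
qed

definition Vstar :: "pt set" where "Vstar = (\<Union>n. V q n)"

lemma Vstar_eq: "Vstar = (\<Union>i. F q i ` Vstar)"
proof -
  have "Vstar = (\<Union>n. V q (Suc n))"
    unfolding Vstar_def using V_subset_Suc by (intro subset_antisym UN_least) blast+
  also have "\<dots> = (\<Union>i. F q i ` Vstar)"
    unfolding Vstar_def by auto
  finally show ?thesis .
qed

lemma finite_V: "finite (V q n)"
  by (induction n) auto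

definition diam0 :: real where
  "diam0 = Max (range (\<lambda>i. norm (q i)))"

lemma diam0: "norm (q i) \<le> diam0"
  unfolding diam0_def by (intro Max_ge) auto

text \<open>Each \<open>F q i\<close> averages a point with a vertex, so it maps the ball about the
  origin with radius \<open>diam0\<close> into itself.\<close>

lemma bounded_Vstar: "bounded Vstar"
proof -
  have "norm x \<le> diam0" if "x \<in> V q n" for x n
    using that
  proof (induction n arbitrary: x)
    case 0
    then show ?case using diam0 by auto
  next
    case (Suc n)
    then obtain i y where y: "y \<in> V q n" "x = F q i y" by auto
    have "norm x \<le> norm y / 2 + norm (q i) / 2"
      unfolding y(2) F_alt by (rule order_trans[OF norm_triangle_ineq]) simp
    also have "\<dots> \<le> diam0" using Suc(1)[OF y(1)] diam0[of i] by simp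
    finally show ?case .
  qed
  then show ?thesis unfolding bounded_iff Vstar_def by blast
qed

lemma F_closure: "F q i ` closure S = closure (F q i ` S)"
proof -
  have "F q i = (\<lambda>x. (q i - (1/2) *\<^sub>R q i) + x) \<circ> (\<lambda>x. (1/2) *\<^sub>R x)"
    by (auto simp: F_def fun_eq_iff algebra_simps)
  then show ?thesis
    by (simp only: image_comp[symmetric] closure_translation closure_scaleR)
qed

text \<open>A point of \<open>K1\<close> is the image of a point of \<open>K1\<close> under n of the
  contractions. Applying the same contractions to a point of \<open>K2\<close> gives a point of
  \<open>K2\<close> at distance at most \<open>B / 2 ^ n\<close>, and \<open>K2\<close> is closed.
  The other inclusion follows by symmetry.\<close>

lemma gasket_unique:
  assumes "compact K1" "K1 \<noteq> {}" "K1 = (\<Union>i. F q i ` K1)"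
    and "compact K2" "K2 \<noteq> {}" "K2 = (\<Union>i. F q i ` K2)"
  shows "K1 \<subseteq> K2"
proof
  fix x assume x: "x \<in> K1"
  have "bounded (K1 \<union> K2)" using assms(1,4) compact_imp_bounded by auto
  then obtain B where B: "\<And>x y. x \<in> K1 \<Longrightarrow> y \<in> K2 \<Longrightarrow> dist x y \<le> B"
    unfolding bounded_two_points by blast
  have "\<exists>y\<in>K2. dist x y \<le> B / 2 ^ n" for n using x
  proof (induction n arbitrary: x)
    case 0
    then show ?case using B assms(5) by fastforce
  next
    case (Suc n)
    then obtain i x' where x': "x' \<in> K1" "x = F q i x'" using assms(3) by blast
    from Suc(1)[OF x'(1)] obtain y where y: "y \<in> K2" "dist x' y \<le> B / 2 ^ n" by blast
    then have "F q i y \<in> K2" using assms(6) by blast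
    moreover have "dist x (F q i y) \<le> B / 2 ^ Suc n"
      using y by (simp add: x' dist_F)
    ultimately show ?case by blast
  qed
  then obtain y where y: "\<And>n. y n \<in> K2" "\<And>n. dist x (y n) \<le> B / 2 ^ n" by metis
  have "(\<lambda>n. dist x (y n)) \<longlonglongrightarrow> 0"
    by (rule Lim_null_comparison[OF _ half_powers_lim[of B]]) (intro always_eventually allI, simp add: y(2))
  then have "y \<longlonglongrightarrow> x" by (subst tendsto_dist_iff, subst dist_commute)
  then show "x \<in> K2" using y(1) assms(4) compact_imp_closed closed_sequentially by blast
qed

lemma closure_Vstar:
  "compact (closure Vstar)" "closure Vstar \<noteq> {}" "closure Vstar = (\<Union>i. F q i ` closure Vstar)"
proof -
  show "compact (closure Vstar)" using bounded_Vstar by (simp add: compact_closure)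
  have "q 0 \<in> Vstar" unfolding Vstar_def by (intro UN_I[of 0]) auto
  then show "closure Vstar \<noteq> {}" by auto
  show "closure Vstar = (\<Union>i. F q i ` closure Vstar)"
    by (subst (1) Vstar_eq) (simp add: F_closure UNIV_3')
qed

lemma gasket_eq_closure: "K = closure Vstar"
  unfolding gasket_def
proof (rule the_equality)
  show "compact (closure Vstar) \<and> closure Vstar \<noteq> {} \<and> closure Vstar = (\<Union>i. F q i ` closure Vstar)"
    using closure_Vstar by simp
  show "A = closure Vstar" if "compact A \<and> A \<noteq> {} \<and> A = (\<Union>i. F q i ` A)" for A
    using that gasket_unique[OF closure_Vstar, of A] gasket_unique[OF _ _ _ closure_Vstar, of A]
    by (metis subset_antisym)
qed

lemma compact_K: "compact K" and K_nonempty: "K \<noteq> {}" and K_eq: "K = (\<Union>i. F q i ` K)"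
  using closure_Vstar unfolding gasket_eq_closure by auto

lemma F_in_K: "x \<in> K \<Longrightarrow> F q i x \<in> K"
  using K_eq by blast

lemma K_cases: 
  assumes "x \<in> K" obtains i y where "y \<in> K" "x = F q i y"
  using assms K_eq by blast

lemma V_subset_K: "V q n \<subseteq> K"
  unfolding gasket_eq_closure by (rule order_trans[OF _ closure_subset]) (auto simp: Vstar_def)

lemma q_in_K [simp]: "q i \<in> K"
  using V_subset_K[of 0] by auto

section \<open>Coordinates on the gasket and intersections of cells\<close>

definition diamK :: real where "diamK = diameter K"

lemma dist_diamK: "x \<in> K \<Longrightarrow> y \<in> K \<Longrightarrow> dist x y \<le> diamK"
  unfolding diamK_def using diameter_bounded_bound compact_imp_bounded[OF compact_K] by blast

text \<open>Both conditions hold at the vertices, are inherited under each \<open>F q j\<close> and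
  are closed, so they extend from the vertices of all levels to the closure.\<close>

lemma K_bary: 
  assumes "x \<in> K"
  shows "0 \<le> bary i x" "x = bary 0 x *\<^sub>R q 0 + bary 1 x *\<^sub>R q 1 + bary 2 x *\<^sub>R q 2"
proof -
  let ?P = "\<lambda>x. (\<forall>i. 0 \<le> bary i x) \<and> x = bary 0 x *\<^sub>R q 0 + bary 1 x *\<^sub>R q 1 + bary 2 x *\<^sub>R q 2"
  have "?P x" if "x \<in> V q n" for x n using that
  proof (induction n arbitrary: x)
    case 0
    then obtain j where "x = q j" by auto
    then show ?case using exhaust_3'[of j] by (auto simp: bary_q)
  next
    case (Suc n)
    then obtain j y where y: "y \<in> V q n" "x = F q j y" by auto
    have IH: "\<And>i. 0 \<le> bary i y" and eq: "y = bary 0 y *\<^sub>R q 0 + bary 1 y *\<^sub>R q 1 + bary 2 y *\<^sub>R q 2"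
      using Suc(1)[OF y(1)] by auto
    have "x = (1/2) *\<^sub>R y + (1/2) *\<^sub>R q j"
      unfolding y(2) by (rule F_alt)
    also have "\<dots> = (1/2) *\<^sub>R (bary 0 y *\<^sub>R q 0 + bary 1 y *\<^sub>R q 1 + bary 2 y *\<^sub>R q 2) + (1/2) *\<^sub>R q j"
      using eq by simp
    also have "\<dots> = bary 0 x *\<^sub>R q 0 + bary 1 x *\<^sub>R q 1 + bary 2 x *\<^sub>R q 2"
      using exhaust_3'[of j] by (auto simp: y bary_F algebra_simps add_divide_distrib)
    finally have "x = bary 0 x *\<^sub>R q 0 + bary 1 x *\<^sub>R q 1 + bary 2 x *\<^sub>R q 2" .
    moreover have "0 \<le> bary i x" for i using IH[of i] unfolding y(2) bary_F by auto
    ultimately show ?case by blast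
  qed
  then have "Vstar \<subseteq> {x. ?P x}" unfolding Vstar_def by blast
  moreover have "closed {x. ?P x}"
    by (intro closed_Collect_conj closed_Collect_all closed_Collect_le closed_Collect_eq continuous_intros continuous_bary)
  ultimately have "K \<subseteq> {x. ?P x}" unfolding gasket_eq_closure by (rule closure_minimal)
  then show "0 \<le> bary i x" "x = bary 0 x *\<^sub>R q 0 + bary 1 x *\<^sub>R q 1 + bary 2 x *\<^sub>R q 2"
    using assms by auto
qed

lemma bary_eq_1:
  assumes "x \<in> K" "bary i x = 1" shows "x = q i"
proof -
  have "bary j x = (if j = i then 1 else 0)" for j
    using K_bary(1)[OF assms(1)] bary_sum[of x] assms(2) 
    using exhaust_3'[of i] exhaust_3'[of j] 
    by (smt (verit))
  then show ?thesis using K_bary(2)[OF assms(1)] exhaust_3'[of i] by auto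
qed

text \<open>Comparing \<open>j\<close>-th coordinates gives \<open>bary j x = bary j y + 1\<close>.
  As coordinates on the gasket lie between 0 and 1, this forces \<open>bary j x = 1\<close>, so
  \<open>x\<close> is a corner; the same argument with \<open>i\<close> settles
  \<open>y\<close>.\<close>

lemma F_overlap:
  assumes "x \<in> K" "y \<in> K" "F q i x = F q j y" "i \<noteq> j"
  shows "x = q j" "y = q i"
proof -
  have 1: "(bary k x + (if k = i then 1 else 0)) / 2 = (bary k y + (if k = j then 1 else 0)) / 2" for k
    using assms(3) bary_F[of k i x] bary_F[of k j y] by simp
  have *: "bary k x \<le> 1" "bary k y \<le> 1" for k
    using bary_sum[of x] bary_sum[of y] K_bary(1)[OF assms(1)] K_bary(1)[OF assms(2)] exhaust_3'[of k]
    by (smt (verit))+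
  have "bary j x = 1" using 1[of j] *(1)[of j] K_bary(1)[OF assms(2), of j] assms(4) by auto
  then show "x = q j" using bary_eq_1 assms(1) by blast
  have "bary i y = 1" using 1[of i] *(2)[of i] K_bary(1)[OF assms(1), of i] assms(4) by auto
  then show "y = q i" using bary_eq_1 assms(2) by blast
qed

section \<open>Graph energies\<close>

text \<open>Sum over all words of length \<open>n\<close> and all ordered pairs of vertices of the
  corresponding cell, diagonal pairs included. Being recursive by definition, it turns
  self-similarity arguments into inductions on \<open>n\<close>.\<close>

primrec esum :: "nat \<Rightarrow> (pt \<Rightarrow> pt \<Rightarrow> real) \<Rightarrow> real" where
  "esum 0 P = (\<Sum>i\<in>UNIV. \<Sum>j\<in>UNIV. P (q i) (q j))"
| "esum (Suc n) P = (\<Sum>i\<in>UNIV. esum n (\<lambda>x y. P (F q i x) (F q i y)))"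

definition edges :: "nat \<Rightarrow> (pt \<times> pt) set" where
  "edges n = (SIGMA x:V q n. {y \<in> V q n. neighbors q n x y})"

lemma F_word_V: "length \<alpha> = n \<Longrightarrow> F_word q \<alpha> ` V q 0 \<subseteq> V q n"
proof (induction \<alpha> arbitrary: n)
  case (Cons i \<alpha>)
  then have "F_word q \<alpha> ` V q 0 \<subseteq> V q (length \<alpha>)" by simp
  moreover have "F_word q (i # \<alpha>) ` V q 0 = F q i ` (F_word q \<alpha> ` V q 0)"
    by (simp only: F_word.simps image_comp)
  moreover have "V q n = (\<Union>j. F q j ` V q (length \<alpha>))" using Cons.prems by (metis V.simps(2) length_Cons)
  ultimately show ?case by blast
qed auto

lemma edges_iff: "(x, y) \<in> edges n \<longleftrightarrow> neighbors q n x y"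
  unfolding edges_def neighbors_def using F_word_V by blast

lemma neighbors_0: "neighbors q 0 x y \<longleftrightarrow> x \<noteq> y \<and> x \<in> range q \<and> y \<in> range q"
  by (simp add: neighbors_def)

lemma neighbors_Suc: "neighbors q (Suc n) x y \<longleftrightarrow>
    (\<exists>i x' y'. neighbors q n x' y' \<and> x = F q i x' \<and> y = F q i y')"
proof
  assume "neighbors q (Suc n) x y"
  then obtain \<alpha> where a: "x \<noteq> y" "length \<alpha> = Suc n" "x \<in> F_word q \<alpha> ` V q 0" "y \<in> F_word q \<alpha> ` V q 0"
    unfolding neighbors_def by blast
  then obtain i \<beta> where b: "\<alpha> = i # \<beta>" "length \<beta> = n" by (cases \<alpha>) auto
  obtain x' y' where "x' \<in> F_word q \<beta> ` V q 0" "y' \<in> F_word q \<beta> ` V q 0" "x = F q i x'" "y = F q i y'"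
    using a(3,4) unfolding b by auto
  moreover from this have "neighbors q n x' y'"
    using a(1) b(2) unfolding neighbors_def by (intro conjI exI[of _ \<beta>]) auto
  ultimately show "\<exists>i x' y'. neighbors q n x' y' \<and> x = F q i x' \<and> y = F q i y'"
    by (intro exI conjI)
next
  assume "\<exists>i x' y'. neighbors q n x' y' \<and> x = F q i x' \<and> y = F q i y'"
  then obtain i x' y' \<beta> where "x' \<noteq> y'" "length \<beta> = n" "x' \<in> F_word q \<beta> ` V q 0"
    "y' \<in> F_word q \<beta> ` V q 0" "x = F q i x'" "y = F q i y'"
    unfolding neighbors_def by blast
  moreover have "F_word q (i # \<beta>) ` V q 0 = F q i ` (F_word q \<beta> ` V q 0)"
    by (simp only: F_word.simps image_comp)
  ultimately show "neighbors q (Suc n) x y" unfolding neighbors_def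
    by (intro conjI exI[of _ "i # \<beta>"]) auto
qed

lemma edges_Suc: "edges (Suc n) = (\<Union>i. map_prod (F q i) (F q i) ` edges n)"
proof (rule set_eqI, clarify)
  fix x y
  have "(x, y) \<in> (\<Union>i. map_prod (F q i) (F q i) ` edges n)
      \<longleftrightarrow> (\<exists>i x' y'. (x', y') \<in> edges n \<and> x = F q i x' \<and> y = F q i y')"
    by force
  then show "(x, y) \<in> edges (Suc n) \<longleftrightarrow> (x, y) \<in> (\<Union>i. map_prod (F q i) (F q i) ` edges n)"
    by (simp only: edges_iff neighbors_Suc)
qed

lemma edges_in: "(x, y) \<in> edges n \<Longrightarrow> x \<in> K \<and> y \<in> K \<and> x \<noteq> y"
  using V_subset_K unfolding edges_def neighbors_def by auto

lemma finite_edges: "finite (edges n)"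
  unfolding edges_def using finite_V by auto

text \<open>No edge is counted in two cells: different cells share at most one point, whereas an
  edge has two distinct endpoints. The hypothesis on \<open>P\<close> absorbs the diagonal pairs of
  \<open>esum\<close>.\<close>

lemma sum_edges:
  assumes "\<And>x. P x x = 0"
  shows "(\<Sum>(x,y)\<in>edges n. P x y) = esum n P"
  using assms
proof (induction n arbitrary: P)
  case 0
  have "(\<Sum>(x,y)\<in>edges 0. P x y) = (\<Sum>(x,y)\<in>range q \<times> range q. P x y)"
    using 0 by (intro sum.mono_neutral_left) (auto simp: edges_iff neighbors_0)
  also have "\<dots> = (\<Sum>x\<in>range q. \<Sum>y\<in>range q. P x y)"
    by (simp add: sum.cartesian_product)
  also have "\<dots> = esum 0 P"
    using inj_q by (subst sum.reindex; simp add: inj_def sum.reindex)+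
  finally show ?case .
next
  case (Suc n)
  have "(\<Sum>(x,y)\<in>edges (Suc n). P x y)
      = (\<Sum>i\<in>UNIV. \<Sum>(x,y)\<in>map_prod (F q i) (F q i) ` edges n. P x y)"
    unfolding edges_Suc
  proof (rule sum.UNION_disjoint)
    show "\<forall>i\<in>UNIV. \<forall>j\<in>UNIV. i \<noteq> j \<longrightarrow>
       map_prod (F q i) (F q i) ` edges n \<inter> map_prod (F q j) (F q j) ` edges n = {}"
    proof (intro ballI impI, rule ccontr)
      fix i j :: 3 assume ij: "i \<noteq> j"
        "map_prod (F q i) (F q i) ` edges n \<inter> map_prod (F q j) (F q j) ` edges n \<noteq> {}"
      then obtain x y x' y' where e: "(x, y) \<in> edges n" "(x', y') \<in> edges n"
        "F q i x = F q j x'" "F q i y = F q j y'" by auto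
      then show False using F_overlap(1)[OF _ _ e(3) ij(1)] F_overlap(1)[OF _ _ e(4) ij(1)] edges_in
        by metis
    qed
  qed (use finite_edges in auto)
  also have "\<dots> = (\<Sum>i\<in>UNIV. \<Sum>(x,y)\<in>edges n. P (F q i x) (F q i y))"
    by (rule sum.cong[OF refl], subst sum.reindex) (auto simp: inj_on_def case_prod_unfold)
  also have "\<dots> = esum (Suc n) P"
    using Suc by simp
  finally show ?case .
qed

text \<open>Only pairs in a common cell of level \<open>n\<close> occur, and such a cell has
  diameter at most \<open>diamK / 2 ^ n\<close>. This locality is what lets uniform continuity
  control edge sums later.\<close>

lemma esum_mono:
  assumes "\<And>x y. x \<in> K \<Longrightarrow> y \<in> K \<Longrightarrow> dist x y \<le> diamK / 2 ^ n \<Longrightarrow> P x y \<le> R x y"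
  shows "esum n P \<le> esum n R"
  using assms
proof (induction n arbitrary: P R)
  case 0
  then show ?case using dist_diamK by (auto intro!: sum_mono)
next
  case (Suc n)
  show ?case unfolding esum.simps
    by (intro sum_mono Suc.IH Suc.prems F_in_K) (auto simp: dist_F field_simps)
qed

lemma esum_cong:
  assumes "\<And>x y. x \<in> K \<Longrightarrow> y \<in> K \<Longrightarrow> P x y = R x y"
  shows "esum n P = esum n R"
  by (intro antisym esum_mono) (simp_all add: assms)

lemma esum_add: "esum n (\<lambda>x y. P x y + R x y) = esum n P + esum n R"
  by (induction n arbitrary: P R) (simp_all add: sum.distrib)

lemma esum_cmult: "esum n (\<lambda>x y. c * P x y) = c * esum n P"
  by (induction n arbitrary: P) (simp_all add: sum_distrib_left)

text \<open>The factor 1/2 compensates for ordered pairs; 5/3 is the energy renormalization of the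
  gasket. Linearity and monotonicity of \<open>Q\<close> reduce all later identities and estimates
  to a single edge.\<close>

definition Q :: "nat \<Rightarrow> (pt \<Rightarrow> pt \<Rightarrow> real) \<Rightarrow> real" where
  "Q n P = 1/2 * (5/3)^n * esum n P"

lemma Q_mono:
  assumes "\<And>x y. x \<in> K \<Longrightarrow> y \<in> K \<Longrightarrow> dist x y \<le> diamK / 2 ^ n \<Longrightarrow> P x y \<le> R x y"
  shows "Q n P \<le> Q n R"
  unfolding Q_def using esum_mono[of n P R] assms by (simp add: mult_left_mono)

lemma Q_cong:
  assumes "\<And>x y. x \<in> K \<Longrightarrow> y \<in> K \<Longrightarrow> P x y = R x y"
  shows "Q n P = Q n R"
  unfolding Q_def using esum_cong[of P R n] assms by simp

lemma Q_add: "Q n (\<lambda>x y. P x y + R x y) = Q n P + Q n R"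
  unfolding Q_def esum_add by (simp add: algebra_simps)

lemma Q_cmult: "Q n (\<lambda>x y. c * P x y) = c * Q n P"
  unfolding Q_def esum_cmult by simp

lemma Q_diff: "Q n (\<lambda>x y. P x y - R x y) = Q n P - Q n R"
  using Q_add[of n "\<lambda>x y. P x y - R x y" R] by simp

lemma Q_zero [simp]: "Q n (\<lambda>x y. 0) = 0"
  using Q_cmult[of n 0 "\<lambda>x y. 0"] by simp

lemma Q_nonneg: "(\<And>x y. x \<in> K \<Longrightarrow> y \<in> K \<Longrightarrow> 0 \<le> P x y) \<Longrightarrow> 0 \<le> Q n P"
  using Q_mono[of n "\<lambda>x y. 0" P] by simp

lemma Q_Suc: "Q (Suc n) P = (\<Sum>i\<in>UNIV. 5/3 * Q n (\<lambda>x y. P (F q i x) (F q i y)))"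
  unfolding Q_def by (simp add: sum_distrib_left mult.assoc)

lemma graph_energy_eq: "graph_energy q n u = Q n (\<lambda>x y. (u x - u y)\<^sup>2)"
proof -
  have "(\<Sum>x\<in>V q n. \<Sum>y\<in>{y \<in> V q n. neighbors q n x y}. (u x - u y)\<^sup>2)
      = (\<Sum>(x,y)\<in>edges n. (u x - u y)\<^sup>2)"
    unfolding edges_def using finite_V by (subst sum.Sigma) auto
  then show ?thesis unfolding graph_energy_def Q_def using sum_edges[of "\<lambda>x y. (u x - u y)\<^sup>2" n] by simp
qed

section \<open>Bilinear graph energies and their monotonicity\<close>

definition En :: "nat \<Rightarrow> (pt \<Rightarrow> real) \<Rightarrow> (pt \<Rightarrow> real) \<Rightarrow> real" where
  "En n u v = Q n (\<lambda>x y. (u x - u y) * (v x - v y))"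

lemma graph_energy_En: "graph_energy q n u = En n u u"
  unfolding graph_energy_eq En_def by (simp add: power2_eq_square)

lemma En_Suc: "En (Suc n) u v = (\<Sum>i\<in>UNIV. 5/3 * En n (\<lambda>x. u (F q i x)) (\<lambda>x. v (F q i x)))"
  unfolding En_def Q_Suc by simp

lemma En_0: "En 0 u v = (u (q 0) - u (q 1)) * (v (q 0) - v (q 1)) +
    (u (q 0) - u (q 2)) * (v (q 0) - v (q 2)) + (u (q 1) - u (q 2)) * (v (q 1) - v (q 2))"
  unfolding En_def Q_def by (simp add: sum_3' field_simps)

text \<open>
  The deviation of \<open>u\<close> at a junction point from the $\frac25$-$\frac25$-$\frac15$ rule. The energy on
  level 1 exceeds that on level 0 by a positive definite quadratic form in the three deviations, which
  gives at once the monotonicity of the graph energies and their invariance for harmonic functions.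
\<close>

definition dev :: "(pt \<Rightarrow> real) \<Rightarrow> 3 \<Rightarrow> 3 \<Rightarrow> 3 \<Rightarrow> real" where
  "dev u i j k = u (F q i (q j)) - (2 * u (q i) + 2 * u (q j) + u (q k)) / 5"

text \<open>Split a function into its harmonic extension to level 1 and the deviations. The harmonic
  part keeps its level 0 energy owing to the factor 5/3, and the cross terms vanish. In the
  deviation part each junction point has two junction neighbors, giving the differences, and two
  corner neighbors, giving the factor 2.\<close>

lemma En_1: "En (Suc 0) u v = En 0 u v + 
    5/3 * ((dev u 0 1 2 - dev u 0 2 1) * (dev v 0 1 2 - dev v 0 2 1) +
           (dev u 0 1 2 - dev u 1 2 0) * (dev v 0 1 2 - dev v 1 2 0) +
           (dev u 0 2 1 - dev u 1 2 0) * (dev v 0 2 1 - dev v 1 2 0) +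
           2 * (dev u 0 1 2 * dev v 0 1 2 + dev u 0 2 1 * dev v 0 2 1 + dev u 1 2 0 * dev v 1 2 0))"
  unfolding En_Suc En_0 sum_3' F_q dev_def F_q_commute[of 1 0] F_q_commute[of 2 0] F_q_commute[of 2 1]
  by (simp add: field_simps)

lemma En_mono_Suc: "En n u u \<le> En (Suc n) u u"
proof (induction n arbitrary: u)
  case 0
  have "a \<le> a + 5/3 * ((b - c) * (b - c) + (b - d) * (b - d) + (c - d) * (c - d)
      + 2 * (b * b + c * c + d * d))" for a b c d :: real
    by (simp add: add_nonneg_nonneg)
  then show ?case unfolding En_1 .
next
  case (Suc n)
  then show ?case unfolding En_Suc[of "Suc n"] En_Suc[of n] by (intro sum_mono) simp
qed

lemma En_mono: "m \<le> n \<Longrightarrow> En m u u \<le> En n u u"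
  by (rule lift_Suc_mono_le) (auto intro: En_mono_Suc)

lemma En_commute: "En n u v = En n v u"
  unfolding En_def by (simp add: mult.commute)

lemma En_nonneg: "0 \<le> En n u u"
  unfolding En_def by (intro Q_nonneg) simp

section \<open>The limit energy and its domain as an algebra\<close>

lemma \<C>_I:
  assumes "continuous_on K u" "\<And>n. En n u u \<le> B"
  shows "u \<in> \<C> q"
proof -
  have "incseq (\<lambda>n. En n u u)" by (simp add: En_mono incseq_def)
  then have "convergent (\<lambda>n. En n u u)" 
    using incseq_convergent[of "\<lambda>n. En n u u" B] assms(2) unfolding convergent_def by metis
  then show ?thesis using assms(1) unfolding \<C>_def by (simp add: graph_energy_En)
qed

lemma \<C>_cont: "u \<in> \<C> q \<Longrightarrow> continuous_on K u"
  unfolding \<C>_def by simp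

lemma energy1_lim: "u \<in> \<C> q \<Longrightarrow> (\<lambda>n. En n u u) \<longlonglongrightarrow> energy1 q u"
  unfolding \<C>_def energy1_def by (simp add: graph_energy_En convergent_LIMSEQ_iff)

lemma En_le_energy1: "u \<in> \<C> q \<Longrightarrow> En n u u \<le> energy1 q u"
  using incseq_le[OF _ energy1_lim, of u n] by (simp add: En_mono incseq_def)

lemma energy1_nonneg: "u \<in> \<C> q \<Longrightarrow> 0 \<le> energy1 q u"
  using En_nonneg[of 0 u] En_le_energy1[of u 0] by linarith

text \<open>Domination of squared increments passes to every graph energy, hence bounds them
  uniformly. Closure of \<open>\<C>\<close> under linear combinations, products and Lipschitz
  functions consists of instances of this.\<close>

lemma \<C>_dom:
  assumes "continuous_on K w" "u \<in> \<C> q" "v \<in> \<C> q" "0 \<le> A" "0 \<le> B"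
    and "\<And>x y. x \<in> K \<Longrightarrow> y \<in> K \<Longrightarrow> (w x - w y)\<^sup>2 \<le> A * (u x - u y)\<^sup>2 + B * (v x - v y)\<^sup>2"
  shows "w \<in> \<C> q"
proof (rule \<C>_I)
  show "En n w w \<le> A * energy1 q u + B * energy1 q v" for n
  proof -
    have "En n w w \<le> Q n (\<lambda>x y. A * ((u x - u y) * (u x - u y)) + B * ((v x - v y) * (v x - v y)))"
      unfolding En_def using assms(6) by (intro Q_mono) (simp add: power2_eq_square)
    also have "\<dots> = A * En n u u + B * En n v v" unfolding Q_add Q_cmult En_def ..
    also have "\<dots> \<le> A * energy1 q u + B * energy1 q v"
      using assms En_le_energy1 by (intro add_mono mult_left_mono) auto
    finally show ?thesis .
  qed
qed fact

lemma \<C>_const [simp]: "(\<lambda>x. c) \<in> \<C> q"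
  by (rule \<C>_I[where B = 0]) (auto simp: En_def)

lemma \<C>_lin:
  assumes "u \<in> \<C> q" "v \<in> \<C> q" shows "(\<lambda>x. a * u x + b * v x) \<in> \<C> q"
proof (rule \<C>_dom[OF _ assms, of _ "2 * a\<^sup>2" "2 * b\<^sup>2"])
  show "continuous_on K (\<lambda>x. a * u x + b * v x)"
    using assms by (intro continuous_intros \<C>_cont)
  show "((a * u x + b * v x) - (a * u y + b * v y))\<^sup>2 \<le> 2 * a\<^sup>2 * (u x - u y)\<^sup>2 + 2 * b\<^sup>2 * (v x - v y)\<^sup>2" for x y
  proof -
    have "0 \<le> (a * (u x - u y) - b * (v x - v y))\<^sup>2" by simp
    then show ?thesis by (simp add: power2_eq_square algebra_simps)
  qed
qed auto

lemma \<C>_add: "u \<in> \<C> q \<Longrightarrow> v \<in> \<C> q \<Longrightarrow> (\<lambda>x. u x + v x) \<in> \<C> q"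
  and \<C>_diff: "u \<in> \<C> q \<Longrightarrow> v \<in> \<C> q \<Longrightarrow> (\<lambda>x. u x - v x) \<in> \<C> q"
  and \<C>_cmult: "u \<in> \<C> q \<Longrightarrow> (\<lambda>x. c * u x) \<in> \<C> q"
  using \<C>_lin[of u v 1 1] \<C>_lin[of u v 1 "-1"] \<C>_lin[of u u c 0] by simp_all

lemma \<C>_mult:
  assumes "u \<in> \<C> q" "v \<in> \<C> q" shows "(\<lambda>x. u x * v x) \<in> \<C> q"
proof -
  obtain A B where A: "\<And>x. x \<in> K \<Longrightarrow> \<bar>u x\<bar> \<le> A" and B: "\<And>x. x \<in> K \<Longrightarrow> \<bar>v x\<bar> \<le> B"
    using compact_continuous_image[OF \<C>_cont compact_K] assms
    by (metis (no_types) bounded_iff compact_imp_bounded imageI real_norm_def)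
  show ?thesis
  proof (rule \<C>_dom[OF _ assms, of _ "2 * B\<^sup>2" "2 * A\<^sup>2"])
    show "continuous_on K (\<lambda>x. u x * v x)"
      using assms by (intro continuous_intros \<C>_cont)
    show "(u x * v x - u y * v y)\<^sup>2 \<le> 2 * B\<^sup>2 * (u x - u y)\<^sup>2 + 2 * A\<^sup>2 * (v x - v y)\<^sup>2"
      if "x \<in> K" "y \<in> K" for x y
    proof -
      have "(u x * v x - u y * v y)\<^sup>2 = (v x * (u x - u y) + u y * (v x - v y))\<^sup>2"
        by (simp add: algebra_simps)
      also have "\<dots> \<le> 2 * ((v x)\<^sup>2 * (u x - u y)\<^sup>2) + 2 * ((u y)\<^sup>2 * (v x - v y)\<^sup>2)"
        using zero_le_power2[of "v x * (u x - u y) - u y * (v x - v y)"]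
        by (simp add: power2_sum power2_diff power_mult_distrib)
      also have "\<dots> \<le> 2 * (B\<^sup>2 * (u x - u y)\<^sup>2) + 2 * (A\<^sup>2 * (v x - v y)\<^sup>2)"
        using A[OF that(2)] B[OF that(1)]
        by (intro add_mono mult_left_mono mult_right_mono) (auto simp: abs_le_square_iff[symmetric])
      finally show ?thesis by simp
    qed
  qed auto
qed

lemma \<C>_lip:
  assumes "u \<in> \<C> q" "continuous_on (u ` K) \<phi>"
    and "\<And>x y. x \<in> K \<Longrightarrow> y \<in> K \<Longrightarrow> \<bar>\<phi> (u x) - \<phi> (u y)\<bar> \<le> L * \<bar>u x - u y\<bar>"
  shows "(\<lambda>x. \<phi> (u x)) \<in> \<C> q"
proof (rule \<C>_dom[OF _ assms(1) assms(1), of _ "L\<^sup>2" 0])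
  show "continuous_on K (\<lambda>x. \<phi> (u x))"
    using continuous_on_compose[OF \<C>_cont[OF assms(1)] assms(2)] by (simp add: o_def)
  show "(\<phi> (u x) - \<phi> (u y))\<^sup>2 \<le> L\<^sup>2 * (u x - u y)\<^sup>2 + 0 * (u x - u y)\<^sup>2" if "x \<in> K" "y \<in> K" for x y
    using power_mono[OF assms(3)[OF that], of 2] by (simp add: power_mult_distrib)
qed auto

text \<open>The polarization identity that defines \<open>energy\<close> holds on every level
  already, edge by edge.\<close>

lemma energy_lim:
  assumes "u \<in> \<C> q" "v \<in> \<C> q"
  shows "(\<lambda>n. En n u v) \<longlonglongrightarrow> energy q u v"
proof -
  have eq: "En n u v = (En n (\<lambda>x. u x + v x) (\<lambda>x. u x + v x) - En n (\<lambda>x. u x - v x) (\<lambda>x. u x - v x)) / 4" for n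
  proof -
    have "En n (\<lambda>x. u x + v x) (\<lambda>x. u x + v x) - En n (\<lambda>x. u x - v x) (\<lambda>x. u x - v x)
        = Q n (\<lambda>x y. 4 * ((u x - u y) * (v x - v y)))"
      unfolding En_def Q_diff[symmetric] by (rule Q_cong) (simp add: algebra_simps)
    then show ?thesis unfolding Q_cmult En_def by simp
  qed
  show ?thesis unfolding energy_def ext[OF eq, of "\<lambda>n. n"] using assms
    by (intro tendsto_intros energy1_lim \<C>_add \<C>_diff) auto
qed

lemma energy_self: "u \<in> \<C> q \<Longrightarrow> energy q u u = energy1 q u"
  using LIMSEQ_unique[OF energy_lim energy1_lim] by blast

lemma \<C>_F: "u \<in> \<C> q \<Longrightarrow> (\<lambda>x. u (F q i x)) \<in> \<C> q"
proof (rule \<C>_I)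
  assume u: "u \<in> \<C> q"
  show "continuous_on K (\<lambda>x. u (F q i x))"
    by (rule continuous_on_compose2[OF \<C>_cont[OF u] continuous_F]) (auto simp: F_in_K)
  show "En n (\<lambda>x. u (F q i x)) (\<lambda>x. u (F q i x)) \<le> 3/5 * energy1 q u" for n
  proof -
    have "5/3 * En n (\<lambda>x. u (F q i x)) (\<lambda>x. u (F q i x)) \<le> En (Suc n) u u"
      unfolding En_Suc by (rule member_le_sum) (auto intro: En_nonneg)
    also have "\<dots> \<le> energy1 q u" using En_le_energy1 u by blast
    finally show ?thesis by simp
  qed
qed

lemma energy1_F:
  assumes "u \<in> \<C> q"
  shows "energy1 q u = (\<Sum>i\<in>UNIV. 5/3 * energy1 q (\<lambda>x. u (F q i x)))"
proof -
  have "(\<lambda>n. En (Suc n) u u) \<longlonglongrightarrow> (\<Sum>i\<in>UNIV. 5/3 * energy1 q (\<lambda>x. u (F q i x)))"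
    unfolding En_Suc using assms by (intro tendsto_intros energy1_lim \<C>_F)
  then show ?thesis using LIMSEQ_unique[OF LIMSEQ_Suc[OF energy1_lim[OF assms]]] by blast
qed

end

section \<open>Harmonic functions\<close>

text \<open>If \<open>d\<close> lists the values of the three harmonic basis functions at a point,
  the result lists them at its image under \<open>F q i\<close>. It is the 2/5-2/5-1/5 rule with the
  sum of \<open>d\<close> replaced by 1: for \<open>k = i\<close> it is d i + 2/5 (1 - d i),
  otherwise 2/5 d k + 1/5 (1 - d i - d k).\<close>

definition harm_step :: "3 \<Rightarrow> 3 \<Rightarrow> (3 \<Rightarrow> real) \<Rightarrow> real" where
  "harm_step i k d = (if k = i then 2/5 + 3/5 * d i else 1/5 + 1/5 * d k - 1/5 * d i)"

text \<open>The absolute values of the coefficients sum to 3/5 or 2/5. The ratio 3/5 below 1 yields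
  uniform convergence of \<open>psi_n\<close>.\<close>

lemma harm_step_contraction:
  assumes "\<And>k. \<bar>d k - e k\<bar> \<le> c"
  shows "\<bar>harm_step i k d - harm_step i k e\<bar> \<le> 3/5 * c"
  using assms[of i] assms[of k] unfolding harm_step_def abs_le_iff by (cases "k = i"; simp; linarith?)

lemma harm_step_simplex:
  assumes "\<And>k. 0 \<le> d k" "(\<Sum>k\<in>UNIV. d k) = 1"
  shows "0 \<le> harm_step i k d" "(\<Sum>k\<in>UNIV. harm_step i k d) = 1"
proof -
  have *: "d 0 \<ge> 0" "d 1 \<ge> 0" "d 2 \<ge> 0" "d 0 + d 1 + d 2 = 1" using assms by (auto simp: sum_3')
  show "0 \<le> harm_step i k d"
    using exhaust_3'[of i] exhaust_3'[of k] * unfolding harm_step_def by (elim disjE; simp; linarith?)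
  show "(\<Sum>k\<in>UNIV. harm_step i k d) = 1"
    using exhaust_3'[of i] * unfolding harm_step_def sum_3' by (elim disjE; simp; linarith?)
qed

context triangle begin

section \<open>Construction of the harmonic basis\<close>

definition F_inv :: "3 \<Rightarrow> pt \<Rightarrow> pt" where
  "F_inv i x = 2 *\<^sub>R (x - q i) + q i"

lemma F_inv_F [simp]: "F_inv i (F q i x) = x" and F_F_inv [simp]: "F q i (F_inv i x) = x"
  by (simp_all add: F_inv_def F_def)

text \<open>
  The values of the harmonic basis on the cell \<open>i\<close> are determined by those at the three vertices of
  the cell via \<open>harm_step\<close>. The choice of \<open>i\<close> is immaterial because two cells share only a junction
  point, where both rules agree.
\<close>

primrec psi_n :: "nat \<Rightarrow> pt \<Rightarrow> 3 \<Rightarrow> real" where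
  "psi_n 0 x = (\<lambda>k. bary k x)"
| "psi_n (Suc n) x = (let i = (SOME i. F_inv i x \<in> K) in (\<lambda>k. harm_step i k (psi_n n (F_inv i x))))"

text \<open>The choice in \<open>psi_n\<close> may pick another cell only at a junction point, and
  there the vertex values make both rules agree. They appear as a hypothesis because
  \<open>psi_n_q\<close> is itself proved by induction through this lemma.\<close>

lemma psi_n_F_if:
  assumes q: "\<And>j k. psi_n n (q j) k = (if k = j then 1 else 0)" and x: "x \<in> K"
  shows "psi_n (Suc n) (F q i x) k = harm_step i k (psi_n n x)"
proof -
  define l where "l = (SOME l. F_inv l (F q i x) \<in> K)"
  define y where "y = F_inv l (F q i x)"
  have y: "y \<in> K" unfolding y_def l_def by (rule someI[of _ i]) (simp add: x)
  have eq: "F q l y = F q i x" by (simp add: y_def)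
  have "psi_n (Suc n) (F q i x) k = harm_step l k (psi_n n y)"
    unfolding psi_n.simps(2) Let_def l_def[symmetric] y_def ..
  also have "\<dots> = harm_step i k (psi_n n x)"
  proof (cases "l = i")
    case False
    then have "y = q i" "x = q l" using F_overlap[OF y x eq] by auto
    then show ?thesis using False by (auto simp: harm_step_def q)
  qed (use eq in simp)
  finally show ?thesis .
qed

lemma psi_n_q: "psi_n n (q j) k = (if k = j then 1 else 0)"
proof (induction n arbitrary: j k)
  case (Suc n)
  have "psi_n (Suc n) (F q j (q j)) k = harm_step j k (psi_n n (q j))"
    by (rule psi_n_F_if[OF Suc q_in_K])
  then show ?case using Suc by (auto simp: harm_step_def simp del: psi_n.simps)
qed (simp add: bary_q)

lemma psi_n_F: "x \<in> K \<Longrightarrow> psi_n (Suc n) (F q i x) k = harm_step i k (psi_n n x)"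
  by (rule psi_n_F_if[OF psi_n_q])

lemma psi_n_simplex: 
  assumes "x \<in> K" shows "0 \<le> psi_n n x k" "(\<Sum>k\<in>UNIV. psi_n n x k) = 1"
proof -
  have "(\<forall>k. 0 \<le> psi_n n x k) \<and> (\<Sum>k\<in>UNIV. psi_n n x k) = 1" using assms
  proof (induction n arbitrary: x)
    case 0
    then show ?case using K_bary(1) bary_sum[of x] by (simp add: sum_3')
  next
    case (Suc n)
    from Suc(2) obtain i y where y: "y \<in> K" "x = F q i y" by (rule K_cases)
    show ?case unfolding y(2) psi_n_F[OF y(1)] using Suc(1)[OF y(1)] harm_step_simplex[of "psi_n n y"] by blast
  qed
  then show "0 \<le> psi_n n x k" "(\<Sum>k\<in>UNIV. psi_n n x k) = 1" by auto
qed

lemma continuous_psi_n: "continuous_on K (\<lambda>x. psi_n n x k)"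
proof (induction n arbitrary: k)
  case 0
  show ?case using continuous_bary by simp
next
  case (Suc n)
  have "continuous_on (\<Union>i\<in>UNIV. F q i ` K) (\<lambda>x. psi_n (Suc n) x k)"
  proof (rule continuous_on_closed_Union)
    fix i
    show "closed (F q i ` K)"
      by (intro compact_imp_closed compact_continuous_image continuous_F compact_K)
    have inv: "continuous_on (F q i ` K) (F_inv i)" unfolding F_inv_def by (intro continuous_intros)
    have "continuous_on (F q i ` K) (\<lambda>x. psi_n n (F_inv i x) l)" for l
      by (rule continuous_on_compose2[OF Suc inv]) auto
    then have "continuous_on (F q i ` K) (\<lambda>x. harm_step i k (psi_n n (F_inv i x)))"
      unfolding harm_step_def by (cases "k = i") (auto intro!: continuous_intros)
    then show "continuous_on (F q i ` K) (\<lambda>x. psi_n (Suc n) x k)"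
      by (rule continuous_on_eq) (use psi_n_F in auto)
  qed simp
  then show ?case using K_eq by simp
qed

text \<open>The limit of \<open>psi_n\<close>, written as a telescoping series so that the
  Weierstrass test with terms (3/5)^n applies.\<close>

definition psi :: "3 \<Rightarrow> pt \<Rightarrow> real" where
  "psi k x = psi_n 0 x k + (\<Sum>n. psi_n (Suc n) x k - psi_n n x k)"

lemma psi_uniform: "uniform_limit K (\<lambda>n x. psi_n n x k) (psi k) sequentially"
proof -
  have b: "\<bar>psi_n (Suc n) x k - psi_n n x k\<bar> \<le> (3/5)^n" if "x \<in> K" for n x k using that
  proof (induction n arbitrary: x k)
    case 0
    have "psi_n m x k \<in> {0..1}" for m 
      using psi_n_simplex[OF 0, of m] member_le_sum[of k UNIV "psi_n m x"] by auto
    from this[of 0] this[of 1] show ?case by auto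
  next
    case (Suc n)
    from Suc(2) obtain i y where y: "y \<in> K" "x = F q i y" by (rule K_cases)
    show ?case unfolding y(2) psi_n_F[OF y(1)] power_Suc
      by (rule harm_step_contraction) (rule Suc(1)[OF y(1)])
  qed
  have "uniform_limit K (\<lambda>n x. \<Sum>i<n. psi_n (Suc i) x k - psi_n i x k)
      (\<lambda>x. \<Sum>i. psi_n (Suc i) x k - psi_n i x k) sequentially"
    by (rule Weierstrass_m_test[where M = "\<lambda>n. (3/5)^n"]) (use b in \<open>auto intro: summable_geometric\<close>)
  then have "uniform_limit K (\<lambda>n x. psi_n 0 x k + (\<Sum>i<n. psi_n (Suc i) x k - psi_n i x k)) (psi k) sequentially"
    unfolding psi_def by (intro uniform_limit_add uniform_limit_const)
  moreover have "psi_n 0 x k + (\<Sum>i<n. psi_n (Suc i) x k - psi_n i x k) = psi_n n x k" for n x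
    using sum_lessThan_telescope[of "\<lambda>i. psi_n i x k" n] by simp
  ultimately show ?thesis by (simp only:)
qed

lemma psi_lim: "x \<in> K \<Longrightarrow> (\<lambda>n. psi_n n x k) \<longlonglongrightarrow> psi k x"
  using tendsto_uniform_limitI[OF psi_uniform] .

lemma continuous_psi: "continuous_on K (psi k)"
  by (rule uniform_limit_theorem[OF always_eventually psi_uniform]) (auto intro: continuous_psi_n)

lemma psi_q: "psi k (q j) = (if k = j then 1 else 0)"
  using psi_lim[OF q_in_K, of j k] unfolding psi_n_q by (simp add: LIMSEQ_const_iff)

lemma psi_F: "x \<in> K \<Longrightarrow> psi k (F q i x) = harm_step i k (\<lambda>k. psi k x)"
proof -
  assume x: "x \<in> K"
  have "(\<lambda>n. psi_n (Suc n) (F q i x) k) \<longlonglongrightarrow> harm_step i k (\<lambda>k. psi k x)"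
    unfolding psi_n_F[OF x] harm_step_def
    by (cases "k = i") (auto intro!: tendsto_intros psi_lim x)
  then show ?thesis using LIMSEQ_unique[OF LIMSEQ_Suc[OF psi_lim[OF F_in_K[OF x]]]] by blast
qed

lemma psi_simplex: 
  assumes "x \<in> K" shows "0 \<le> psi k x" "psi 0 x + psi 1 x + psi 2 x = 1"
proof -
  show "0 \<le> psi k x" by (rule LIMSEQ_le_const[OF psi_lim[OF assms]]) (use psi_n_simplex[OF assms] in auto)
  have "(\<lambda>n. \<Sum>k\<in>UNIV. psi_n n x k) \<longlonglongrightarrow> (\<Sum>k\<in>UNIV. psi k x)"
    by (intro tendsto_intros psi_lim assms)
  then show "psi 0 x + psi 1 x + psi 2 x = 1" unfolding sum_3' psi_n_simplex(2)[OF assms, unfolded sum_3']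
    by (simp add: LIMSEQ_const_iff sum_3')
qed

section \<open>Harmonic extension of boundary values\<close>

definition hext :: "(3 \<Rightarrow> real) \<Rightarrow> pt \<Rightarrow> real" where
  "hext a x = a 0 * psi 0 x + a 1 * psi 1 x + a 2 * psi 2 x"

lemma hext_q [simp]: "hext a (q j) = a j"
  using exhaust_3'[of j] by (auto simp: hext_def psi_q)

lemma continuous_hext: "continuous_on K (hext a)"
  unfolding hext_def by (intro continuous_intros continuous_psi)

text \<open>\<open>harm_step\<close> is affine, and it becomes linear in the coordinates once their
  sum is known to be 1. Hence on each cell the extension is determined linearly by its values at the
  three cell vertices.\<close>

lemma hext_F:
  assumes "x \<in> K"
  shows "hext a (F q i x) = hext (\<lambda>j. hext a (F q i (q j))) x"
proof -
  have s: "psi 2 x = 1 - psi 0 x - psi 1 x" using psi_simplex(2)[OF assms] by simp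
  have h: "psi k (F q i x) = psi 0 x * psi k (F q i (q 0)) + psi 1 x * psi k (F q i (q 1)) + psi 2 x * psi k (F q i (q 2))" for k
    using exhaust_3'[of i] exhaust_3'[of k] unfolding psi_F[OF assms] psi_F[OF q_in_K] harm_step_def psi_q s
    by (elim disjE; simp add: s; (simp add: field_simps)?)
  show ?thesis unfolding hext_def h by (simp add: algebra_simps)
qed

lemma dev_hext: "dev (hext a) 0 1 2 = 0" "dev (hext a) 0 2 1 = 0" "dev (hext a) 1 2 0 = 0"
  unfolding dev_def hext_q
  by (simp_all add: hext_def psi_F harm_step_def psi_q field_simps)

text \<open>On each cell the function is again a harmonic extension, so the induction hypothesis
  collapses level n + 1 to level 1; there all deviations of the extension vanish. The second
  argument is arbitrary, which makes this a discrete Green formula.\<close>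

lemma En_hext: "En n (hext a) u = En 0 (hext a) u"
proof (induction n arbitrary: a u)
  case (Suc n)
  have "En (Suc n) (hext a) u = (\<Sum>i\<in>UNIV. 5/3 * En n (hext (\<lambda>j. hext a (F q i (q j)))) (\<lambda>x. u (F q i x)))"
    unfolding En_Suc unfolding En_def by (intro sum.cong refl arg_cong2[where f="(*)"] Q_cong) (simp add: hext_F[symmetric])
  also have "\<dots> = (\<Sum>i\<in>UNIV. 5/3 * En 0 (\<lambda>x. hext a (F q i x)) (\<lambda>x. u (F q i x)))"
    unfolding Suc by (simp add: En_0)
  also have "\<dots> = En (Suc 0) (hext a) u" unfolding En_Suc ..
  also have "\<dots> = En 0 (hext a) u" unfolding En_1 dev_hext by simp
  finally show ?case .
qed simp

lemma hext_\<C>: "hext a \<in> \<C> q"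
  by (rule \<C>_I[where B = "En 0 (hext a) (hext a)"]) (auto intro: continuous_hext eq_refl En_hext)

lemma psi_eq_hext: "psi k = hext (\<lambda>j. if j = k then 1 else 0)"
  using exhaust_3'[of k] by (auto simp: hext_def fun_eq_iff)

lemma psi_\<C>: "psi k \<in> \<C> q"
  unfolding psi_eq_hext by (rule hext_\<C>)

lemma energy_hext: "u \<in> \<C> q \<Longrightarrow> energy q (hext a) u = En 0 (hext a) u"
proof -
  assume "u \<in> \<C> q"
  moreover have "(\<lambda>n. En n (hext a) u) = (\<lambda>n. En 0 (hext a) u)" by (rule ext) (rule En_hext)
  ultimately show ?thesis using energy_lim[OF hext_\<C>, of u a] by (simp add: LIMSEQ_const_iff)
qed

lemma harmonic_hext: "harmonic q (hext a)"
  unfolding harmonic_def \<C>\<^sub>B_def by (auto simp: hext_\<C> energy_hext En_0)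

lemma energy_diff_left:
  assumes "u \<in> \<C> q" "v \<in> \<C> q" "w \<in> \<C> q"
  shows "energy q (\<lambda>x. u x - v x) w = energy q u w - energy q v w"
proof -
  have "En n (\<lambda>x. u x - v x) w = En n u w - En n v w" for n
    unfolding En_def Q_diff[symmetric] by (rule Q_cong) (simp add: algebra_simps)
  then have "(\<lambda>n. En n (\<lambda>x. u x - v x) w) \<longlonglongrightarrow> energy q u w - energy q v w"
    using assms by (auto intro!: tendsto_intros energy_lim)
  then show ?thesis using LIMSEQ_unique[OF energy_lim[OF \<C>_diff]] assms by blast
qed

text \<open>Zero energy is inherited by all cells, so the function is constant on the vertices of
  each cell. The constants of the cells j and k agree because F_j(q_k) = F_k(q_j) is a common
  junction point.\<close>

lemma energy_0_const:
  assumes "u \<in> \<C> q" "energy1 q u = 0" "x \<in> K"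
  shows "u x = u (q 0)"
proof -
  have "u x = u (q 0)" if "x \<in> V q n" "\<And>n. En n u u = 0" for n x u using that
  proof (induction n arbitrary: u x)
    case 0
    have "(u (q 0) - u (q 1)) * (u (q 0) - u (q 1)) + (u (q 0) - u (q 2)) * (u (q 0) - u (q 2))
        + (u (q 1) - u (q 2)) * (u (q 1) - u (q 2)) = 0"
      using 0(2)[of 0] unfolding En_0 .
    then have "(u (q 0) - u (q 1)) * (u (q 0) - u (q 1)) = 0" "(u (q 0) - u (q 2)) * (u (q 0) - u (q 2)) = 0"
      by (smt (verit) zero_le_square)+
    then have "u (q 1) = u (q 0)" "u (q 2) = u (q 0)" by auto
    moreover obtain j where "x = q j" using 0(1) by auto
    ultimately show ?case using exhaust_3'[of j] by auto
  next
    case (Suc n)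
    obtain i y where y: "y \<in> V q n" "x = F q i y" using Suc.prems(1) by auto
    have "En m (\<lambda>x. u (F q i x)) (\<lambda>x. u (F q i x)) = 0" for m i
    proof -
      have "5/3 * En m (\<lambda>x. u (F q i x)) (\<lambda>x. u (F q i x)) \<le> En (Suc m) u u"
        unfolding En_Suc by (rule member_le_sum) (auto intro: En_nonneg)
      then show ?thesis using Suc.prems(2) En_nonneg[of m "\<lambda>x. u (F q i x)"] by simp
    qed
    then have *: "u (F q i z) = u (F q i (q 0))" if "z \<in> V q n" for z i
      using Suc.IH[OF that, of "\<lambda>x. u (F q i x)"] by simp
    have qn: "q j \<in> V q n" for j using V_subset_Suc lift_Suc_mono_le[of "V q" 0 n] by auto
    have j: "u (q j) = u (F q j (q k))" for j k using *[OF qn, of j j] *[OF qn, of j k] by simp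
    have "u (q j) = u (q k)" for j k
      using j[of j k] j[of k j] by (simp add: F_q_commute)
    then show ?case using *[OF y(1), of i] j[of i 0] y(2) by metis
  qed
  moreover have "En n u u = 0" for n
    using En_nonneg[of n u] En_le_energy1[OF assms(1), of n] assms(2) by simp
  ultimately have "u x = u (q 0)" if "x \<in> Vstar" for x using that unfolding Vstar_def by blast
  then show ?thesis using continuous_constant_on_closure[of Vstar u "u (q 0)" x]
    \<C>_cont[OF assms(1)] assms(3) unfolding gasket_eq_closure by blast
qed

text \<open>The difference of the two harmonic functions lies in \<open>\<C>\<^sub>B\<close>, so it
  is orthogonal to itself in energy and therefore constant, with value 0 at the boundary.\<close>

lemma harmonic_eq_hext:
  assumes "harmonic q u" "x \<in> K"
  shows "u x = hext (\<lambda>i. u (q i)) x"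
proof -
  let ?v = "hext (\<lambda>i. u (q i))"
  let ?d = "\<lambda>x. u x - ?v x"
  have C: "u \<in> \<C> q" "?v \<in> \<C> q" "?d \<in> \<C> q" using assms hext_\<C> \<C>_diff unfolding harmonic_def by auto
  have d: "?d \<in> \<C>\<^sub>B q" using C unfolding \<C>\<^sub>B_def by auto
  have "energy q ?d ?d = energy q u ?d - energy q ?v ?d" by (rule energy_diff_left[OF C])
  also have "\<dots> = 0" using d assms harmonic_hext unfolding harmonic_def by auto
  finally have "energy1 q ?d = 0" using energy_self[OF C(3)] by simp
  from energy_0_const[OF C(3) this assms(2)] show ?thesis by simp
qed

text \<open>Gauss-Green formula for the gasket: the right-hand side involves only boundary values.
  It produces all boundary terms below.\<close>

lemma energy_harmonic:
  assumes "harmonic q u" "v \<in> \<C> q"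
  shows "energy q u v = En 0 u v"
proof -
  define w where "w = hext (\<lambda>i. u (q i))"
  have uw: "x \<in> K \<Longrightarrow> u x = w x" for x
    unfolding w_def by (rule harmonic_eq_hext[OF assms(1)])
  have "En n u v = En n w v" for n
    unfolding En_def by (rule Q_cong) (simp add: uw)
  then have "(\<lambda>n. En n u v) = (\<lambda>n. En 0 u v)"
    unfolding w_def by (metis En_hext)
  then show ?thesis using energy_lim[OF _ assms(2), of u] assms(1) unfolding harmonic_def
    by (simp add: LIMSEQ_const_iff)
qed

lemma harmonic_basis: "harmonic q (harmonic_basis q i)" "harmonic_basis q i (q j) = (if j = i then 1 else 0)"
proof -
  have "harmonic q (psi i) \<and> (\<forall>j. psi i (q j) = (if j = i then 1 else 0))"
    unfolding psi_eq_hext by (simp add: harmonic_hext)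
  from someI[of "\<lambda>\<psi>. harmonic q \<psi> \<and> (\<forall>j. \<psi> (q j) = (if j = i then 1 else 0))", OF this]
  show "harmonic q (harmonic_basis q i)" "harmonic_basis q i (q j) = (if j = i then 1 else 0)"
    unfolding harmonic_basis_def by auto
qed

text \<open>
  Different cells are separated by the coordinates of \<open>psi\<close>: the \<open>i\<close>-th one is at least $\frac25$ on
  cell \<open>i\<close> and at most $\frac25$ on the others.
\<close>

lemma psi_vertex:
  assumes "x \<in> K" "psi j x = 1" shows "x = q j"
proof -
  have "dist x (q j) \<le> diamK / 2 ^ n" for n using assms
  proof (induction n arbitrary: x)
    case 0
    then show ?case using dist_diamK by simp
  next
    case (Suc n)
    from Suc(2) obtain i y where y: "y \<in> K" "x = F q i y" by (rule K_cases)
    have "psi j y \<le> 1" 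
      using psi_simplex(2)[OF y(1)] psi_simplex(1)[OF y(1), of 0] psi_simplex(1)[OF y(1), of 1]
        psi_simplex(1)[OF y(1), of 2] exhaust_3'[of j] by (elim disjE; hypsubst; linarith)
    moreover have "psi i y \<ge> 0" using psi_simplex[OF y(1)] by blast
    \<comment> \<open>For \<open>i\<close> different from \<open>j\<close> the value would be 1/5 +
      (psi j y - psi i y) / 5, which is at most 2/5. So the point stays in cell \<open>j\<close> at
      every level.\<close>
    ultimately have ij: "i = j" using Suc(3) unfolding y(2) psi_F[OF y(1)] harm_step_def
      by (auto split: if_splits)
    then have "psi j y = 1" using Suc(3) unfolding y(2) psi_F[OF y(1)] harm_step_def by simp
    from Suc(1)[OF y(1) this] have "dist (F q j y) (F q j (q j)) \<le> diamK / 2 ^ Suc n" unfolding dist_F by simp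
    then show ?case by (simp add: y(2) ij)
  qed
  then have "dist x (q j) \<le> 0" using LIMSEQ_le_const[OF half_powers_lim] by blast
  then show ?thesis by simp
qed

text \<open>In a common cell \<open>harm_step\<close> is injective and the induction halves the
  distance; in different cells equal coordinates force the common junction point. This is the
  separation of points required by the Stone-Weierstrass theorem.\<close>

lemma psi_inj:
  assumes "x \<in> K" "y \<in> K" "\<And>k. psi k x = psi k y" shows "x = y"
proof -
  have D0: "0 \<le> diamK" using dist_diamK[OF assms(1,1)] by simp
  have "dist x y \<le> diamK / 2 ^ n" for n using assms
  proof (induction n arbitrary: x y)
    case 0
    then show ?case using dist_diamK by simp
  next
    case (Suc n)
    from Suc(2) obtain i x' where x: "x' \<in> K" "x = F q i x'" by (rule K_cases)
    from Suc(3) obtain j y' where y: "y' \<in> K" "y = F q j y'" by (rule K_cases)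
    have eq: "harm_step i k (\<lambda>k. psi k x') = harm_step j k (\<lambda>k. psi k y')" for k
      using Suc(4)[of k] unfolding x(2) y(2) psi_F[OF x(1)] psi_F[OF y(1)] .
    show ?case
    proof (cases "i = j")
      case True
      have i: "psi i x' = psi i y'" using eq[of i] True by (simp add: harm_step_def)
      have "psi k x' = psi k y'" for k using eq[of k] True i by (simp add: harm_step_def split: if_splits)
      from Suc(1)[OF x(1) y(1) this] show ?thesis unfolding x y True dist_F by simp
    next
      case False
      note sx = psi_simplex(2)[OF x(1)] psi_simplex(1)[OF x(1), of 0] psi_simplex(1)[OF x(1), of 1] psi_simplex(1)[OF x(1), of 2]
      note sy = psi_simplex(2)[OF y(1)] psi_simplex(1)[OF y(1), of 0] psi_simplex(1)[OF y(1), of 1] psi_simplex(1)[OF y(1), of 2]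
      have "psi j x' = 1 \<and> psi i y' = 1"
        using exhaust_3'[of i] exhaust_3'[of j] False eq[of i] eq[of j] sx sy
        unfolding harm_step_def by (elim disjE; simp; linarith?)
      then have "x' = q j" "y' = q i" using psi_vertex x(1) y(1) by auto
      then have "x = y" using x(2) y(2) F_q_commute by simp
      then show ?thesis using D0 by simp
    qed
  qed
  then have "dist x y \<le> 0" using LIMSEQ_le_const[OF half_powers_lim] by blast
  then show ?thesis by simp
qed

text \<open>Provides the Stone-Weierstrass theorem for \<open>\<C>\<close>: every continuous
  function on the gasket is a uniform limit of functions of finite energy.\<close>

sublocale function_ring_on "\<C> q" K
proof
  show "\<exists>f\<in>\<C> q. f x \<noteq> f y" if "x \<in> K" "y \<in> K" "x \<noteq> y" for x y
    using psi_inj[OF that(1,2)] that(3) psi_\<C> by blast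
qed (use compact_K \<C>_cont \<C>_add \<C>_mult \<C>_const in auto)

section \<open>Energy measures\<close>

text \<open>
  The energy measure of \<open>f\<close> is realized as a distribution: subdividing an interval of length
  \<open>energy1 q f\<close> in proportion to the energies of the cells of level \<open>n\<close> and sending each piece to a
  point of its cell gives maps that converge uniformly to \<open>quantile f\<close>.
\<close>

primrec quantile_n :: "nat \<Rightarrow> real \<Rightarrow> (pt \<Rightarrow> real) \<Rightarrow> real \<Rightarrow> pt" where
  "quantile_n 0 c f t = q 0"
| "quantile_n (Suc n) c f t =
    (let m = (\<lambda>i. 5/3 * c * energy1 q (\<lambda>x. f (F q i x)))
     in if t < m 0 then F q 0 (quantile_n n (5/3 * c) (\<lambda>x. f (F q 0 x)) t)
        else if t < m 0 + m 1 then F q 1 (quantile_n n (5/3 * c) (\<lambda>x. f (F q 1 x)) (t - m 0))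
        else F q 2 (quantile_n n (5/3 * c) (\<lambda>x. f (F q 2 x)) (t - (m 0 + m 1))))"

text \<open>A Riemann sum: \<open>g\<close> is sampled at the image of \<open>q 0\<close> in each
  cell of level \<open>n\<close> and weighted with the energy of \<open>f\<close> on that cell. The
  factors 5/3 come from the scaling of energy under \<open>F\<close>.\<close>

primrec cell_sum :: "nat \<Rightarrow> (pt \<Rightarrow> real) \<Rightarrow> (pt \<Rightarrow> real) \<Rightarrow> real" where
  "cell_sum 0 f g = energy1 q f * g (q 0)"
| "cell_sum (Suc n) f g = (\<Sum>i\<in>UNIV. 5/3 * cell_sum n (\<lambda>x. f (F q i x)) (\<lambda>x. g (F q i x)))"

lemma quantile_n_K: "quantile_n n c f t \<in> K"
  by (induction n arbitrary: c f t) (auto simp: Let_def intro: F_in_K)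

lemma borel_measurable_F [measurable]: "F q i \<in> borel_measurable borel"
  by (rule borel_measurable_continuous_onI[OF continuous_F])

lemma quantile_n_measurable [measurable]: "quantile_n n c f \<in> borel_measurable borel"
proof (induction n arbitrary: c f)
  case 0
  show ?case by (simp add: fun_eq_iff[of "quantile_n 0 c f"] measurable_cong[of _ "quantile_n 0 c f" "\<lambda>_. q 0"])
next
  case (Suc n)
  note [measurable] = Suc
  let ?m = "\<lambda>i. 5/3 * c * energy1 q (\<lambda>x. f (F q i x))"
  have "quantile_n (Suc n) c f = (\<lambda>t. if t < ?m 0 then F q 0 (quantile_n n (5/3 * c) (\<lambda>x. f (F q 0 x)) t)
        else if t < ?m 0 + ?m 1 then F q 1 (quantile_n n (5/3 * c) (\<lambda>x. f (F q 1 x)) (t - ?m 0))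
        else F q 2 (quantile_n n (5/3 * c) (\<lambda>x. f (F q 2 x)) (t - (?m 0 + ?m 1))))"
    by (rule ext) (simp only: quantile_n.simps Let_def)
  also have "\<dots> \<in> borel_measurable borel" by measurable
  finally show ?case .
qed

text \<open>The first \<open>n\<close> choices of a cell coincide for both maps, since they depend
  only on \<open>t\<close> and the energies; both values lie in the same cell of level
  \<open>n\<close>.\<close>

lemma quantile_n_step: "dist (quantile_n n c f t) (quantile_n (Suc n) c f t) \<le> diamK / 2 ^ n"
proof (induction n arbitrary: c f t)
  case 0
  show ?case using dist_diamK[OF quantile_n_K[of 0 c f t] quantile_n_K[of "Suc 0" c f t]]
    by (simp only: power_0 div_by_1)
next
  case (Suc n)
  have *: "dist (quantile_n n c f t) (quantile_n (Suc n) c f t) / 2 \<le> diamK / 2 ^ Suc n" for c f t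
    using Suc[of c f t] by simp
  show ?case
    unfolding quantile_n.simps(2)[of n c f t] quantile_n.simps(2)[of "Suc n" c f t] Let_def
    by (auto simp only: dist_F * split: if_split)
qed

lemma quantile_integral:
  assumes "f \<in> \<C> q" "0 \<le> c"
  shows "((\<lambda>t. g (quantile_n n c f t)) has_integral c * cell_sum n f g) {0..c * energy1 q f}"
  using assms
proof (induction n arbitrary: c f g)
  case 0
  then have "0 \<le> c * energy1 q f" using energy1_nonneg by simp
  then show ?case using has_integral_const_real[of "g (q 0)" 0 "c * energy1 q f"] by (simp add: mult.assoc)
next
  case (Suc n)
  define m where "m i = 5/3 * c * energy1 q (\<lambda>x. f (F q i x))" for i
  have m: "0 \<le> m i" for i unfolding m_def using Suc.prems energy1_nonneg \<C>_F by simp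
  have tot: "c * energy1 q f = m 0 + m 1 + m 2"
    unfolding energy1_F[OF Suc.prems(1)] m_def sum_3' by (simp add: algebra_simps)
  let ?f = "\<lambda>t. g (quantile_n (Suc n) c f t)"
  let ?I = "\<lambda>i. 5/3 * c * cell_sum n (\<lambda>x. f (F q i x)) (\<lambda>x. g (F q i x))"
  let ?h = "\<lambda>i t. g (F q i (quantile_n n (5/3 * c) (\<lambda>x. f (F q i x)) t))"
  have IH: "(?h i has_integral ?I i) {0..m i}" for i
    using Suc.IH[OF \<C>_F[OF Suc.prems(1), of i], of "5/3 * c" "\<lambda>x. g (F q i x)"] Suc.prems(2)
    unfolding m_def by (simp add: mult.assoc)
  have IH': "((\<lambda>t. ?h i (t - a)) has_integral ?I i) {a..a + m i}" for i a
    using IH[of i] has_integral_shift_Icc_real[of "\<lambda>t. ?h i (t - a)" a "?I i" 0 "m i"]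
    by (simp add: add.commute o_def)
  have fe: "?f t = (if t < m 0 then ?h 0 t else if t < m 0 + m 1 then ?h 1 (t - m 0) else ?h 2 (t - (m 0 + m 1)))" for t
    by (simp add: m_def Let_def)
  \<comment> \<open>The branches are taken on half-open intervals, so the formula for a piece can
    fail only at its right endpoint. The last piece has no exceptional point.\<close>
  have 0: "(?f has_integral ?I 0) {0..m 0}"
    by (rule has_integral_spike_finite[OF _ _ IH, of "{m 0}"]) (simp_all only: fe, auto)
  have 1: "(?f has_integral ?I 1) {m 0..m 0 + m 1}"
    by (rule has_integral_spike_finite[OF _ _ IH', of "{m 0 + m 1}"]) (simp_all only: fe, auto)
  have 2: "(?f has_integral ?I 2) {m 0 + m 1..m 0 + m 1 + m 2}"
    by (rule has_integral_spike_finite[OF _ _ IH', of "{}"]) (simp_all only: fe, use m[of 1] in auto)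
  have "(?f has_integral ?I 0 + ?I 1 + ?I 2) {0..m 0 + m 1 + m 2}"
    by (rule has_integral_combine[OF _ _ has_integral_combine[OF _ _ 0 1] 2]) (use m in auto)
  then show ?case unfolding tot by (simp add: sum_3' algebra_simps)
qed

section \<open>The limit of the quantile maps and its image measure\<close>

definition quantile :: "(pt \<Rightarrow> real) \<Rightarrow> real \<Rightarrow> pt" where
  "quantile f t = lim (\<lambda>n. quantile_n n 1 f t)"

lemma quantile_lim: "(\<lambda>n. quantile_n n 1 f t) \<longlonglongrightarrow> quantile f t"
proof -
  have "summable (\<lambda>n. diamK * (1/2)^n)" by (intro summable_mult summable_geometric) simp
  then have "summable (\<lambda>n. quantile_n (Suc n) 1 f t - quantile_n n 1 f t)"
    by (rule summable_comparison_test'[where N = 0])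
      (use quantile_n_step[of _ 1 f t] in \<open>simp add: dist_norm norm_minus_commute power_divide del: quantile_n.simps\<close>)
  then have "convergent (\<lambda>n. quantile_n 0 1 f t + (\<Sum>k<n. quantile_n (Suc k) 1 f t - quantile_n k 1 f t))"
    unfolding summable_iff_convergent by (intro convergent_add convergent_const)
  then have "convergent (\<lambda>n. quantile_n n 1 f t)"
    unfolding sum_lessThan_telescope[of "\<lambda>k. quantile_n k 1 f t"] by simp
  then show ?thesis unfolding quantile_def by (simp add: convergent_LIMSEQ_iff)
qed

lemma quantile_K: "quantile f t \<in> K"
  using closed_sequentially[OF compact_imp_closed[OF compact_K] quantile_n_K quantile_lim] by blast

lemma quantile_measurable [measurable]: "quantile f \<in> borel_measurable borel"
  by (rule borel_measurable_LIMSEQ_metric[OF _ quantile_lim]) measurable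

abbreviation "Kb \<equiv> restrict_space borel K"

lemma cont_meas: "continuous_on K g \<Longrightarrow> g \<in> borel_measurable Kb"
  by (rule borel_measurable_continuous_on_restrict)

lemma cont_bounded: "continuous_on K g \<Longrightarrow> \<exists>B\<ge>0. \<forall>x\<in>K. \<bar>g x\<bar> \<le> (B::real)"
  using compact_imp_bounded[OF compact_continuous_image[OF _ compact_K], of g]
  unfolding bounded_pos by (auto intro: less_imp_le)

definition quantile_distr :: "(pt \<Rightarrow> real) \<Rightarrow> pt measure" where
  "quantile_distr f = distr (restrict_space lborel {0..energy1 q f}) Kb (quantile f)"

lemma sets_quantile_distr: "sets (quantile_distr f) = sets Kb"
  unfolding quantile_distr_def by simp

lemma finite_quantile_distr: "finite_measure (quantile_distr f)"
proof -
  interpret finite_measure "restrict_space lborel {0..energy1 q f}"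
    by (rule finite_measureI) (simp add: emeasure_restrict_space space_restrict_space emeasure_lborel_Icc_eq)
  show ?thesis unfolding quantile_distr_def
    by (rule finite_measure_distr)
       (auto intro!: measurable_restrict_space1 measurable_restrict_space2 simp: quantile_K)
qed

lemma quantile_distr_lim:
  assumes f: "f \<in> \<C> q" and g: "continuous_on K g"
  shows "(\<lambda>n. cell_sum n f g) \<longlonglongrightarrow> (\<integral>x. g x \<partial>quantile_distr f)"
proof -
  let ?L = "restrict_space lborel {0..energy1 q f}"
  interpret finite_measure ?L
    by (rule finite_measureI) (simp add: emeasure_restrict_space space_restrict_space emeasure_lborel_Icc_eq)
  obtain B where B: "B \<ge> 0" "\<And>x. x \<in> K \<Longrightarrow> \<bar>g x\<bar> \<le> B" using cont_bounded[OF g] by blast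
  have X: "quantile f \<in> measurable lborel Kb" "quantile_n n c f \<in> measurable lborel Kb" for n c
    by (auto intro!: measurable_restrict_space2 simp: quantile_K quantile_n_K)
  have gX: "(\<lambda>t. g (quantile f t)) \<in> borel_measurable lborel" "(\<lambda>t. g (quantile_n n c f t)) \<in> borel_measurable lborel" for n c
    using measurable_compose[OF X(1) cont_meas[OF g]] measurable_compose[OF X(2) cont_meas[OF g]] by auto
  have cs: "cell_sum n f g = (\<integral>t. g (quantile_n n 1 f t) \<partial>?L)" for n
  proof -
    have i: "set_integrable lborel {0..energy1 q f} (\<lambda>t. g (quantile_n n 1 f t))"
      unfolding set_integrable_def
    proof (rule Bochner_Integration.integrable_bound[of _ "\<lambda>t. indicator {0..energy1 q f} t * B"])
      show "integrable lborel (\<lambda>t. indicator {0..energy1 q f} t * B)"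
        by (intro integrable_mult_left integrable_real_indicator) (auto simp: emeasure_lborel_Icc_eq)
    qed (use gX B quantile_n_K in \<open>auto simp: indicator_def intro!: AE_I2 simp del: quantile_n.simps\<close>)
    have "cell_sum n f g = integral {0..energy1 q f} (\<lambda>t. g (quantile_n n 1 f t))"
      using quantile_integral[OF f, of 1 g n] by (simp add: integral_unique)
    also have "\<dots> = (\<integral>t. g (quantile_n n 1 f t) \<partial>?L)"
      using set_borel_integral_eq_integral(2)[OF i]
      by (simp add: integral_restrict_space set_lebesgue_integral_def)
    finally show ?thesis .
  qed
  have lim: "(\<lambda>n. g (quantile_n n 1 f t)) \<longlonglongrightarrow> g (quantile f t)" for t
    using continuous_on_tendsto_compose[OF g quantile_lim quantile_K] quantile_n_K by auto
  have "(\<lambda>n. \<integral>t. g (quantile_n n 1 f t) \<partial>?L) \<longlonglongrightarrow> (\<integral>t. g (quantile f t) \<partial>?L)"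
    by (rule integral_dominated_convergence[where w = "\<lambda>_. B"])
       (use gX B quantile_n_K lim in \<open>auto intro!: measurable_restrict_space1\<close>)
  also have "(\<integral>t. g (quantile f t) \<partial>?L) = (\<integral>x. g x \<partial>quantile_distr f)"
    unfolding quantile_distr_def
    by (subst integral_distr) (use X cont_meas[OF g] in \<open>auto intro!: measurable_restrict_space1\<close>)
  finally show ?thesis unfolding cs .
qed

text \<open>\<open>cell_sum\<close> with the limit energy of each cell replaced by a graph energy:
  \<open>n\<close> is the sampling level, \<open>k\<close> the level of the energy inside a cell. It
  links edge sums to \<open>cell_sum\<close>.\<close>

primrec cell_sum_n :: "nat \<Rightarrow> nat \<Rightarrow> (pt \<Rightarrow> real) \<Rightarrow> (pt \<Rightarrow> real) \<Rightarrow> real" where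
  "cell_sum_n k 0 f g = En k f f * g (q 0)"
| "cell_sum_n k (Suc n) f g = (\<Sum>i\<in>UNIV. 5/3 * cell_sum_n k n (\<lambda>x. f (F q i x)) (\<lambda>x. g (F q i x)))"

lemma cell_sum_n_lim:
  assumes "f \<in> \<C> q" shows "(\<lambda>k. cell_sum_n k n f g) \<longlonglongrightarrow> cell_sum n f g"
  using assms
proof (induction n arbitrary: f g)
  case 0
  then show ?case unfolding cell_sum.simps cell_sum_n.simps by (intro tendsto_intros energy1_lim)
next
  case (Suc n)
  then show ?case unfolding cell_sum.simps cell_sum_n.simps by (intro tendsto_intros Suc.IH \<C>_F)
qed

definition wgt :: "(pt \<Rightarrow> real) \<Rightarrow> (pt \<Rightarrow> real) \<Rightarrow> pt \<Rightarrow> pt \<Rightarrow> real" where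
  "wgt g f x y = (g x + g y) / 2 * ((f x - f y) * (f x - f y))"

text \<open>Level \<open>n + k\<close> is split into \<open>n\<close> steps down to a cell and
  \<open>k\<close> steps inside it. Replacing \<open>g\<close> on a cell by one sample costs at most
  \<open>e\<close> times the energy there, and these costs add up to \<open>e\<close> times the
  total energy, uniformly in \<open>k\<close>.\<close>

lemma Q_wgt_cell_sum:
  assumes "\<And>x y. x \<in> K \<Longrightarrow> y \<in> K \<Longrightarrow> dist x y \<le> diamK / 2 ^ n \<Longrightarrow> \<bar>g x - g y\<bar> \<le> e"
  shows "\<bar>Q (n + k) (wgt g f) - cell_sum_n k n f g\<bar> \<le> e * En (n + k) f f"
  using assms
proof (induction n arbitrary: f g)
  case 0
  let ?d = "\<lambda>x y. (f x - f y) * (f x - f y)"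
  have g0: "\<bar>g x - g (q 0)\<bar> \<le> e" if "x \<in> K" for x
    using 0[OF that q_in_K] dist_diamK[OF that q_in_K] by simp
  have *: "\<bar>(g x + g y) / 2 - g (q 0)\<bar> \<le> e" if "x \<in> K" "y \<in> K" for x y
  proof -
    have "\<bar>(g x + g y) / 2 - g (q 0)\<bar> = \<bar>(g x - g (q 0)) + (g y - g (q 0))\<bar> / 2"
      by (simp add: abs_if field_simps)
    also have "\<dots> \<le> (e + e) / 2"
      using abs_triangle_ineq[of "g x - g (q 0)" "g y - g (q 0)"] g0[OF that(1)] g0[OF that(2)] by simp
    finally show ?thesis by simp
  qed
  have d: "0 \<le> ?d x y" for x y by simp
  have eq: "Q k (wgt g f) - cell_sum_n k 0 f g = Q k (\<lambda>x y. ((g x + g y) / 2 - g (q 0)) * ?d x y)"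
  proof -
    have "Q k (\<lambda>x y. ((g x + g y) / 2 - g (q 0)) * ?d x y) = Q k (\<lambda>x y. wgt g f x y - g (q 0) * ?d x y)"
      by (rule Q_cong) (simp add: wgt_def algebra_simps)
    then show ?thesis unfolding Q_diff Q_cmult by (simp add: En_def)
  qed
  have ab: "a \<le> e \<and> - e \<le> a" if "\<bar>a\<bar> \<le> e" for a :: real
    using that by (simp add: abs_le_iff minus_le_iff)
  have "Q k (\<lambda>x y. ((g x + g y) / 2 - g (q 0)) * ?d x y) \<le> Q k (\<lambda>x y. e * ?d x y)"
    by (rule Q_mono, rule mult_right_mono[OF conjunct1[OF ab[OF *]] d])
  moreover have "Q k (\<lambda>x y. - e * ?d x y) \<le> Q k (\<lambda>x y. ((g x + g y) / 2 - g (q 0)) * ?d x y)"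
    by (rule Q_mono, rule mult_right_mono[OF conjunct2[OF ab[OF *]] d])
  ultimately show ?case unfolding add_0 eq Q_cmult by (simp add: En_def abs_le_iff minus_le_iff)
next
  case (Suc n)
  have IH: "\<bar>Q (n + k) (wgt (\<lambda>x. g (F q i x)) (\<lambda>x. f (F q i x))) - cell_sum_n k n (\<lambda>x. f (F q i x)) (\<lambda>x. g (F q i x))\<bar>
      \<le> e * En (n + k) (\<lambda>x. f (F q i x)) (\<lambda>x. f (F q i x))" for i
  proof (rule Suc.IH)
    fix x y assume "x \<in> K" "y \<in> K" "dist x y \<le> diamK / 2 ^ n"
    then show "\<bar>g (F q i x) - g (F q i y)\<bar> \<le> e"
      by (intro Suc.prems F_in_K) (simp_all add: dist_F)
  qed
  have "\<bar>Q (Suc n + k) (wgt g f) - cell_sum_n k (Suc n) f g\<bar>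
     = \<bar>\<Sum>i\<in>UNIV. 5/3 * (Q (n + k) (wgt (\<lambda>x. g (F q i x)) (\<lambda>x. f (F q i x))) - cell_sum_n k n (\<lambda>x. f (F q i x)) (\<lambda>x. g (F q i x)))\<bar>"
    by (simp add: Q_Suc wgt_def[abs_def] right_diff_distrib sum_subtractf)
  also have "\<dots> \<le> (\<Sum>i\<in>UNIV. 5/3 * (e * En (n + k) (\<lambda>x. f (F q i x)) (\<lambda>x. f (F q i x))))"
    by (rule order_trans[OF sum_abs], rule sum_mono) (simp only: abs_mult, rule mult_mono, use IH in auto)
  also have "\<dots> = e * En (Suc n + k) f f"
    by (simp add: En_Suc sum_distrib_left mult.left_commute)
  finally show ?case .
qed

lemma small_cells: "0 < (d::real) \<Longrightarrow> \<exists>n. diamK / 2 ^ n < d"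
  using order_tendstoD(2)[OF half_powers_lim, of d diamK] by (auto simp: eventually_sequentially)

lemma osc_small:
  assumes "continuous_on K g" "0 < (e::real)"
  shows "\<exists>N. \<forall>n\<ge>N. \<forall>x\<in>K. \<forall>y\<in>K. dist x y \<le> diamK / 2 ^ n \<longrightarrow> \<bar>g x - g y\<bar> \<le> e"
proof -
  have "uniformly_continuous_on K g" by (rule compact_uniformly_continuous[OF assms(1) compact_K])
  then obtain d where d: "d > 0" "\<And>x y. x \<in> K \<Longrightarrow> y \<in> K \<Longrightarrow> dist y x < d \<Longrightarrow> dist (g y) (g x) < e"
    unfolding uniformly_continuous_on_def using assms(2) by metis
  obtain N where N: "diamK / 2 ^ N < d" using small_cells[OF d(1)] by blast
  have "0 \<le> diamK" using dist_diamK[OF q_in_K q_in_K, of 0 0] by simp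
  then have "diamK / 2 ^ n \<le> diamK / 2 ^ N" if "N \<le> n" for n
    using that by (intro divide_left_mono power_increasing) auto
  then show ?thesis using N d(2) by (intro exI[of _ N]) (fastforce simp: dist_real_def)
qed

text \<open>The two limits are taken in turn: the sampling level \<open>n\<close> is fixed first,
  making the oscillation of \<open>g\<close> on cells small and the cell sum close to the integral;
  then the inner level grows.\<close>

lemma Q_wgt_lim:
  assumes f: "f \<in> \<C> q" and g: "continuous_on K g"
  shows "(\<lambda>k. Q k (wgt g f)) \<longlonglongrightarrow> (\<integral>x. g x \<partial>quantile_distr f)"
proof (rule LIMSEQ_I)
  fix r :: real assume r: "r > 0"
  let ?I = "\<integral>x. g x \<partial>quantile_distr f"
  \<comment> \<open>The error is at most \<open>e\<close> times the energy from sampling plus one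
    \<open>e\<close> from each of the two limits; 3 instead of 2 gives a strict bound.\<close>
  define e where "e = r / (energy1 q f + 3)"
  have E0: "0 \<le> energy1 q f" using energy1_nonneg[OF f] .
  then have e: "e > 0" unfolding e_def using r by simp
  obtain N where N: "\<And>n x y. n \<ge> N \<Longrightarrow> x \<in> K \<Longrightarrow> y \<in> K \<Longrightarrow> dist x y \<le> diamK / 2 ^ n \<Longrightarrow> \<bar>g x - g y\<bar> \<le> e"
    using osc_small[OF g e] by blast
  obtain N' where N': "\<And>n. n \<ge> N' \<Longrightarrow> \<bar>cell_sum n f g - ?I\<bar> < e"
    using LIMSEQ_D[OF quantile_distr_lim[OF f g] e] by auto
  define n where "n = max N N'"
  obtain k0 where k0: "\<And>k. k \<ge> k0 \<Longrightarrow> \<bar>cell_sum_n k n f g - cell_sum n f g\<bar> < e"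
    using LIMSEQ_D[OF cell_sum_n_lim[OF f] e] by force
  have "\<bar>Q j (wgt g f) - ?I\<bar> < r" if j: "j \<ge> n + k0" for j
  proof -
    obtain k where k: "j = n + k" "k \<ge> k0" using j by (metis add.assoc le_iff_add le_add1)
    have "\<bar>Q j (wgt g f) - cell_sum_n k n f g\<bar> \<le> e * En (n + k) f f"
      unfolding k(1) by (rule Q_wgt_cell_sum) (rule N, auto simp: n_def)
    also have "\<dots> \<le> e * energy1 q f" using En_le_energy1[OF f] e by (intro mult_left_mono) auto
    finally have "\<bar>Q j (wgt g f) - ?I\<bar> < e * energy1 q f + 2 * e"
      using k0[OF k(2)] N'[of n] by (simp add: n_def)
    also have "\<dots> < e * (energy1 q f + 3)" using e by (simp add: algebra_simps)
    also have "\<dots> = r" unfolding e_def using E0 by simp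
    finally show ?thesis .
  qed
  then show "\<exists>no. \<forall>n\<ge>no. norm (Q n (wgt g f) - ?I) < r" by auto
qed

end

section \<open>Square integrable functions\<close>

lemma quadratic_nonneg_imp:
  fixes a b c :: real
  assumes "0 \<le> c" "\<And>t. 0 \<le> a + 2 * t * b + t\<^sup>2 * c"
  shows "b\<^sup>2 \<le> a * c"
proof (cases "c = 0")
  case True
  have "b = 0"
  proof (rule ccontr)
    assume "b \<noteq> 0"
    then show False using assms(2)[of "- (a + 1) / (2 * b)"] True by (simp add: field_simps)
  qed
  then show ?thesis using True by simp
next
  case False
  then have "c > 0" using assms(1) by simp
  then show ?thesis using assms(2)[of "- b / c"] by (simp add: field_simps power2_eq_square)
qed

lemma sqrt_triangle:
  fixes a b c :: real
  assumes "0 \<le> a" "0 \<le> c" "b\<^sup>2 \<le> a * c"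
  shows "sqrt (a + 2 * b + c) \<le> sqrt a + sqrt c"
proof (rule real_le_lsqrt)
  have "b \<le> sqrt (a * c)" using assms(3) by (rule real_le_rsqrt)
  then show "a + 2 * b + c \<le> (sqrt a + sqrt c)\<^sup>2"
    using assms by (simp add: power2_sum real_sqrt_mult)
qed (use assms in auto)

lemma L2_meas: "f \<in> L2 M \<Longrightarrow> f \<in> borel_measurable M"
  and L2_int: "f \<in> L2 M \<Longrightarrow> integrable M (\<lambda>x. (f x)\<^sup>2)"
  by (auto simp: L2_def)

lemma L2_prod:
  assumes "f \<in> L2 M" "g \<in> L2 M" shows "integrable M (\<lambda>x. f x * g x)"
proof (rule Bochner_Integration.integrable_bound)
  show "integrable M (\<lambda>x. (f x)\<^sup>2 + (g x)\<^sup>2)"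
    by (intro Bochner_Integration.integrable_add L2_int assms)
  show "(\<lambda>x. f x * g x) \<in> borel_measurable M"
    by (intro borel_measurable_times L2_meas assms)
  show "AE x in M. norm (f x * g x) \<le> norm ((f x)\<^sup>2 + (g x)\<^sup>2)"
  proof (rule AE_I2)
    fix x
    have "0 \<le> (\<bar>f x\<bar> - \<bar>g x\<bar>)\<^sup>2" by simp
    then have "2 * (\<bar>f x\<bar> * \<bar>g x\<bar>) \<le> (f x)\<^sup>2 + (g x)\<^sup>2" by (simp add: power2_diff)
    moreover have "0 \<le> \<bar>f x\<bar> * \<bar>g x\<bar>" by simp
    ultimately have "\<bar>f x * g x\<bar> \<le> (f x)\<^sup>2 + (g x)\<^sup>2" unfolding abs_mult by linarith
    then show "norm (f x * g x) \<le> norm ((f x)\<^sup>2 + (g x)\<^sup>2)" by simp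
  qed
qed

lemma L2_lin:
  assumes "f \<in> L2 M" "g \<in> L2 M" shows "(\<lambda>x. a * f x + b * g x) \<in> L2 M"
proof -
  have "(\<lambda>x. (a * f x + b * g x)\<^sup>2) = (\<lambda>x. a\<^sup>2 * (f x)\<^sup>2 + 2 * a * b * (f x * g x) + b\<^sup>2 * (g x)\<^sup>2)"
    by (simp add: power2_eq_square algebra_simps fun_eq_iff)
  moreover have "integrable M (\<lambda>x. a\<^sup>2 * (f x)\<^sup>2 + 2 * a * b * (f x * g x) + b\<^sup>2 * (g x)\<^sup>2)"
    by (intro Bochner_Integration.integrable_add integrable_mult_right L2_int L2_prod assms)
  moreover have "(\<lambda>x. a * f x + b * g x) \<in> borel_measurable M"
    by (intro borel_measurable_add borel_measurable_times borel_measurable_const L2_meas assms)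
  ultimately show ?thesis unfolding L2_def by auto
qed

lemma L2_add: "f \<in> L2 M \<Longrightarrow> g \<in> L2 M \<Longrightarrow> (\<lambda>x. f x + g x) \<in> L2 M"
  and L2_diff: "f \<in> L2 M \<Longrightarrow> g \<in> L2 M \<Longrightarrow> (\<lambda>x. f x - g x) \<in> L2 M"
  and L2_cmult: "f \<in> L2 M \<Longrightarrow> (\<lambda>x. c * f x) \<in> L2 M"
  using L2_lin[of f M g 1 1] L2_lin[of f M g 1 "-1"] L2_lin[of f M f c 0] by simp_all

lemma L2_zero [simp]: "(\<lambda>x. 0) \<in> L2 M"
  by (simp add: L2_def)

lemma L2_Cauchy_Schwarz:
  assumes "f \<in> L2 M" "g \<in> L2 M"
  shows "(\<integral>x. f x * g x \<partial>M)\<^sup>2 \<le> (\<integral>x. (f x)\<^sup>2 \<partial>M) * (\<integral>x. (g x)\<^sup>2 \<partial>M)"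
proof (rule quadratic_nonneg_imp)
  show "0 \<le> (\<integral>x. (g x)\<^sup>2 \<partial>M)" by simp
  fix t :: real
  have "0 \<le> (\<integral>x. (f x + t * g x)\<^sup>2 \<partial>M)" by simp
  also have "(\<lambda>x. (f x + t * g x)\<^sup>2) = (\<lambda>x. (f x)\<^sup>2 + 2 * t * (f x * g x) + t\<^sup>2 * (g x)\<^sup>2)"
    by (simp add: power2_eq_square algebra_simps fun_eq_iff)
  also have "(\<integral>x. (f x)\<^sup>2 + 2 * t * (f x * g x) + t\<^sup>2 * (g x)\<^sup>2 \<partial>M)
      = (\<integral>x. (f x)\<^sup>2 \<partial>M) + 2 * t * (\<integral>x. f x * g x \<partial>M) + t\<^sup>2 * (\<integral>x. (g x)\<^sup>2 \<partial>M)"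
    using assms by (simp add: L2_int L2_prod)
  finally show "0 \<le> (\<integral>x. (f x)\<^sup>2 \<partial>M) + 2 * t * (\<integral>x. f x * g x \<partial>M) + t\<^sup>2 * (\<integral>x. (g x)\<^sup>2 \<partial>M)" .
qed

lemma L2_norm_nonneg [simp]: "0 \<le> L2_norm M f"
  by (simp add: L2_norm_def)

lemma L2_norm_triangle:
  assumes "f \<in> L2 M" "g \<in> L2 M"
  shows "L2_norm M (\<lambda>x. f x + g x) \<le> L2_norm M f + L2_norm M g"
proof -
  have "(\<integral>x. (f x + g x)\<^sup>2 \<partial>M) = (\<integral>x. (f x)\<^sup>2 + 2 * (f x * g x) + (g x)\<^sup>2 \<partial>M)"
    by (intro Bochner_Integration.integral_cong refl) (simp add: power2_eq_square algebra_simps)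
  also have "\<dots> = (\<integral>x. (f x)\<^sup>2 \<partial>M) + 2 * (\<integral>x. f x * g x \<partial>M) + (\<integral>x. (g x)\<^sup>2 \<partial>M)"
    using assms by (simp add: L2_int L2_prod)
  finally show ?thesis unfolding L2_norm_def
    using sqrt_triangle[OF _ _ L2_Cauchy_Schwarz[OF assms]] by simp
qed

lemma L2_norm_cmult: "L2_norm M (\<lambda>x. c * f x) = \<bar>c\<bar> * L2_norm M f"
  unfolding L2_norm_def by (simp add: power_mult_distrib real_sqrt_mult)

lemma L2_norm_minus_commute: "L2_norm M (\<lambda>x. f x - g x) = L2_norm M (\<lambda>x. g x - f x)"
  unfolding L2_norm_def by (simp add: power2_commute)

lemma L2_norm_triangle3:
  assumes "f \<in> L2 M" "g \<in> L2 M" "k \<in> L2 M"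
  shows "L2_norm M (\<lambda>x. f x - k x) \<le> L2_norm M (\<lambda>x. f x - g x) + L2_norm M (\<lambda>x. g x - k x)"
  using L2_norm_triangle[OF L2_diff[OF assms(1,2)] L2_diff[OF assms(2,3)]] by simp

lemma L2_norm_0_imp:
  assumes "f \<in> L2 M" "L2_norm M f = 0" shows "AE x in M. f x = 0"
proof -
  have "AE x in M. (f x)\<^sup>2 = 0"
    using assms integral_nonneg_eq_0_iff_AE[OF L2_int[OF assms(1)]] by (simp add: L2_norm_def)
  then show ?thesis by eventually_elim simp
qed

lemma L2_norm_cong_AE:
  assumes "f \<in> borel_measurable M" "g \<in> borel_measurable M" "AE x in M. f x = g x"
  shows "L2_norm M f = L2_norm M g"
proof -
  have "AE x in M. (f x)\<^sup>2 = (g x)\<^sup>2" using assms(3) by eventually_elim simp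
  then show ?thesis unfolding L2_norm_def using integral_cong_AE[of "\<lambda>x. (f x)\<^sup>2" M "\<lambda>x. (g x)\<^sup>2"] assms by simp
qed

lemma (in finite_measure) bounded_L2:
  assumes "f \<in> borel_measurable M" "\<And>x. x \<in> space M \<Longrightarrow> \<bar>f x\<bar> \<le> B"
  shows "f \<in> L2 M" "L2_norm M f \<le> B * sqrt (measure M (space M))"
proof -
  have b: "(f x)\<^sup>2 \<le> B\<^sup>2" if "x \<in> space M" for x
    using power_mono[OF assms(2)[OF that], of 2] by simp
  have i: "integrable M (\<lambda>x. (f x)\<^sup>2)"
    by (rule integrable_const_bound[where B = "B\<^sup>2"]) (use assms b in auto)
  then show "f \<in> L2 M" using assms unfolding L2_def by auto
  have "(\<integral>x. (f x)\<^sup>2 \<partial>M) \<le> (\<integral>x. B\<^sup>2 \<partial>M)"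
    by (rule integral_mono) (use i b in auto)
  then have "L2_norm M f \<le> sqrt (B\<^sup>2 * measure M (space M))"
    unfolding L2_norm_def by (simp add: mult.commute)
  also have "\<dots> = \<bar>B\<bar> * sqrt (measure M (space M))" by (simp add: real_sqrt_mult)
  also have "\<dots> = B * sqrt (measure M (space M))"
  proof (cases "space M = {}")
    case False
    then have "0 \<le> B" using assms(2) by (metis abs_ge_zero ex_in_conv order_trans)
    then show ?thesis by simp
  qed simp
  finally show "L2_norm M f \<le> B * sqrt (measure M (space M))" .
qed

context triangle begin

section \<open>Finite measures on the gasket and density of continuous functions\<close>

definition K_measure :: "pt measure \<Rightarrow> bool" where
  "K_measure M \<longleftrightarrow> finite_measure M \<and> sets M = sets Kb"

lemma K_measure_space: "K_measure M \<Longrightarrow> space M = K"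
  unfolding K_measure_def using sets_eq_imp_space_eq[of M Kb] by (simp add: space_restrict_space)

lemma K_measurable_cont: "K_measure M \<Longrightarrow> continuous_on K g \<Longrightarrow> (g :: pt \<Rightarrow> real) \<in> borel_measurable M"
  unfolding K_measure_def using cont_meas measurable_cong_sets[of M Kb borel borel] by auto

lemma K_L2_cont: assumes "K_measure M" "continuous_on K g" shows "g \<in> L2 M"
proof -
  interpret finite_measure M using assms unfolding K_measure_def by simp
  obtain B where "\<forall>x\<in>K. \<bar>g x\<bar> \<le> B" using cont_bounded[OF assms(2)] by blast
  then show ?thesis using bounded_L2(1)[OF K_measurable_cont[OF assms]] K_measure_space[OF assms(1)] by blast
qed

lemma K_integrable_cont: assumes "K_measure M" "continuous_on K g" shows "integrable M (g :: pt \<Rightarrow> real)"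
proof -
  interpret finite_measure M using assms unfolding K_measure_def by simp
  obtain B where "\<forall>x\<in>K. \<bar>g x\<bar> \<le> B" using cont_bounded[OF assms(2)] by blast
  then show ?thesis using integrable_const_bound[of g B] K_measurable_cont[OF assms] K_measure_space[OF assms(1)] by auto
qed

text \<open>The approximation is uniform, so one sequence works for all finite measures
  simultaneously. That matters for signed measures, which are handled as pairs.\<close>

lemma \<C>_dense:
  assumes "continuous_on K g"
  shows "\<exists>fs. (\<forall>n. fs n \<in> \<C> q) \<and> (\<forall>M. K_measure M \<longrightarrow> (\<lambda>n. \<integral>x. fs n x \<partial>M) \<longlonglongrightarrow> (\<integral>x. g x \<partial>M))"
proof -
  have "\<exists>f\<in>\<C> q. \<forall>x\<in>K. \<bar>g x - f x\<bar> < 1 / (1 + real n)" for n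
    by (rule Stone_Weierstrass_basic[OF assms]) simp
  then obtain fs where fs: "\<And>n. fs n \<in> \<C> q" "\<And>n x. x \<in> K \<Longrightarrow> \<bar>g x - fs n x\<bar> < 1 / (1 + real n)"
    by metis
  have "(\<lambda>n. \<integral>x. fs n x \<partial>M) \<longlonglongrightarrow> (\<integral>x. g x \<partial>M)" if M: "K_measure M" for M
  proof -
    interpret finite_measure M using M unfolding K_measure_def by simp
    have int: "integrable M (fs n)" "integrable M g" for n
      using K_integrable_cont[OF M] \<C>_cont fs(1) assms by auto
    have le: "\<bar>(\<integral>x. fs n x \<partial>M) - (\<integral>x. g x \<partial>M)\<bar> \<le> measure M (space M) * (1 / (1 + real n))" for n
    proof -
      have "(\<integral>x. fs n x \<partial>M) - (\<integral>x. g x \<partial>M) = (\<integral>x. fs n x - g x \<partial>M)" using int by simp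
      also have "\<bar>\<dots>\<bar> \<le> (\<integral>x. \<bar>fs n x - g x\<bar> \<partial>M)" using integral_norm_bound[of M "\<lambda>x. fs n x - g x"] by simp
      also have "\<dots> \<le> (\<integral>x. 1 / (1 + real n) \<partial>M)"
        by (rule integral_mono)
           (use int fs(2)[THEN less_imp_le] K_measure_space[OF M] in \<open>auto simp: abs_minus_commute\<close>)
      finally show ?thesis by simp
    qed
    have lim: "(\<lambda>n. measure M (space M) * (1 / (1 + real n))) \<longlonglongrightarrow> 0"
      using tendsto_mult[OF tendsto_const LIMSEQ_inverse_real_of_nat, of "measure M (space M)"]
      by (simp add: inverse_eq_divide)
    have "(\<lambda>n. (\<integral>x. fs n x \<partial>M) - (\<integral>x. g x \<partial>M)) \<longlonglongrightarrow> 0"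
      by (rule Lim_null_comparison[OF _ lim]) (rule always_eventually, rule allI, simp only: real_norm_def le)
    then show ?thesis by (simp add: LIM_zero_iff)
  qed
  then show ?thesis using fs(1) by blast
qed

lemma closed_approx:
  assumes M: "K_measure M" and A: "closed A" "A \<noteq> {}"
  shows "(\<lambda>n. \<integral>x. max 0 (1 - real n * infdist x A) \<partial>M) \<longlonglongrightarrow> measure M (A \<inter> K)"
proof -
  interpret finite_measure M using M unfolding K_measure_def by simp
  have "K \<inter> A \<in> (\<inter>) K ` sets borel" using A(1) by (intro imageI borel_closed)
  then have AK: "A \<inter> K \<in> sets M" using M unfolding K_measure_def by (simp add: sets_restrict_space Int_commute)
  have "(\<lambda>n. \<integral>x. max 0 (1 - real n * infdist x A) \<partial>M) \<longlonglongrightarrow> (\<integral>x. indicator (A \<inter> K) x \<partial>M)"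
  proof (rule integral_dominated_convergence[where w = "\<lambda>_. 1"])
    show "(\<lambda>x. max 0 (1 - real n * infdist x A)) \<in> borel_measurable M" for n
      by (rule K_measurable_cont[OF M]) (intro continuous_intros)
    show "AE x in M. (\<lambda>n. max 0 (1 - real n * infdist x A)) \<longlonglongrightarrow> indicator (A \<inter> K) x"
    proof (rule AE_I2)
      fix x assume "x \<in> space M"
      then have xK: "x \<in> K" using K_measure_space[OF M] by simp
      show "(\<lambda>n. max 0 (1 - real n * infdist x A)) \<longlonglongrightarrow> indicator (A \<inter> K) x"
      proof (cases "x \<in> A")
        case True then show ?thesis using xK by simp
      next
        case False
        then have p: "infdist x A > 0" using infdist_pos_not_in_closed A by blast
        obtain N :: nat where N: "1 / infdist x A < real N" using reals_Archimedean2 by blast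
        have "max 0 (1 - real n * infdist x A) = 0" if "n \<ge> N" for n
        proof -
          have "1 / infdist x A < real n" using N that by linarith
          then show ?thesis using p by (simp add: field_simps)
        qed
        then have "eventually (\<lambda>n. max 0 (1 - real n * infdist x A) = 0) sequentially"
          by (auto simp: eventually_sequentially)
        then show ?thesis using False by (simp add: tendsto_eventually)
      qed
    qed
  qed (use AK in \<open>auto simp: infdist_nonneg\<close>)
  then show ?thesis using AK K_measure_space[OF M] by (simp add: Int_absorb2 Int_commute Int_left_commute)
qed

lemma K_sets_borel: "K_measure M \<Longrightarrow> A \<in> sets M \<Longrightarrow> A \<in> sets borel \<and> A \<subseteq> K"
  unfolding K_measure_def using compact_imp_closed[OF compact_K] by (auto simp: sets_restrict_space)

lemma K_measurable_id: "K_measure M \<Longrightarrow> (\<lambda>x. x) \<in> measurable M borel"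
proof -
  assume "K_measure M"
  then have "sets M = sets Kb" unfolding K_measure_def by simp
  then show ?thesis
    by (subst measurable_cong_sets[OF _ refl]) (auto intro: measurable_restrict_space1)
qed

lemma K_distr_emeasure:
  assumes "K_measure M" "A \<in> sets borel" shows "emeasure (distr M borel (\<lambda>x. x)) A = emeasure M (A \<inter> K)"
  using assms by (subst emeasure_distr) (auto simp: K_measurable_id K_measure_space)

text \<open>Uniform density extends equality from \<open>\<C>\<close> to continuous functions,
  cut-offs of the distance give closed sets, and closed sets form an intersection-stable generator.
  The measures are pushed to the Borel sets of the plane so that this generator is
  available.\<close>

lemma K_measure_eqI:
  assumes M: "K_measure M" and N: "K_measure N"
    and eq: "\<And>g. g \<in> \<C> q \<Longrightarrow> (\<integral>x. g x \<partial>M) = (\<integral>x. g x \<partial>N)"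
  shows "M = N"
proof -
  interpret M: finite_measure M using M unfolding K_measure_def by simp
  interpret N: finite_measure N using N unfolding K_measure_def by simp
  have cont: "(\<integral>x. g x \<partial>M) = (\<integral>x. g x \<partial>N)" if g: "continuous_on K g" for g :: "pt \<Rightarrow> real"
  proof -
    obtain fs where fs: "\<And>n. fs n \<in> \<C> q" "(\<lambda>n. \<integral>x. fs n x \<partial>M) \<longlonglongrightarrow> (\<integral>x. g x \<partial>M)"
      "(\<lambda>n. \<integral>x. fs n x \<partial>N) \<longlonglongrightarrow> (\<integral>x. g x \<partial>N)" using \<C>_dense[OF g] M N by blast
    moreover have "(\<lambda>n. \<integral>x. fs n x \<partial>M) = (\<lambda>n. \<integral>x. fs n x \<partial>N)" using eq[OF fs(1)] by simp
    ultimately show ?thesis using LIMSEQ_unique[OF fs(2)] by simp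
  qed
  have cl: "measure M (A \<inter> K) = measure N (A \<inter> K)" if "closed A" for A
  proof (cases "A = {}")
    case False
    have "(\<integral>x. max 0 (1 - real n * infdist x A) \<partial>M) = (\<integral>x. max 0 (1 - real n * infdist x A) \<partial>N)" for n
      by (rule cont) (intro continuous_intros)
    then show ?thesis using closed_approx[OF M that False] closed_approx[OF N that False] LIMSEQ_unique by auto
  qed simp
  have "distr M borel (\<lambda>x. x) = distr N borel (\<lambda>x. x)"
  proof (rule measure_eqI_generator_eq[where E = "Collect closed" and \<Omega> = UNIV and A = "\<lambda>_. UNIV"])
    show "Int_stable (Collect closed :: pt set set)" by (auto simp: Int_stable_def)
    show "emeasure (distr M borel (\<lambda>x. x)) X = emeasure (distr N borel (\<lambda>x. x)) X" if "X \<in> Collect closed" for X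
      using that cl[of X] by (subst (1 2) K_distr_emeasure) (auto simp: M N M.emeasure_eq_measure N.emeasure_eq_measure)
    show "emeasure (distr M borel (\<lambda>x. x)) UNIV \<noteq> \<infinity>" 
      by (subst K_distr_emeasure[OF M]) auto
  qed (auto simp: borel_eq_closed)
  then show ?thesis
  proof (intro measure_eqI)
    show "sets M = sets N" using M N unfolding K_measure_def by simp
    fix A assume d: "distr M borel (\<lambda>x. x) = distr N borel (\<lambda>x. x)" and A: "A \<in> sets M"
    have "A \<in> sets borel" "A \<inter> K = A" using K_sets_borel[OF M A] by auto
    then show "emeasure M A = emeasure N A"
      using arg_cong[OF d, of "\<lambda>M. emeasure M A"] K_distr_emeasure M N by simp
  qed
qed

text \<open>Inner regularity supplies a compact subset of \<open>A\<close> of nearly full measure;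
  continuous cut-offs decreasing to its indicator do the rest.\<close>

lemma indicator_L1_approx:
  assumes M: "K_measure M" and A: "A \<in> sets M" and e: "(0::real) < e"
  shows "\<exists>c. continuous_on K c \<and> (\<integral>x. \<bar>indicator A x - c x\<bar> \<partial>M) < e"
proof -
  interpret finite_measure M using M unfolding K_measure_def by simp
  have Ab: "A \<in> sets borel" "A \<inter> K = A" using K_sets_borel[OF M A] by auto
  let ?D = "distr M borel (\<lambda>x. x)"
  have D: "emeasure ?D B = ennreal (measure M (B \<inter> K))" if "B \<in> sets borel" for B
    using K_distr_emeasure[OF M that] emeasure_eq_measure by simp
  have "\<exists>C. C \<subseteq> A \<and> compact C \<and> measure M A < measure M (C \<inter> K) + e / 2"
  proof (cases "measure M A < e / 2")
    case True
    then show ?thesis by (intro exI[of _ "{}"]) auto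
  next
    case False
    have "emeasure ?D A = (SUP C\<in>{C. C \<subseteq> A \<and> compact C}. emeasure ?D C)"
      by (rule inner_regular) (use Ab D[of UNIV] in auto)
    moreover have "ennreal (measure M A - e / 2) < emeasure ?D A"
      using D[OF Ab(1)] Ab(2) e False by (simp add: ennreal_less_iff)
    ultimately obtain C where C: "C \<subseteq> A" "compact C" "ennreal (measure M A - e / 2) < emeasure ?D C"
      by (auto simp: less_SUP_iff)
    then have "measure M A - e / 2 < measure M (C \<inter> K)"
      using D[of C] compact_imp_closed[of C] False by (auto simp: ennreal_less_iff)
    then show ?thesis using C by (intro exI[of _ C]) auto
  qed
  then obtain C where C: "C \<subseteq> A" "compact C" "measure M A < measure M (C \<inter> K) + e / 2" by blast
  have CK: "C \<inter> K \<in> sets M" "C \<inter> K = C"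
    using M C Ab compact_imp_closed[OF C(2)] unfolding K_measure_def by (auto simp: sets_restrict_space)
  show ?thesis
  proof (cases "C = {}")
    case True
    then have "measure M A < e" using C(3) e by simp
    then show ?thesis using A by (intro exI[of _ "\<lambda>_. 0"]) auto
  next
    case False
    let ?c = "\<lambda>n x. max 0 (1 - real n * infdist x C)"
    have cc: "continuous_on K (?c n)" for n by (intro continuous_intros)
    obtain n where n: "\<bar>(\<integral>x. ?c n x \<partial>M) - measure M (C \<inter> K)\<bar> < e / 2"
      using LIMSEQ_D[OF closed_approx[OF M compact_imp_closed[OF C(2)] False], of "e / 2"] e by auto
    have int: "integrable M (?c n)" "integrable M (indicator A :: pt \<Rightarrow> real)" "integrable M (indicator (C \<inter> K) :: pt \<Rightarrow> real)"
      using K_integrable_cont[OF M cc] A CK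
      by (auto intro!: integrable_real_indicator simp: emeasure_eq_measure)
    have "(\<integral>x. \<bar>indicator A x - ?c n x\<bar> \<partial>M) \<le> (\<integral>x. (indicator A x - indicator (C \<inter> K) x) + (?c n x - indicator (C \<inter> K) x) \<partial>M)"
    proof (rule integral_mono)
      show "integrable M (\<lambda>x. \<bar>indicator A x - ?c n x\<bar>)"
        "integrable M (\<lambda>x. (indicator A x - indicator (C \<inter> K) x) + (?c n x - indicator (C \<inter> K) x))"
        using int by auto
      fix x assume "x \<in> space M"
      have "?c n x = 1" if "x \<in> C" using that by simp
      moreover have "0 \<le> ?c n x" "?c n x \<le> 1" by (auto simp: infdist_nonneg)
      ultimately show "\<bar>indicator A x - ?c n x\<bar> \<le> (indicator A x - indicator (C \<inter> K) x) + (?c n x - indicator (C \<inter> K) x)"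
        using C(1) unfolding CK(2) by (cases "x \<in> C"; cases "x \<in> A") auto
    qed
    also have "\<dots> = (measure M A - measure M (C \<inter> K)) + ((\<integral>x. ?c n x \<partial>M) - measure M (C \<inter> K))"
      using int A CK by simp
    also have "\<dots> < e" using n C(3) by linarith
    finally show ?thesis using cc by blast
  qed
qed

lemma L1_approx:
  assumes M: "K_measure M" and f: "integrable M f" and "0 < (e::real)"
  shows "\<exists>c. continuous_on K c \<and> (\<integral>x. \<bar>f x - c x\<bar> \<partial>M) < e"
  using f \<open>0 < e\<close>
proof (induction arbitrary: e)
  case (base A a)
  obtain c where c: "continuous_on K c" "(\<integral>x. \<bar>indicator A x - c x\<bar> \<partial>M) < e / (1 + \<bar>a\<bar>)"
    using indicator_L1_approx[OF M base(1), of "e / (1 + \<bar>a\<bar>)"] base(3) by (auto simp: add_pos_nonneg)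
  have "(\<integral>x. \<bar>indicator A x *\<^sub>R a - a * c x\<bar> \<partial>M) = (\<integral>x. \<bar>a\<bar> * \<bar>indicator A x - c x\<bar> \<partial>M)"
    by (intro Bochner_Integration.integral_cong refl) (simp add: abs_mult[symmetric] algebra_simps)
  also have "\<dots> = \<bar>a\<bar> * (\<integral>x. \<bar>indicator A x - c x\<bar> \<partial>M)" by simp
  also have "\<dots> \<le> \<bar>a\<bar> * (e / (1 + \<bar>a\<bar>))" using c(2) by (intro mult_left_mono) auto
  also have "\<dots> < e" using base(3) by (simp add: field_simps add_pos_nonneg)
  finally show ?case using c(1) by (intro exI[of _ "\<lambda>x. a * c x"]) (auto intro!: continuous_intros)
next
  case (add f g)
  have h: "0 < e / 2" using add.prems by simp
  obtain c d where c: "continuous_on K c" "(\<integral>x. \<bar>f x - c x\<bar> \<partial>M) < e/2"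
    "continuous_on K d" "(\<integral>x. \<bar>g x - d x\<bar> \<partial>M) < e/2"
    using add.IH(1)[OF h] add.IH(2)[OF h] by blast
  have int: "integrable M c" "integrable M d" using K_integrable_cont[OF M] c by auto
  have "(\<integral>x. \<bar>f x + g x - (c x + d x)\<bar> \<partial>M) \<le> (\<integral>x. \<bar>f x - c x\<bar> + \<bar>g x - d x\<bar> \<partial>M)"
    by (rule integral_mono) (use int add in auto)
  also have "\<dots> = (\<integral>x. \<bar>f x - c x\<bar> \<partial>M) + (\<integral>x. \<bar>g x - d x\<bar> \<partial>M)" using int add by simp
  also have "\<dots> < e" using c by simp
  finally show ?case using c by (intro exI[of _ "\<lambda>x. c x + d x"]) (auto intro!: continuous_intros)
next
  case (lim f s)
  have "(\<lambda>i. \<integral>x. \<bar>f x - s i x\<bar> \<partial>M) \<longlonglongrightarrow> (\<integral>x. 0 \<partial>M)"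
  proof (rule integral_dominated_convergence[where w = "\<lambda>x. 3 * \<bar>f x\<bar>"])
    show "AE x in M. (\<lambda>i. \<bar>f x - s i x\<bar>) \<longlonglongrightarrow> 0"
    proof (rule AE_I2)
      fix x assume "x \<in> space M"
      then have "(\<lambda>i. \<bar>f x - s i x\<bar>) \<longlonglongrightarrow> \<bar>f x - f x\<bar>" by (intro tendsto_intros lim)
      then show "(\<lambda>i. \<bar>f x - s i x\<bar>) \<longlonglongrightarrow> 0" by simp
    qed
    show "AE x in M. norm \<bar>f x - s i x\<bar> \<le> 3 * \<bar>f x\<bar>" for i
    proof (rule AE_I2)
      fix x assume "x \<in> space M"
      then have "\<bar>s i x\<bar> \<le> 2 * \<bar>f x\<bar>" using lim.hyps(3)[of x i] by simp
      then show "norm \<bar>f x - s i x\<bar> \<le> 3 * \<bar>f x\<bar>" using abs_triangle_ineq4[of "f x" "s i x"] by simp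
    qed
  qed (use lim in auto)
  then obtain i where i: "(\<integral>x. \<bar>f x - s i x\<bar> \<partial>M) < e/2"
    using LIMSEQ_D[of _ 0 "e/2"] lim.prems by fastforce
  obtain c where c: "continuous_on K c" "(\<integral>x. \<bar>s i x - c x\<bar> \<partial>M) < e/2"
    using lim.IH[of "e/2" i] lim.prems by auto
  have int: "integrable M c" using K_integrable_cont[OF M] c by auto
  have "(\<integral>x. \<bar>f x - c x\<bar> \<partial>M) \<le> (\<integral>x. \<bar>f x - s i x\<bar> + \<bar>s i x - c x\<bar> \<partial>M)"
    by (rule integral_mono) (use int lim in auto)
  also have "\<dots> = (\<integral>x. \<bar>f x - s i x\<bar> \<partial>M) + (\<integral>x. \<bar>s i x - c x\<bar> \<partial>M)" using int lim by simp
  also have "\<dots> < e" using c i by simp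
  finally show ?case using c by blast
qed

text \<open>For functions bounded by N the squared difference is at most 2N times the difference, so
  an L1 approximation of the truncated function, truncated as well, is good in L2.\<close>

lemma L2_approx:
  assumes M: "K_measure M" and f: "f \<in> L2 M" and "0 < (e::real)"
  shows "\<exists>c. continuous_on K c \<and> L2_norm M (\<lambda>x. c x - f x) < e"
proof -
  interpret finite_measure M using M unfolding K_measure_def by simp
  define clip where "clip N y = max (- real N) (min (real N) y)" for N y
  have clip: "\<bar>clip N y\<bar> \<le> real N" "\<bar>clip N y - clip N z\<bar> \<le> \<bar>y - z\<bar>" "\<bar>clip N y - y\<bar> \<le> \<bar>y\<bar>" for N y z
    unfolding clip_def by (auto simp: max_def min_def)
  note [measurable] = L2_meas[OF f]
  have cm [measurable]: "(\<lambda>x. clip N (f x)) \<in> borel_measurable M" for N unfolding clip_def by measurable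
  have "(\<lambda>N. \<integral>x. (clip N (f x) - f x)\<^sup>2 \<partial>M) \<longlonglongrightarrow> (\<integral>x. 0 \<partial>M)"
  proof (rule integral_dominated_convergence[where w = "\<lambda>x. (f x)\<^sup>2"])
    show "AE x in M. (\<lambda>N. (clip N (f x) - f x)\<^sup>2) \<longlonglongrightarrow> 0"
    proof (rule AE_I2)
      fix x
      obtain N0 :: nat where N0: "\<bar>f x\<bar> < real N0" using reals_Archimedean2 by blast
      have "(clip N (f x) - f x)\<^sup>2 = 0" if "N \<ge> N0" for N
      proof -
        have "\<bar>f x\<bar> \<le> real N" using N0 that by linarith
        then show ?thesis unfolding clip_def by (auto simp: max_def min_def)
      qed
      then show "(\<lambda>N. (clip N (f x) - f x)\<^sup>2) \<longlonglongrightarrow> 0"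
        by (intro tendsto_eventually) (auto simp: eventually_sequentially)
    qed
    show "AE x in M. norm ((clip N (f x) - f x)\<^sup>2) \<le> (f x)\<^sup>2" for N
      using clip(3)[of N] by (intro AE_I2) (simp add: abs_le_square_iff)
  qed (use L2_int[OF f] in auto)
  then obtain N where "\<bar>\<integral>x. (clip N (f x) - f x)\<^sup>2 \<partial>M\<bar> < (e/2)\<^sup>2"
    using LIMSEQ_D[of _ 0 "(e/2)\<^sup>2"] \<open>0 < e\<close> by (fastforce simp del: power_divide)
  then have N: "L2_norm M (\<lambda>x. clip N (f x) - f x) < e/2"
    unfolding L2_norm_def using \<open>0 < e\<close> by (intro real_less_lsqrt) auto
  have int: "integrable M (\<lambda>x. clip N (f x))"
    by (rule integrable_const_bound[where B = "real N"]) (use clip(1) in auto)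
  \<comment> \<open>Chosen so that 2N d lies below the square of e/2; adding 1 keeps the divisor
    positive for N = 0.\<close>
  define d where "d = (e/2)\<^sup>2 / (2 * real N + 1)"
  have "d > 0" unfolding d_def using \<open>0 < e\<close> by (simp add: add_nonneg_pos)
  then obtain c where c: "continuous_on K c" "(\<integral>x. \<bar>clip N (f x) - c x\<bar> \<partial>M) < d"
    using L1_approx[OF M int] by blast
  let ?c = "\<lambda>x. clip N (c x)"
  have cc: "continuous_on K ?c" unfolding clip_def by (intro continuous_intros c)
  have ci: "integrable M c" using K_integrable_cont[OF M c(1)] .
  have L2s: "?c \<in> L2 M" "(\<lambda>x. clip N (f x)) \<in> L2 M"
    using K_L2_cont[OF M cc] bounded_L2(1)[OF cm clip(1)] by auto
  have "(\<integral>x. (?c x - clip N (f x))\<^sup>2 \<partial>M) \<le> (\<integral>x. 2 * real N * \<bar>clip N (f x) - c x\<bar> \<partial>M)"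
  proof (rule integral_mono)
    show "integrable M (\<lambda>x. (?c x - clip N (f x))\<^sup>2)" using L2_int[OF L2_diff[OF L2s]] .
    show "integrable M (\<lambda>x. 2 * real N * \<bar>clip N (f x) - c x\<bar>)" using int ci by auto
    fix x
    have "\<bar>?c x - clip N (f x)\<bar> \<le> 2 * real N" using clip(1)[of N "c x"] clip(1)[of N "f x"] by linarith
    moreover have "\<bar>?c x - clip N (f x)\<bar> \<le> \<bar>clip N (f x) - c x\<bar>"
      using clip(1)[of N "f x"] unfolding clip_def by (auto simp: max_def min_def)
    ultimately have "\<bar>?c x - clip N (f x)\<bar> * \<bar>?c x - clip N (f x)\<bar> \<le> (2 * real N) * \<bar>clip N (f x) - c x\<bar>"
      by (intro mult_mono) auto
    then show "(?c x - clip N (f x))\<^sup>2 \<le> 2 * real N * \<bar>clip N (f x) - c x\<bar>"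
      by (simp add: power2_eq_square)
  qed
  also have "\<dots> = 2 * real N * (\<integral>x. \<bar>clip N (f x) - c x\<bar> \<partial>M)" by simp
  also have "\<dots> \<le> 2 * real N * d" using c(2) by (intro mult_left_mono) auto
  also have "\<dots> < (2 * real N + 1) * d" using \<open>d > 0\<close> by (simp add: algebra_simps)
  also have "\<dots> = (e/2)\<^sup>2" unfolding d_def by (simp add: add_nonneg_eq_0_iff)
  finally have "L2_norm M (\<lambda>x. ?c x - clip N (f x)) < e/2"
    unfolding L2_norm_def using \<open>0 < e\<close> by (intro real_less_lsqrt) auto
  then have "L2_norm M (\<lambda>x. ?c x - f x) < e"
    using L2_norm_triangle3[OF L2s(1) L2s(2) f] N by linarith
  then show ?thesis using cc by blast
qed

section \<open>The space of one-forms\<close>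

definition wgt2 :: "(pt \<Rightarrow> real) \<Rightarrow> (pt \<Rightarrow> real) \<Rightarrow> (pt \<Rightarrow> real) \<Rightarrow> pt \<Rightarrow> pt \<Rightarrow> real" where
  "wgt2 g f1 f2 x y = (g x + g y) / 2 * ((f1 x - f1 y) * (f2 x - f2 y))"

text \<open>With the symmetric average of \<open>g\<close> at the endpoints, the Leibniz combination
  that defines the energy measure is an exact identity on every edge, without remainder.\<close>

lemma wgt2_energy_lim:
  assumes "f1 \<in> \<C> q" "f2 \<in> \<C> q" "g \<in> \<C> q"
  shows "(\<lambda>n. Q n (wgt2 g f1 f2)) \<longlonglongrightarrow>
    (energy q (\<lambda>x. f1 x * g x) f2 + energy q f1 (\<lambda>x. f2 x * g x) - energy q (\<lambda>x. f1 x * f2 x) g) / 2"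
proof -
  have eq: "Q n (wgt2 g f1 f2) = (En n (\<lambda>x. f1 x * g x) f2 + En n f1 (\<lambda>x. f2 x * g x) - En n (\<lambda>x. f1 x * f2 x) g) / 2" for n
  proof -
    have "En n (\<lambda>x. f1 x * g x) f2 + En n f1 (\<lambda>x. f2 x * g x) - En n (\<lambda>x. f1 x * f2 x) g
        = Q n (\<lambda>x y. 2 * wgt2 g f1 f2 x y)"
      unfolding En_def Q_diff[symmetric] Q_add[symmetric] wgt2_def
      by (rule Q_cong) (simp add: field_simps)
    then show ?thesis unfolding Q_cmult by simp
  qed
  show ?thesis unfolding eq using assms by (intro tendsto_intros energy_lim \<C>_mult) auto
qed

text \<open>Polarization on an edge: a product of increments is the square of their half sum minus
  the square of their half difference. The two image measures form the pair asked for by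
  \<open>is_energy_measure\<close>.\<close>

lemma wgt2_measure_lim:
  assumes f: "f1 \<in> \<C> q" "f2 \<in> \<C> q" and g: "continuous_on K g"
  shows "(\<lambda>n. Q n (wgt2 g f1 f2)) \<longlonglongrightarrow>
    (\<integral>x. g x \<partial>quantile_distr (\<lambda>x. 1/2 * f1 x + 1/2 * f2 x)) - (\<integral>x. g x \<partial>quantile_distr (\<lambda>x. 1/2 * f1 x + (-1/2) * f2 x))"
proof -
  let ?u = "\<lambda>x. 1/2 * f1 x + 1/2 * f2 x" and ?v = "\<lambda>x. 1/2 * f1 x + (-1/2) * f2 x"
  have eq: "Q n (wgt2 g f1 f2) = Q n (wgt g ?u) - Q n (wgt g ?v)" for n
    unfolding Q_diff[symmetric] by (rule Q_cong) (simp add: wgt_def wgt2_def field_simps)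
  show ?thesis unfolding eq by (rule tendsto_diff[OF Q_wgt_lim[OF \<C>_lin[OF f] g] Q_wgt_lim[OF \<C>_lin[OF f] g]])
qed

lemma K_measure_quantile: "K_measure (quantile_distr f)"
  unfolding K_measure_def using finite_quantile_distr sets_quantile_distr by blast

lemma is_energy_measure_iff:
  assumes "f1 \<in> \<C> q" "f2 \<in> \<C> q"
  shows "is_energy_measure q f1 f2 M N \<longleftrightarrow> K_measure M \<and> K_measure N \<and>
    (\<forall>g\<in>\<C> q. (\<lambda>n. Q n (wgt2 g f1 f2)) \<longlonglongrightarrow> (\<integral>x. g x \<partial>M) - (\<integral>x. g x \<partial>N))"
  unfolding is_energy_measure_def K_measure_def
  using wgt2_energy_lim[OF assms] by (metis (no_types, lifting) LIMSEQ_unique)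

lemma energy_measure_exists:
  assumes "f1 \<in> \<C> q" "f2 \<in> \<C> q"
  shows "is_energy_measure q f1 f2 (quantile_distr (\<lambda>x. 1/2 * f1 x + 1/2 * f2 x)) (quantile_distr (\<lambda>x. 1/2 * f1 x + (-1/2) * f2 x))"
  unfolding is_energy_measure_iff[OF assms]
  using K_measure_quantile wgt2_measure_lim[OF assms] \<C>_cont by blast

text \<open>An energy measure is tested only against \<open>\<C>\<close>, whereas forms have
  continuous coefficients. Any admissible pair agrees with the concrete one on \<open>\<C>\<close>,
  hence by density on all continuous functions.\<close>

lemma energy_measure_integral:
  assumes f: "f1 \<in> \<C> q" "f2 \<in> \<C> q" and g: "continuous_on K g" and MN: "is_energy_measure q f1 f2 M N"
  shows "(\<lambda>n. Q n (wgt2 g f1 f2)) \<longlonglongrightarrow> (\<integral>x. g x \<partial>M) - (\<integral>x. g x \<partial>N)"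
proof -
  define M' where "M' = quantile_distr (\<lambda>x. 1/2 * f1 x + 1/2 * f2 x)"
  define N' where "N' = quantile_distr (\<lambda>x. 1/2 * f1 x + (-1/2) * f2 x)"
  have MN': "is_energy_measure q f1 f2 M' N'" unfolding M'_def N'_def by (rule energy_measure_exists[OF f])
  have K: "K_measure M" "K_measure N" "K_measure M'" "K_measure N'"
    using MN MN' unfolding is_energy_measure_iff[OF f] by auto
  obtain fs where fs: "\<And>n. fs n \<in> \<C> q" "\<And>M. K_measure M \<Longrightarrow> (\<lambda>n. \<integral>x. fs n x \<partial>M) \<longlonglongrightarrow> (\<integral>x. g x \<partial>M)"
    using \<C>_dense[OF g] by blast
  have "(\<integral>x. fs n x \<partial>M) - (\<integral>x. fs n x \<partial>N) = (\<integral>x. fs n x \<partial>M') - (\<integral>x. fs n x \<partial>N')" for n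
    using MN MN' fs(1)[of n] unfolding is_energy_measure_iff[OF f] by (metis LIMSEQ_unique)
  then have "(\<lambda>n. (\<integral>x. fs n x \<partial>M) - (\<integral>x. fs n x \<partial>N)) \<longlonglongrightarrow> (\<integral>x. g x \<partial>M') - (\<integral>x. g x \<partial>N')"
    using tendsto_diff[OF fs(2)[OF K(3)] fs(2)[OF K(4)]] by simp
  then have "(\<integral>x. g x \<partial>M) - (\<integral>x. g x \<partial>N) = (\<integral>x. g x \<partial>M') - (\<integral>x. g x \<partial>N')"
    using tendsto_diff[OF fs(2)[OF K(1)] fs(2)[OF K(2)]] LIMSEQ_unique by blast
  then show ?thesis using wgt2_measure_lim[OF f g] unfolding M'_def N'_def by simp
qed

lemma nu_integral_lim:
  assumes f: "f1 \<in> \<C> q" "f2 \<in> \<C> q" and g: "continuous_on K g"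
  shows "(\<lambda>n. Q n (wgt2 g f1 f2)) \<longlonglongrightarrow> nu_integral q f1 f2 g"
proof -
  define P where "P = (SOME MN. is_energy_measure q f1 f2 (fst MN) (snd MN))"
  have "is_energy_measure q f1 f2 (fst P) (snd P)"
    unfolding P_def by (rule someI_ex) (use energy_measure_exists[OF f] in force)
  from energy_measure_integral[OF f g this] show ?thesis
    unfolding nu_integral_def P_def[symmetric] by (simp add: case_prod_unfold)
qed

lemma wgt2_self: "wgt2 g f f = wgt g f"
  by (simp add: wgt2_def wgt_def fun_eq_iff)

lemma K_measure_null: "K_measure (null_measure Kb)"
  unfolding K_measure_def by (auto intro!: finite_measureI)

lemma nu_eq:
  assumes "f \<in> \<C> q" shows "nu q f = quantile_distr f"
  unfolding nu_def
proof (rule the_equality)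
  show e: "is_energy_measure q f f (quantile_distr f) (null_measure Kb)"
    unfolding is_energy_measure_iff[OF assms assms] wgt2_self
    using K_measure_quantile K_measure_null Q_wgt_lim[OF assms \<C>_cont] by simp
  fix M assume "is_energy_measure q f f M (null_measure Kb)"
  then show "M = quantile_distr f"
    using e unfolding is_energy_measure_iff[OF assms assms]
    by (intro K_measure_eqI) (auto dest: LIMSEQ_unique)
qed

lemma K_measure_nu: "f \<in> \<C> q \<Longrightarrow> K_measure (nu q f)"
  using nu_eq K_measure_quantile by simp

lemma nu_lim: "f \<in> \<C> q \<Longrightarrow> continuous_on K g \<Longrightarrow> (\<lambda>n. Q n (wgt g f)) \<longlonglongrightarrow> (\<integral>x. g x \<partial>nu q f)"
  using nu_eq Q_wgt_lim by simp

lemma nu_integral_self: "f \<in> \<C> q \<Longrightarrow> continuous_on K g \<Longrightarrow> nu_integral q f f g = (\<integral>x. g x \<partial>nu q f)"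
  using nu_integral_lim[of f f g] nu_lim[of f g] unfolding wgt2_self using LIMSEQ_unique by blast

section \<open>Discrete scalar products of one-forms\<close>

definition QQ :: "nat \<Rightarrow> (pt \<times> pt \<Rightarrow> real) \<Rightarrow> (pt \<times> pt \<Rightarrow> real) \<Rightarrow> real" where
  "QQ n a b = Q n (\<lambda>x y. a (x, y) * b (x, y))"

lemma QQ_add_left: "QQ n (\<lambda>p. a p + a' p) b = QQ n a b + QQ n a' b"
  unfolding QQ_def Q_add[symmetric] by (rule Q_cong) (simp add: algebra_simps)

lemma QQ_add_right: "QQ n b (\<lambda>p. a p + a' p) = QQ n b a + QQ n b a'"
  unfolding QQ_def Q_add[symmetric] by (rule Q_cong) (simp add: algebra_simps)

lemma QQ_commute: "QQ n a b = QQ n b a"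
  unfolding QQ_def by (simp add: mult.commute)

lemma QQ_cmult_left: "QQ n (\<lambda>p. c * a p) b = c * QQ n a b"
  unfolding QQ_def Q_cmult[symmetric] by (rule Q_cong) (simp add: algebra_simps)

text \<open>
  The averages satisfy $\overline{g_1 g_2} - \overline{g_1}\,\overline{g_2} = \frac14\,d_ug_1\,d_ug_2$,
  which is uniformly small on the edges of a high level. Hence the scalar product of simple forms is the
  limit of their discrete scalar products and does not depend on the representations.
\<close>

lemma QQ_avg_lim:
  assumes f: "f1 \<in> \<C> q" "f2 \<in> \<C> q" and g: "continuous_on K g1" "continuous_on K g2"
  shows "(\<lambda>n. QQ n (\<lambda>p. avg g1 p * d_u f1 p) (\<lambda>p. avg g2 p * d_u f2 p)) \<longlonglongrightarrow> nu_integral q f1 f2 (\<lambda>x. g1 x * g2 x)"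
proof -
  let ?r = "\<lambda>n. Q n (\<lambda>x y. (g1 x - g1 y) * (g2 x - g2 y) * ((f1 x - f1 y) * (f2 x - f2 y)) / 4)"
  have eq: "QQ n (\<lambda>p. avg g1 p * d_u f1 p) (\<lambda>p. avg g2 p * d_u f2 p) = Q n (wgt2 (\<lambda>x. g1 x * g2 x) f1 f2) - ?r n" for n
    unfolding QQ_def Q_diff[symmetric] by (rule Q_cong) (simp add: wgt2_def avg_def d_u_def field_simps)
  obtain B where B: "B \<ge> 0" "\<And>x. x \<in> K \<Longrightarrow> \<bar>g2 x\<bar> \<le> B" using cont_bounded[OF g(2)] by blast
  define E where "E = B * (energy1 q f1 + energy1 q f2)"
  have E0: "0 \<le> E" unfolding E_def using B energy1_nonneg f by simp
  have r0: "?r \<longlonglongrightarrow> 0"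
  proof (rule LIMSEQ_I)
    fix r :: real assume "r > 0"
    define e where "e = r / (E + 1)"
    have e: "e > 0" unfolding e_def using E0 \<open>r > 0\<close> by simp
    obtain N where N: "\<And>n x y. n \<ge> N \<Longrightarrow> x \<in> K \<Longrightarrow> y \<in> K \<Longrightarrow> dist x y \<le> diamK / 2 ^ n \<Longrightarrow> \<bar>g1 x - g1 y\<bar> \<le> e"
      using osc_small[OF g(1) e] by blast
    have "\<bar>?r n\<bar> < r" if n: "n \<ge> N" for n
    proof -
      let ?P = "\<lambda>x y. (g1 x - g1 y) * (g2 x - g2 y) * ((f1 x - f1 y) * (f2 x - f2 y)) / 4"
      let ?R = "\<lambda>x y. e * B * ((f1 x - f1 y) * (f1 x - f1 y) + (f2 x - f2 y) * (f2 x - f2 y))"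
      have b: "\<bar>?P x y\<bar> \<le> ?R x y" if xy: "x \<in> K" "y \<in> K" "dist x y \<le> diamK / 2 ^ n" for x y
      proof -
        have g1: "\<bar>g1 x - g1 y\<bar> \<le> e" using N[OF n xy] .
        have g2: "\<bar>g2 x - g2 y\<bar> \<le> 2 * B" using B(2)[OF xy(1)] B(2)[OF xy(2)] by linarith
        have ff: "\<bar>(f1 x - f1 y) * (f2 x - f2 y)\<bar> \<le> (f1 x - f1 y) * (f1 x - f1 y) + (f2 x - f2 y) * (f2 x - f2 y)"
        proof -
          have "0 \<le> (\<bar>f1 x - f1 y\<bar> - \<bar>f2 x - f2 y\<bar>)\<^sup>2" by simp
          then have "2 * (\<bar>f1 x - f1 y\<bar> * \<bar>f2 x - f2 y\<bar>) \<le> (f1 x - f1 y)\<^sup>2 + (f2 x - f2 y)\<^sup>2" by (simp add: power2_diff)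
          moreover have "0 \<le> \<bar>f1 x - f1 y\<bar> * \<bar>f2 x - f2 y\<bar>" by simp
          ultimately have "\<bar>f1 x - f1 y\<bar> * \<bar>f2 x - f2 y\<bar> \<le> (f1 x - f1 y)\<^sup>2 + (f2 x - f2 y)\<^sup>2" by linarith
          then show ?thesis unfolding abs_mult power2_eq_square .
        qed
        have "\<bar>(g1 x - g1 y) * (g2 x - g2 y)\<bar> \<le> e * (2 * B)" unfolding abs_mult using g1 g2 e by (intro mult_mono) auto
        then have "\<bar>(g1 x - g1 y) * (g2 x - g2 y) * ((f1 x - f1 y) * (f2 x - f2 y))\<bar>
            \<le> e * (2 * B) * ((f1 x - f1 y) * (f1 x - f1 y) + (f2 x - f2 y) * (f2 x - f2 y))"
          unfolding abs_mult[of "(g1 x - g1 y) * (g2 x - g2 y)"] using ff e B by (intro mult_mono) auto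
        moreover have "0 \<le> ?R x y" using e B by simp
        ultimately show ?thesis unfolding abs_divide by simp
      qed
      have "Q n ?P \<le> Q n ?R" by (rule Q_mono, rule abs_le_D1[OF b]; assumption)
      moreover have "Q n (\<lambda>x y. - 1 * ?P x y) \<le> Q n ?R" 
        by (rule Q_mono, subst mult_minus1, rule abs_le_D2[OF b]; assumption)
      ultimately have "\<bar>?r n\<bar> \<le> Q n ?R" unfolding Q_cmult by (simp add: abs_le_iff)
      also have "\<dots> = e * B * (En n f1 f1 + En n f2 f2)" unfolding Q_cmult Q_add En_def ..
      also have "\<dots> \<le> e * B * (energy1 q f1 + energy1 q f2)"
        using f e B En_le_energy1 by (intro mult_left_mono add_mono) auto
      also have "\<dots> = e * E" unfolding E_def by simp
      also have "\<dots> < e * (E + 1)" using e by simp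
      also have "\<dots> = r" unfolding e_def using E0 by simp
      finally show ?thesis .
    qed
    then show "\<exists>no. \<forall>n\<ge>no. norm (?r n - 0) < r" by auto
  qed
  show ?thesis unfolding eq
    using tendsto_diff[OF nu_integral_lim[OF f continuous_on_mult[OF g]] r0] by simp
qed

lemma form_of_Cons: "form_of ((g, f) # xs) = (\<lambda>p. avg g p * d_u f p + form_of xs p)"
  by (simp add: form_of_def)

lemma form_of_Nil: "form_of [] = (\<lambda>p. 0)"
  by (simp add: form_of_def)

lemma QQ_form_lim:
  assumes xs: "set xs \<subseteq> {g. continuous_on K g} \<times> \<C> q" and ys: "set ys \<subseteq> {g. continuous_on K g} \<times> \<C> q"
  shows "(\<lambda>n. QQ n (form_of xs) (form_of ys)) \<longlonglongrightarrow>
    (\<Sum>(g1, f1)\<leftarrow>xs. \<Sum>(g2, f2)\<leftarrow>ys. nu_integral q f1 f2 (\<lambda>x. g1 x * g2 x))"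
  using xs
proof (induction xs)
  case Nil
  show ?case unfolding form_of_Nil QQ_def by simp
next
  case (Cons gf xs)
  obtain g1 f1 where gf: "gf = (g1, f1)" by (cases gf)
  have 1: "continuous_on K g1" "f1 \<in> \<C> q" using Cons.prems gf by auto
  have "(\<lambda>n. QQ n (\<lambda>p. avg g1 p * d_u f1 p) (form_of ys)) \<longlonglongrightarrow> (\<Sum>(g2, f2)\<leftarrow>ys. nu_integral q f1 f2 (\<lambda>x. g1 x * g2 x))"
    using ys
  proof (induction ys)
    case Nil
    show ?case unfolding form_of_Nil QQ_def by simp
  next
    case (Cons gf' ys)
    obtain g2 f2 where gf': "gf' = (g2, f2)" by (cases gf')
    have 2: "continuous_on K g2" "f2 \<in> \<C> q" using Cons.prems gf' by auto
    have "QQ n (\<lambda>p. avg g1 p * d_u f1 p) (form_of (gf' # ys)) =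
        QQ n (\<lambda>p. avg g1 p * d_u f1 p) (\<lambda>p. avg g2 p * d_u f2 p) + QQ n (\<lambda>p. avg g1 p * d_u f1 p) (form_of ys)" for n
      unfolding gf' form_of_Cons by (rule QQ_add_right)
    then show ?case using tendsto_add[OF QQ_avg_lim[OF 1(2) 2(2) 1(1) 2(1)] Cons.IH] Cons.prems by (simp add: gf')
  qed
  then show ?case unfolding gf form_of_Cons QQ_add_left
    using Cons by (auto intro!: tendsto_add)
qed

lemma simple_inner_lim:
  assumes "a \<in> simple_forms q" "b \<in> simple_forms q"
  shows "(\<lambda>n. QQ n a b) \<longlonglongrightarrow> simple_inner q a b"
proof -
  define P where "P c \<longleftrightarrow> (\<exists>xs ys. represents q xs a \<and> represents q ys b \<and>
     c = (\<Sum>(g1, f1)\<leftarrow>xs. \<Sum>(g2, f2)\<leftarrow>ys. nu_integral q f1 f2 (\<lambda>x. g1 x * g2 x)))" for c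
  have *: "(\<lambda>n. QQ n a b) \<longlonglongrightarrow> c" if "P c" for c
    using that QQ_form_lim unfolding P_def represents_def by blast
  obtain xs ys where "represents q xs a" "represents q ys b" using assms unfolding simple_forms_def by blast
  then have "\<exists>c. P c" unfolding P_def by blast
  then have "\<exists>!c. P c" using LIMSEQ_unique[OF * *] by (rule ex_ex1I)
  from theI'[OF this] show ?thesis unfolding simple_inner_def P_def[symmetric] by (rule *)
qed

lemma simple_form_basic: "continuous_on K g \<Longrightarrow> f \<in> \<C> q \<Longrightarrow> (\<lambda>p. avg g p * d_u f p) \<in> simple_forms q"
  unfolding simple_forms_def represents_def by (auto intro!: exI[of _ "[(g, f)]"] simp: form_of_def)

lemma simple_form_d: "f \<in> \<C> q \<Longrightarrow> d_u f \<in> simple_forms q"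
  using simple_form_basic[of "\<lambda>_. 1" f] by (simp add: avg_def case_prod_unfold)

lemma simple_form_lin:
  assumes "a \<in> simple_forms q" "b \<in> simple_forms q"
  shows "(\<lambda>p. a p + c * b p) \<in> simple_forms q"
proof -
  obtain xs ys where xs: "represents q xs a" and ys: "represents q ys b" using assms unfolding simple_forms_def by blast
  let ?zs = "xs @ map (\<lambda>(g, f). (\<lambda>x. c * g x, f)) ys"
  have e: "form_of (map (\<lambda>(g, f). (\<lambda>x. c * g x, f)) ys) = (\<lambda>p. c * form_of ys p)"
  proof (induction ys)
    case (Cons gf ys)
    obtain g f where gf: "gf = (g, f)" by (cases gf)
    have "avg (\<lambda>x. c * g x) p = c * avg g p" for p
      by (simp add: avg_def case_prod_unfold algebra_simps)
    then show ?case using Cons by (simp add: gf form_of_Cons algebra_simps)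
  qed (simp add: form_of_Nil)
  have "form_of ?zs = (\<lambda>p. form_of xs p + form_of (map (\<lambda>(g, f). (\<lambda>x. c * g x, f)) ys) p)"
    by (simp add: form_of_def)
  then have z1: "form_of ?zs = (\<lambda>p. a p + c * b p)"
    unfolding e using xs ys unfolding represents_def by simp
  have z2: "set ?zs \<subseteq> {g. continuous_on K g} \<times> \<C> q"
  proof -
    have "set xs \<subseteq> {g. continuous_on K g} \<times> \<C> q" "set ys \<subseteq> {g. continuous_on K g} \<times> \<C> q"
      using xs ys unfolding represents_def by auto
    moreover have "continuous_on K (\<lambda>x. c * g x)" if "continuous_on K g" for g
      using that by (intro continuous_intros)
    ultimately show ?thesis by (auto simp: subset_iff)
  qed
  have "represents q ?zs (\<lambda>p. a p + c * b p)"
    unfolding represents_def by (rule conjI[OF z2 z1[symmetric]])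
  then show ?thesis unfolding simple_forms_def by blast
qed

lemma simple_form_diff: "a \<in> simple_forms q \<Longrightarrow> b \<in> simple_forms q \<Longrightarrow> (\<lambda>p. a p - b p) \<in> simple_forms q"
  and simple_form_add: "a \<in> simple_forms q \<Longrightarrow> b \<in> simple_forms q \<Longrightarrow> (\<lambda>p. a p + b p) \<in> simple_forms q"
  using simple_form_lin[of a b "-1"] simple_form_lin[of a b 1] by simp_all

lemma simple_inner_commute:
  "a \<in> simple_forms q \<Longrightarrow> b \<in> simple_forms q \<Longrightarrow> simple_inner q a b = simple_inner q b a"
  using simple_inner_lim[of a b] simple_inner_lim[of b a] QQ_commute[of _ a b] LIMSEQ_unique by simp

lemma simple_inner_lin:
  assumes "a \<in> simple_forms q" "b \<in> simple_forms q" "d \<in> simple_forms q"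
  shows "simple_inner q (\<lambda>p. a p + c * b p) d = simple_inner q a d + c * simple_inner q b d"
proof -
  have "(\<lambda>n. QQ n (\<lambda>p. a p + c * b p) d) \<longlonglongrightarrow> simple_inner q a d + c * simple_inner q b d"
    unfolding QQ_add_left QQ_cmult_left using assms by (intro tendsto_intros simple_inner_lim)
  then show ?thesis using simple_inner_lim[OF simple_form_lin assms(3)] assms LIMSEQ_unique by blast
qed

lemma simple_inner_nonneg: "a \<in> simple_forms q \<Longrightarrow> 0 \<le> simple_inner q a a"
  by (rule LIMSEQ_le_const[OF simple_inner_lim]) (auto intro!: Q_nonneg simp: QQ_def)

lemma simple_inner_expand:
  assumes "a \<in> simple_forms q" "b \<in> simple_forms q"
  shows "simple_inner q (\<lambda>p. a p + t * b p) (\<lambda>p. a p + t * b p)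
    = simple_inner q a a + 2 * t * simple_inner q a b + t\<^sup>2 * simple_inner q b b"
  using assms simple_form_lin[OF assms, of t] simple_inner_commute[of a "\<lambda>p. a p + t * b p"]
    simple_inner_commute[of b "\<lambda>p. a p + t * b p"] simple_inner_commute[of b a]
  by (simp add: simple_inner_lin power2_eq_square algebra_simps)

lemma simple_inner_CS:
  assumes "a \<in> simple_forms q" "b \<in> simple_forms q"
  shows "(simple_inner q a b)\<^sup>2 \<le> simple_inner q a a * simple_inner q b b"
  by (rule quadratic_nonneg_imp[OF simple_inner_nonneg[OF assms(2)]])
     (use simple_inner_nonneg[OF simple_form_lin[OF assms]] simple_inner_expand[OF assms] in simp)

lemma simple_norm_triangle:
  assumes "a \<in> simple_forms q" "b \<in> simple_forms q"
  shows "simple_norm q (\<lambda>p. a p + b p) \<le> simple_norm q a + simple_norm q b"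
  using sqrt_triangle[OF simple_inner_nonneg[OF assms(1)] simple_inner_nonneg[OF assms(2)] simple_inner_CS[OF assms]]
    simple_inner_expand[OF assms, of 1] unfolding simple_norm_def by simp

lemma simple_norm_nonneg: "a \<in> simple_forms q \<Longrightarrow> 0 \<le> simple_norm q a"
  unfolding simple_norm_def using simple_inner_nonneg by simp

lemma simple_norm_power2: "a \<in> simple_forms q \<Longrightarrow> (simple_norm q a)\<^sup>2 = simple_inner q a a"
  unfolding simple_norm_def using simple_inner_nonneg by simp

lemma simple_norm_minus:
  assumes "a \<in> simple_forms q" "b \<in> simple_forms q"
  shows "simple_norm q (\<lambda>p. a p - b p) = simple_norm q (\<lambda>p. b p - a p)"
proof -
  have "QQ n (\<lambda>p. a p - b p) (\<lambda>p. a p - b p) = QQ n (\<lambda>p. b p - a p) (\<lambda>p. b p - a p)" for n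
    unfolding QQ_def by (rule Q_cong) (simp add: algebra_simps)
  then show ?thesis unfolding simple_norm_def
    using simple_inner_lim[OF simple_form_diff[OF assms] simple_form_diff[OF assms]]
      simple_inner_lim[OF simple_form_diff[OF assms(2,1)] simple_form_diff[OF assms(2,1)]] LIMSEQ_unique by auto
qed

lemma simple_norm_abs_diff:
  assumes "a \<in> simple_forms q" "b \<in> simple_forms q"
  shows "\<bar>simple_norm q a - simple_norm q b\<bar> \<le> simple_norm q (\<lambda>p. a p - b p)"
  using simple_norm_triangle[OF simple_form_diff[OF assms] assms(2)]
    simple_norm_triangle[OF simple_form_diff[OF assms(2,1)] assms(1)] simple_norm_minus[OF assms] by simp

section \<open>The completion\<close>

lemma \<H>_simple: "v \<in> \<H> q \<Longrightarrow> v n \<in> simple_forms q"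
  unfolding \<H>_def by simp

lemma \<H>_const: "a \<in> simple_forms q \<Longrightarrow> (\<lambda>n. a) \<in> \<H> q"
proof -
  assume a: "a \<in> simple_forms q"
  have "simple_inner q (\<lambda>p. 0) (\<lambda>p. 0) = 0"
    using simple_inner_lim[OF simple_form_diff[OF a a] simple_form_diff[OF a a]]
    by (simp add: QQ_def LIMSEQ_const_iff)
  then show ?thesis using a unfolding \<H>_def by (simp add: simple_norm_def)
qed

lemma \<H>_lin:
  assumes "v \<in> \<H> q" "v' \<in> \<H> q" shows "(\<lambda>n p. v n p + c * v' n p) \<in> \<H> q"
  unfolding \<H>_def mem_Collect_eq
proof (intro conjI allI impI)
  show "(\<lambda>p. v n p + c * v' n p) \<in> simple_forms q" for n
    using assms \<H>_simple simple_form_lin by blast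
  fix e :: real assume "e > 0"
  define d where "d = e / (1 + \<bar>c\<bar>)"
  have "d > 0" unfolding d_def using \<open>e > 0\<close> by simp
  obtain N where N: "\<And>m n. m \<ge> N \<Longrightarrow> n \<ge> N \<Longrightarrow> simple_norm q (\<lambda>p. v m p - v n p) < d"
    using assms(1) \<open>d > 0\<close> unfolding \<H>_def by blast
  obtain N' where N': "\<And>m n. m \<ge> N' \<Longrightarrow> n \<ge> N' \<Longrightarrow> simple_norm q (\<lambda>p. v' m p - v' n p) < d"
    using assms(2) \<open>d > 0\<close> unfolding \<H>_def by blast
  have "simple_norm q (\<lambda>p. (v m p + c * v' m p) - (v n p + c * v' n p)) < e" if "m \<ge> max N N'" "n \<ge> max N N'" for m n
  proof -
    let ?a = "\<lambda>p. v m p - v n p" and ?b = "\<lambda>p. v' m p - v' n p"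
    have s: "?a \<in> simple_forms q" "?b \<in> simple_forms q"
      by (rule simple_form_diff[OF \<H>_simple \<H>_simple], fact, fact)+
    have z: "(\<lambda>p. 0) \<in> simple_forms q" using simple_form_diff[OF s(2) s(2)] by simp
    have cb: "(\<lambda>p. c * ?b p) \<in> simple_forms q" using simple_form_lin[OF z s(2), of c] by simp
    have "simple_inner q (\<lambda>p. c * ?b p) (\<lambda>p. c * ?b p) = c\<^sup>2 * simple_inner q ?b ?b"
    proof -
      have "QQ n (\<lambda>p. c * ?b p) (\<lambda>p. c * ?b p) = c\<^sup>2 * QQ n ?b ?b" for n
        unfolding QQ_def Q_cmult[symmetric] by (rule Q_cong) (simp add: power2_eq_square)
      then have "(\<lambda>n. QQ n (\<lambda>p. c * ?b p) (\<lambda>p. c * ?b p)) \<longlonglongrightarrow> c\<^sup>2 * simple_inner q ?b ?b"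
        using tendsto_mult[OF tendsto_const simple_inner_lim[OF s(2) s(2)]] by simp
      then show ?thesis using simple_inner_lim[OF cb cb] LIMSEQ_unique by blast
    qed
    then have c: "simple_norm q (\<lambda>p. c * ?b p) = \<bar>c\<bar> * simple_norm q ?b"
      unfolding simple_norm_def by (simp add: real_sqrt_mult)
    have "(\<lambda>p. (v m p + c * v' m p) - (v n p + c * v' n p)) = (\<lambda>p. ?a p + c * ?b p)" by (simp add: algebra_simps)
    then have "simple_norm q (\<lambda>p. (v m p + c * v' m p) - (v n p + c * v' n p)) \<le> simple_norm q ?a + \<bar>c\<bar> * simple_norm q ?b"
      using simple_norm_triangle[OF s(1) cb] c by simp
    also have "\<dots> < d + \<bar>c\<bar> * d"
      using N[of m n] N'[of m n] that by (intro add_less_le_mono mult_left_mono) auto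
    also have "\<dots> = d * (1 + \<bar>c\<bar>)" by (simp add: algebra_simps)
    also have "\<dots> = e" unfolding d_def by (simp add: add_nonneg_eq_0_iff)
    finally show ?thesis .
  qed
  then show "\<exists>N. \<forall>m\<ge>N. \<forall>n\<ge>N. simple_norm q (\<lambda>p. (v m p + c * v' m p) - (v n p + c * v' n p)) < e" by blast
qed

lemma \<H>_norm_convergent:
  assumes "v \<in> \<H> q" shows "convergent (\<lambda>n. simple_inner q (v n) (v n))"
proof -
  have "Cauchy (\<lambda>n. simple_norm q (v n))"
  proof (rule metric_CauchyI)
    fix e :: real assume "e > 0"
    then obtain N where N: "\<And>m n. m \<ge> N \<Longrightarrow> n \<ge> N \<Longrightarrow> simple_norm q (\<lambda>p. v m p - v n p) < e"
      using assms unfolding \<H>_def by blast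
    have "dist (simple_norm q (v m)) (simple_norm q (v n)) < e" if "m \<ge> N" "n \<ge> N" for m n
      using simple_norm_abs_diff[OF \<H>_simple[OF assms] \<H>_simple[OF assms], of m n] N[OF that]
      by (simp add: dist_real_def)
    then show "\<exists>M. \<forall>m\<ge>M. \<forall>n\<ge>M. dist (simple_norm q (v m)) (simple_norm q (v n)) < e" by blast
  qed
  then obtain l where "(\<lambda>n. simple_norm q (v n)) \<longlonglongrightarrow> l" using real_Cauchy_convergent convergent_def by blast
  then have "(\<lambda>n. (simple_norm q (v n))\<^sup>2) \<longlonglongrightarrow> l\<^sup>2" by (intro tendsto_intros)
  then show ?thesis using simple_norm_power2[OF \<H>_simple[OF assms]] by (auto simp: convergent_def)
qed

text \<open>A Cauchy sequence has convergent norms; polarization carries this over to mixed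
  products. This makes the \<open>lim\<close> in \<open>\<H>_inner\<close> a genuine limit.\<close>

lemma \<H>_inner_lim:
  assumes "v \<in> \<H> q" "v' \<in> \<H> q"
  shows "(\<lambda>n. simple_inner q (v n) (v' n)) \<longlonglongrightarrow> \<H>_inner q v v'"
proof -
  have eq: "simple_inner q (v n) (v' n) = (simple_inner q (\<lambda>p. v n p + 1 * v' n p) (\<lambda>p. v n p + 1 * v' n p)
       - simple_inner q (\<lambda>p. v n p + (-1) * v' n p) (\<lambda>p. v n p + (-1) * v' n p)) / 4" for n
    unfolding simple_inner_expand[OF \<H>_simple[OF assms(1)] \<H>_simple[OF assms(2)]] by simp
  have "convergent (\<lambda>n. (simple_inner q (\<lambda>p. v n p + 1 * v' n p) (\<lambda>p. v n p + 1 * v' n p)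
       - simple_inner q (\<lambda>p. v n p + (-1) * v' n p) (\<lambda>p. v n p + (-1) * v' n p)) / 4)"
  proof -
    obtain L1 L2 where "(\<lambda>n. simple_inner q (\<lambda>p. v n p + 1 * v' n p) (\<lambda>p. v n p + 1 * v' n p)) \<longlonglongrightarrow> L1"
      "(\<lambda>n. simple_inner q (\<lambda>p. v n p + (-1) * v' n p) (\<lambda>p. v n p + (-1) * v' n p)) \<longlonglongrightarrow> L2"
      using \<H>_norm_convergent[OF \<H>_lin[OF assms, of 1]] \<H>_norm_convergent[OF \<H>_lin[OF assms, of "-1"]]
      unfolding convergent_def by blast
    then show ?thesis by (intro convergentI[of _ "(L1 - L2) / 4"] tendsto_intros) auto
  qed
  then show ?thesis unfolding \<H>_inner_def eq[symmetric] by (simp add: convergent_LIMSEQ_iff)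
qed

lemma \<H>_inner_lin:
  assumes "v \<in> \<H> q" "v' \<in> \<H> q" "u \<in> \<H> q"
  shows "\<H>_inner q (\<lambda>n p. v n p + c * v' n p) u = \<H>_inner q v u + c * \<H>_inner q v' u"
proof -
  have "(\<lambda>n. simple_inner q (\<lambda>p. v n p + c * v' n p) (u n)) \<longlonglongrightarrow> \<H>_inner q v u + c * \<H>_inner q v' u"
    unfolding simple_inner_lin[OF \<H>_simple[OF assms(1)] \<H>_simple[OF assms(2)] \<H>_simple[OF assms(3)]]
    using assms by (intro tendsto_intros \<H>_inner_lim)
  then show ?thesis using \<H>_inner_lim[OF \<H>_lin[OF assms(1,2)] assms(3)] LIMSEQ_unique by blast
qed

lemma \<H>_diff: "v \<in> \<H> q \<Longrightarrow> v' \<in> \<H> q \<Longrightarrow> (\<lambda>n p. v n p - v' n p) \<in> \<H> q"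
  using \<H>_lin[of v v' "-1"] by simp

lemma \<H>_dist_lim:
  assumes "v \<in> \<H> q" "v' \<in> \<H> q"
  shows "(\<lambda>n. simple_norm q (\<lambda>p. v n p - v' n p)) \<longlonglongrightarrow> \<H>_dist q v v'"
  unfolding \<H>_dist_def simple_norm_def
  by (intro tendsto_real_sqrt) (rule \<H>_inner_lim[OF \<H>_diff[OF assms] \<H>_diff[OF assms]])

lemma \<H>_dist_nonneg: "v \<in> \<H> q \<Longrightarrow> v' \<in> \<H> q \<Longrightarrow> 0 \<le> \<H>_dist q v v'"
  by (rule LIMSEQ_le_const[OF \<H>_dist_lim]) (auto intro!: simple_norm_nonneg simple_form_diff \<H>_simple)

lemma \<H>_dist_commute:
  assumes "v \<in> \<H> q" "v' \<in> \<H> q" shows "\<H>_dist q v v' = \<H>_dist q v' v"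
  using \<H>_dist_lim[OF assms] \<H>_dist_lim[OF assms(2,1)] simple_norm_minus[OF \<H>_simple[OF assms(1)] \<H>_simple[OF assms(2)]]
    LIMSEQ_unique by simp

lemma \<H>_dist_triangle:
  assumes "v \<in> \<H> q" "u \<in> \<H> q" "w \<in> \<H> q"
  shows "\<H>_dist q v w \<le> \<H>_dist q v u + \<H>_dist q u w"
proof (rule LIMSEQ_le[OF \<H>_dist_lim[OF assms(1,3)] tendsto_add[OF \<H>_dist_lim[OF assms(1,2)] \<H>_dist_lim[OF assms(2,3)]]])
  have "simple_norm q (\<lambda>p. v n p - w n p) \<le> simple_norm q (\<lambda>p. v n p - u n p) + simple_norm q (\<lambda>p. u n p - w n p)" for n
    using simple_norm_triangle[OF simple_form_diff[OF \<H>_simple[OF assms(1)] \<H>_simple[OF assms(2)], of n n]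
      simple_form_diff[OF \<H>_simple[OF assms(2)] \<H>_simple[OF assms(3)], of n n]] by simp
  then show "\<exists>N. \<forall>n\<ge>N. simple_norm q (\<lambda>p. v n p - w n p) \<le> simple_norm q (\<lambda>p. v n p - u n p) + simple_norm q (\<lambda>p. u n p - w n p)"
    by blast
qed

lemma \<H>_inner_CS:
  assumes "v \<in> \<H> q" "u \<in> \<H> q"
  shows "(\<H>_inner q v u)\<^sup>2 \<le> \<H>_inner q v v * \<H>_inner q u u"
  using assms simple_inner_CS[OF \<H>_simple \<H>_simple, of v u]
  by (intro LIMSEQ_le[OF tendsto_power[OF \<H>_inner_lim] tendsto_mult[OF \<H>_inner_lim \<H>_inner_lim]]) auto

text \<open>Elements of the completion are known only up to \<open>\<H>_eq\<close>; by the
  Cauchy-Schwarz inequality representatives may be exchanged inside a pairing.\<close>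

lemma \<H>_inner_cong:
  assumes "v \<in> \<H> q" "v' \<in> \<H> q" "u \<in> \<H> q" "\<H>_eq q v v'"
  shows "\<H>_inner q v u = \<H>_inner q v' u"
proof -
  let ?d = "\<lambda>n p. v n p - v' n p"
  have "\<H>_inner q ?d ?d = 0" using assms(4) unfolding \<H>_eq_def \<H>_dist_def by simp
  then have "(\<H>_inner q ?d u)\<^sup>2 \<le> 0" using \<H>_inner_CS[OF \<H>_diff[OF assms(1,2)] assms(3)] by simp
  then have "\<H>_inner q ?d u = 0" by simp
  then show ?thesis using \<H>_inner_lin[OF assms(1-3), of "-1"] by simp
qed

lemma \<H>_inner_const: "a \<in> simple_forms q \<Longrightarrow> b \<in> simple_forms q \<Longrightarrow> \<H>_inner q (\<lambda>n. a) (\<lambda>n. b) = simple_inner q a b"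
  unfolding \<H>_inner_def by (simp add: limI)

lemma \<H>_dist_const: "a \<in> simple_forms q \<Longrightarrow> b \<in> simple_forms q \<Longrightarrow> \<H>_dist q (\<lambda>n. a) (\<lambda>n. b) = simple_norm q (\<lambda>p. a p - b p)"
  using \<H>_inner_const[OF simple_form_diff simple_form_diff, of a b a b] unfolding \<H>_dist_def simple_norm_def by simp

section \<open>The forms \<open>mult_deriv g f\<close> in the completion\<close>

lemma mult_deriv_\<H>: "continuous_on K g \<Longrightarrow> f \<in> \<C> q \<Longrightarrow> mult_deriv g f \<in> \<H> q"
  unfolding mult_deriv_def by (intro \<H>_const simple_form_basic)

lemma deriv1_\<H>: "f \<in> \<C> q \<Longrightarrow> deriv1 f \<in> \<H> q"
  unfolding deriv1_def by (intro \<H>_const simple_form_d)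

lemma \<H>_inner_mult_deriv:
  assumes "continuous_on K g" "f \<in> \<C> q" "u \<in> \<C> q"
  shows "\<H>_inner q (mult_deriv g f) (deriv1 u) = nu_integral q f u g"
proof -
  have "(\<lambda>n. QQ n (\<lambda>p. avg g p * d_u f p) (\<lambda>p. avg (\<lambda>_. 1) p * d_u u p)) \<longlonglongrightarrow> nu_integral q f u (\<lambda>x. g x * 1)"
    by (rule QQ_avg_lim) (use assms in auto)
  then have "(\<lambda>n. QQ n (\<lambda>p. avg g p * d_u f p) (d_u u)) \<longlonglongrightarrow> nu_integral q f u g"
    by (simp add: avg_def case_prod_unfold)
  moreover note b = simple_form_basic[OF assms(1,2)] and d = simple_form_d[OF assms(3)]
  ultimately show ?thesis unfolding mult_deriv_def deriv1_def \<H>_inner_const[OF b d]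
    using simple_inner_lim[OF b d] LIMSEQ_unique by blast
qed

lemma \<H>_inner_deriv1:
  assumes "f \<in> \<C> q" "u \<in> \<C> q" shows "\<H>_inner q (deriv1 f) (deriv1 u) = energy q f u"
proof -
  have "QQ n (d_u f) (d_u u) = En n f u" for n unfolding QQ_def En_def d_u_def by simp
  then show ?thesis unfolding deriv1_def
    using simple_inner_lim[OF simple_form_d simple_form_d, OF assms] \<H>_inner_const[OF simple_form_d simple_form_d, OF assms]
      energy_lim[OF assms] LIMSEQ_unique by simp
qed

text \<open>The isometry property behind \<open>star\<close>, for continuous coefficients: the
  squared norm of the difference form is the limit that defines the integral against the energy
  measure.\<close>

lemma \<H>_dist_mult_deriv:
  assumes "continuous_on K g" "continuous_on K g'" "f \<in> \<C> q"
  shows "\<H>_dist q (mult_deriv g f) (mult_deriv g' f) = L2_norm (nu q f) (\<lambda>x. g x - g' x)"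
proof -
  let ?g = "\<lambda>x. g x - g' x"
  have c: "continuous_on K ?g" using assms by (intro continuous_intros)
  have eq: "(\<lambda>p. avg g p * d_u f p - avg g' p * d_u f p) = (\<lambda>p. avg ?g p * d_u f p)"
    by (auto simp: avg_def d_u_def fun_eq_iff field_simps)
  have s: "(\<lambda>p. avg ?g p * d_u f p) \<in> simple_forms q" by (rule simple_form_basic[OF c assms(3)])
  have "simple_inner q (\<lambda>p. avg ?g p * d_u f p) (\<lambda>p. avg ?g p * d_u f p) = nu_integral q f f (\<lambda>x. ?g x * ?g x)"
    using simple_inner_lim[OF s s] QQ_avg_lim[OF assms(3,3) c c] LIMSEQ_unique by blast
  also have "\<dots> = (\<integral>x. (?g x)\<^sup>2 \<partial>nu q f)"
    by (subst nu_integral_self) (use assms(3) c in \<open>auto intro!: continuous_intros simp: power2_eq_square\<close>)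
  finally show ?thesis unfolding mult_deriv_def
    by (subst \<H>_dist_const) (use assms simple_form_basic in \<open>auto simp: eq simple_norm_def L2_norm_def\<close>)
qed

lemma deriv1_eq_mult_deriv: "deriv1 f = mult_deriv (\<lambda>_. 1) f"
  by (auto simp: deriv1_def mult_deriv_def avg_def fun_eq_iff)

lemma \<H>_inner_mult_deriv2:
  assumes "continuous_on K g1" "f1 \<in> \<C> q" "continuous_on K g2" "f2 \<in> \<C> q"
  shows "\<H>_inner q (mult_deriv g1 f1) (mult_deriv g2 f2) = nu_integral q f1 f2 (\<lambda>x. g1 x * g2 x)"
proof -
  note b = simple_form_basic[OF assms(1,2)] simple_form_basic[OF assms(3,4)]
  show ?thesis unfolding mult_deriv_def \<H>_inner_const[OF b]
    using simple_inner_lim[OF b] QQ_avg_lim[OF assms(2,4,1,3)] LIMSEQ_unique by blast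
qed

lemma \<H>_inner_diff_le:
  assumes "v \<in> \<H> q" "v' \<in> \<H> q" "u \<in> \<H> q"
  shows "\<bar>\<H>_inner q v u - \<H>_inner q v' u\<bar> \<le> \<H>_dist q v v' * sqrt (\<H>_inner q u u)"
proof -
  let ?d = "\<lambda>n p. v n p - v' n p"
  have "\<H>_inner q v u - \<H>_inner q v' u = \<H>_inner q ?d u"
    using \<H>_inner_lin[OF assms, of "-1"] by simp
  moreover have "\<bar>\<H>_inner q ?d u\<bar> \<le> sqrt (\<H>_inner q ?d ?d * \<H>_inner q u u)"
    using \<H>_inner_CS[OF \<H>_diff[OF assms(1,2)] assms(3)] by (intro real_le_rsqrt) simp
  ultimately show ?thesis unfolding \<H>_dist_def real_sqrt_mult by simp
qed

lemma \<H>_eq_sym: "v \<in> \<H> q \<Longrightarrow> v' \<in> \<H> q \<Longrightarrow> \<H>_eq q v v' \<Longrightarrow> \<H>_eq q v' v"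
  unfolding \<H>_eq_def using \<H>_dist_commute by metis

lemma \<H>_eq_trans: "v \<in> \<H> q \<Longrightarrow> u \<in> \<H> q \<Longrightarrow> w \<in> \<H> q \<Longrightarrow> \<H>_eq q v u \<Longrightarrow> \<H>_eq q u w \<Longrightarrow> \<H>_eq q v w"
  unfolding \<H>_eq_def using \<H>_dist_triangle[of v u w] \<H>_dist_nonneg[of v w] by linarith

section \<open>Chain rule\<close>

lemma compact_range:
  assumes "u \<in> \<C> q" obtains B where "B > 0" "\<And>x. x \<in> K \<Longrightarrow> u x \<in> {-B..B}"
proof -
  obtain B where B: "B \<ge> 0" "\<forall>x\<in>K. \<bar>u x\<bar> \<le> B" using cont_bounded[OF \<C>_cont[OF assms]] by blast
  show ?thesis by (rule that[of "B + 1"]) (use B in \<open>force simp: abs_le_iff\<close>)+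
qed

lemma chain_\<C>:
  assumes u: "u \<in> \<C> q" and d: "\<And>s::real. (\<phi> has_real_derivative \<phi>' s) (at s)" and c: "continuous_on UNIV \<phi>'"
  shows "(\<lambda>x. \<phi> (u x)) \<in> \<C> q"
proof -
  obtain B where B: "B > 0" "\<And>x. x \<in> K \<Longrightarrow> u x \<in> {-B..B}" using compact_range[OF u] by blast
  have "compact (\<phi>' ` {-B..B})"
    by (rule compact_continuous_image[OF continuous_on_subset[OF c]]) auto
  then obtain L where L: "\<And>s. s \<in> {-B..B} \<Longrightarrow> norm (\<phi>' s) \<le> L"
    using compact_imp_bounded[of "\<phi>' ` {-B..B}"] unfolding bounded_iff by (meson imageI)
  show ?thesis
  proof (rule \<C>_lip[OF u])
    show "continuous_on (u ` K) \<phi>"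
      using d by (intro continuous_at_imp_continuous_on ballI DERIV_isCont)
    show "\<bar>\<phi> (u x) - \<phi> (u y)\<bar> \<le> L * \<bar>u x - u y\<bar>" if "x \<in> K" "y \<in> K" for x y
      using field_differentiable_bound[of "{-B..B}" \<phi> \<phi>' L "u x" "u y"] B(2)[OF that(1)] B(2)[OF that(2)] L d
      by (auto simp: has_field_derivative_at_within)
  qed
qed

text \<open>The mean value theorem writes the increment with \<phi>' at an intermediate point, and
  uniform continuity of \<phi>' compares that value with the average at the endpoints. A C1 function
  suffices for an error of order o(|a - b|).\<close>

lemma trapezoid_bound:
  assumes d: "\<And>s::real. (\<phi> has_real_derivative \<phi>' s) (at s)" and c: "continuous_on UNIV \<phi>'" and e: "e > 0"
  shows "\<exists>\<delta>>0. \<forall>a\<in>{-B..B}. \<forall>b\<in>{-B..B}. \<bar>a - b\<bar> < \<delta> \<longrightarrow>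
    \<bar>(\<phi>' a + \<phi>' b) / 2 * (a - b) - (\<phi> a - \<phi> b)\<bar> \<le> e * \<bar>a - b\<bar>"
proof -
  have "uniformly_continuous_on {-B..B} \<phi>'"
    by (rule compact_uniformly_continuous[OF continuous_on_subset[OF c]]) auto
  then obtain \<delta> where \<delta>: "\<delta> > 0" "\<And>s t. s \<in> {-B..B} \<Longrightarrow> t \<in> {-B..B} \<Longrightarrow> dist t s < \<delta> \<Longrightarrow> dist (\<phi>' t) (\<phi>' s) < e"
    unfolding uniformly_continuous_on_def using e by metis
  have main: "\<bar>(\<phi>' a + \<phi>' b) / 2 * (a - b) - (\<phi> a - \<phi> b)\<bar> \<le> e * \<bar>a - b\<bar>"
    if ab: "a \<in> {-B..B}" "b \<in> {-B..B}" "\<bar>a - b\<bar> < \<delta>" "b < a" for a b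
  proof -
    obtain z where z: "b < z" "z < a" "\<phi> a - \<phi> b = (a - b) * \<phi>' z"
      using MVT2[OF ab(4), of \<phi> \<phi>'] d by blast
    have zi: "z \<in> {-B..B}" using z ab by auto
    have "\<bar>\<phi>' a - \<phi>' z\<bar> < e" "\<bar>\<phi>' b - \<phi>' z\<bar> < e"
      using \<delta>(2)[OF zi ab(1)] \<delta>(2)[OF zi ab(2)] z ab(3,4) by (auto simp: dist_real_def)
    then have "\<bar>(\<phi>' a + \<phi>' b) / 2 - \<phi>' z\<bar> \<le> e" by (simp add: abs_less_iff abs_le_iff field_simps)
    then have "\<bar>(\<phi>' a + \<phi>' b) / 2 - \<phi>' z\<bar> * \<bar>a - b\<bar> \<le> e * \<bar>a - b\<bar>" by (rule mult_right_mono) simp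
    moreover have "(\<phi>' a + \<phi>' b) / 2 * (a - b) - (\<phi> a - \<phi> b) = ((\<phi>' a + \<phi>' b) / 2 - \<phi>' z) * (a - b)"
      unfolding z(3) by (simp add: algebra_simps)
    ultimately show ?thesis by (simp add: abs_mult)
  qed
  have "\<bar>(\<phi>' a + \<phi>' b) / 2 * (a - b) - (\<phi> a - \<phi> b)\<bar> \<le> e * \<bar>a - b\<bar>"
    if ab: "a \<in> {-B..B}" "b \<in> {-B..B}" "\<bar>a - b\<bar> < \<delta>" for a b
  proof (cases a b rule: linorder_cases)
    case less
    have "\<bar>(\<phi>' b + \<phi>' a) / 2 * (b - a) - (\<phi> b - \<phi> a)\<bar> \<le> e * \<bar>b - a\<bar>"
      by (rule main) (use ab less in \<open>auto simp: abs_minus_commute\<close>)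
    moreover have "(\<phi>' b + \<phi>' a) / 2 * (b - a) - (\<phi> b - \<phi> a) = - ((\<phi>' a + \<phi>' b) / 2 * (a - b) - (\<phi> a - \<phi> b))"
      by (simp add: field_simps)
    ultimately show ?thesis by (simp only: abs_minus_cancel abs_minus_commute[of b a])
  qed (use main ab in auto)
  then show ?thesis using \<delta>(1) by blast
qed

text \<open>On edges of high level the increments of \<open>u\<close> are small, so the difference
  of the two forms is at most \<open>r\<close> times the increment of \<open>u\<close>, and its
  squared norm at most r^2 times the energy of \<open>u\<close>.\<close>

lemma chain_rule:
  assumes u: "u \<in> \<C> q" and d: "\<And>s::real. (\<phi> has_real_derivative \<phi>' s) (at s)" and c: "continuous_on UNIV \<phi>'"
  shows "\<H>_eq q (mult_deriv (\<lambda>x. \<phi>' (u x)) u) (deriv1 (\<lambda>x. \<phi> (u x)))"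
proof -
  note F = chain_\<C>[OF u d c]
  have cont: "continuous_on K (\<lambda>x. \<phi>' (u x))"
    using continuous_on_compose2[OF c \<C>_cont[OF u]] by auto
  let ?a = "\<lambda>p. avg (\<lambda>x. \<phi>' (u x)) p * d_u u p - d_u (\<lambda>x. \<phi> (u x)) p"
  have a: "?a \<in> simple_forms q" by (intro simple_form_diff simple_form_basic simple_form_d F cont u)
  obtain B where B: "B > 0" "\<And>x. x \<in> K \<Longrightarrow> u x \<in> {-B..B}" using compact_range[OF u] by blast
  have E0: "0 \<le> energy1 q u" using energy1_nonneg[OF u] .
  have "simple_inner q ?a ?a \<le> e" if "e > 0" for e
  proof -
    define r where "r = sqrt (e / (energy1 q u + 1))"
    have r: "r > 0" "r\<^sup>2 * (energy1 q u + 1) = e" unfolding r_def using E0 that by simp_all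
    obtain \<delta> where \<delta>: "\<delta> > 0" "\<And>a b. a \<in> {-B..B} \<Longrightarrow> b \<in> {-B..B} \<Longrightarrow> \<bar>a - b\<bar> < \<delta> \<Longrightarrow>
        \<bar>(\<phi>' a + \<phi>' b) / 2 * (a - b) - (\<phi> a - \<phi> b)\<bar> \<le> r * \<bar>a - b\<bar>"
      using trapezoid_bound[OF d c r(1), of B] by blast
    obtain N where N: "\<And>n x y. n \<ge> N \<Longrightarrow> x \<in> K \<Longrightarrow> y \<in> K \<Longrightarrow> dist x y \<le> diamK / 2 ^ n \<Longrightarrow> \<bar>u x - u y\<bar> \<le> \<delta> / 2"
      using osc_small[OF \<C>_cont[OF u], of "\<delta>/2"] \<delta>(1) by (metis half_gt_zero)
    have "QQ n ?a ?a \<le> e" if n: "n \<ge> N" for n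
    proof -
      have "QQ n ?a ?a \<le> Q n (\<lambda>x y. r\<^sup>2 * ((u x - u y) * (u x - u y)))"
        unfolding QQ_def
      proof (rule Q_mono)
        fix x y assume xy: "x \<in> K" "y \<in> K" "dist x y \<le> diamK / 2 ^ n"
        have "\<bar>u x - u y\<bar> < \<delta>" using N[OF n xy] \<delta>(1) by linarith
        then have "\<bar>?a (x, y)\<bar> \<le> r * \<bar>u x - u y\<bar>"
          using \<delta>(2)[OF B(2)[OF xy(1)] B(2)[OF xy(2)]] by (simp add: avg_def d_u_def)
        then have "\<bar>?a (x, y)\<bar> * \<bar>?a (x, y)\<bar> \<le> (r * \<bar>u x - u y\<bar>) * (r * \<bar>u x - u y\<bar>)"
          using r(1) by (intro mult_mono) auto
        moreover have "\<bar>?a (x, y)\<bar> * \<bar>?a (x, y)\<bar> = ?a (x, y) * ?a (x, y)" by (rule abs_mult_self_eq)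
        moreover have "(r * \<bar>u x - u y\<bar>) * (r * \<bar>u x - u y\<bar>) = r\<^sup>2 * (\<bar>u x - u y\<bar> * \<bar>u x - u y\<bar>)"
          by (simp only: power2_eq_square mult_ac)
        ultimately show "?a (x, y) * ?a (x, y) \<le> r\<^sup>2 * ((u x - u y) * (u x - u y))"
          by (simp only: abs_mult_self_eq)
      qed
      also have "\<dots> = r\<^sup>2 * En n u u" unfolding Q_cmult En_def ..
      also have "\<dots> \<le> r\<^sup>2 * (energy1 q u + 1)" using En_le_energy1[OF u, of n] by (intro mult_left_mono) auto
      finally show ?thesis using r(2) by simp
    qed
    then show ?thesis by (intro LIMSEQ_le_const2[OF simple_inner_lim[OF a a]]) blast
  qed
  then have "simple_inner q ?a ?a \<le> 0" by (rule field_le_epsilon[where y = 0, simplified])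
  then have "simple_norm q ?a = 0" unfolding simple_norm_def using simple_inner_nonneg[OF a] by simp
  then show ?thesis unfolding \<H>_eq_def mult_deriv_def deriv1_def
    by (subst \<H>_dist_const) (auto intro: simple_form_basic simple_form_d F cont u)
qed

end

section \<open>Operators associated with a harmonic function\<close>

locale harmonic_triangle = triangle +
  fixes h :: "pt \<Rightarrow> real"
  assumes harmonic: "harmonic q h"
begin

abbreviation "\<nu> \<equiv> nu q h"

lemma h_\<C>: "h \<in> \<C> q"
  using harmonic unfolding harmonic_def by simp

lemma K_nu: "K_measure \<nu>"
  by (rule K_measure_nu[OF h_\<C>])

lemma finite_nu: "finite_measure \<nu>"
  using K_nu unfolding K_measure_def by simp

lemma space_nu: "space \<nu> = K"
  by (rule K_measure_space[OF K_nu])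

lemma cont_L2: "continuous_on K g \<Longrightarrow> g \<in> L2 \<nu>"
  by (rule K_L2_cont[OF K_nu])

lemma \<C>_L2: "g \<in> \<C> q \<Longrightarrow> g \<in> L2 \<nu>"
  by (rule cont_L2[OF \<C>_cont])

lemma mult_deriv_h_\<H>: "continuous_on K g \<Longrightarrow> mult_deriv g h \<in> \<H> q"
  by (rule mult_deriv_\<H>[OF _ h_\<C>])

lemma mult_deriv_0_inner:
  assumes "u \<in> \<H> q" shows "\<H>_inner q (mult_deriv (\<lambda>_. 0) h) u = 0"
proof -
  have z: "mult_deriv (\<lambda>_. 0) h \<in> \<H> q" by (rule mult_deriv_h_\<H>) simp
  show ?thesis using \<H>_inner_lin[OF z z assms, of 1] by (simp add: mult_deriv_def avg_def case_prod_unfold)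
qed

section \<open>The isometry \<open>star\<close> on L2\<close>

definition star_spec :: "(pt \<Rightarrow> real) \<Rightarrow> form_seq \<Rightarrow> bool" where
  "star_spec g v \<longleftrightarrow> v \<in> \<H> q \<and> (\<exists>gs. (\<forall>n. continuous_on K (gs n)) \<and>
     (\<lambda>n. L2_norm \<nu> (\<lambda>x. gs n x - g x)) \<longlonglongrightarrow> 0 \<and>
     (\<lambda>n. \<H>_dist q (mult_deriv (gs n) h) v) \<longlonglongrightarrow> 0)"

lemma L2_approx_seq:
  assumes "g \<in> L2 \<nu>"
  obtains gs where "\<And>n. continuous_on K (gs n)" "(\<lambda>n. L2_norm \<nu> (\<lambda>x. gs n x - g x)) \<longlonglongrightarrow> 0"
proof -
  have "\<exists>c. continuous_on K c \<and> L2_norm \<nu> (\<lambda>x. c x - g x) < inverse (real (Suc n))" for n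
    by (rule L2_approx[OF K_nu assms]) simp
  then obtain gs where gs: "\<And>n. continuous_on K (gs n)" "\<And>n. L2_norm \<nu> (\<lambda>x. gs n x - g x) < inverse (real (Suc n))"
    by metis
  have "(\<lambda>n. L2_norm \<nu> (\<lambda>x. gs n x - g x)) \<longlonglongrightarrow> 0"
    by (rule tendsto_sandwich[OF _ _ tendsto_const LIMSEQ_inverse_real_of_nat])
       (rule always_eventually, rule allI, simp, rule always_eventually, rule allI, rule less_imp_le, rule gs(2))
  then show ?thesis using gs(1) that by blast
qed

text \<open>The approximating forms, read as one sequence, are themselves the required element of
  the completion: their mutual distances are L2 distances of the coefficients, so the sequence is
  Cauchy.\<close>

lemma star_spec_exists:
  assumes g: "g \<in> L2 \<nu>" shows "\<exists>v. star_spec g v"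
proof -
  obtain gs where gs: "\<And>n. continuous_on K (gs n)" "(\<lambda>n. L2_norm \<nu> (\<lambda>x. gs n x - g x)) \<longlonglongrightarrow> 0"
    using L2_approx_seq[OF g] by blast
  define a where "a n = (\<lambda>p. avg (gs n) p * d_u h p)" for n
  have as: "a n \<in> simple_forms q" for n unfolding a_def by (rule simple_form_basic[OF gs(1) h_\<C>])
  have nrm: "simple_norm q (\<lambda>p. a m p - a n p) = L2_norm \<nu> (\<lambda>x. gs m x - gs n x)" for m n
    using \<H>_dist_mult_deriv[OF gs(1) gs(1) h_\<C>, of m n] unfolding mult_deriv_def
    by (subst (asm) \<H>_dist_const) (simp_all add: a_def as[unfolded a_def])
  have tri: "simple_norm q (\<lambda>p. a m p - a n p) \<le> L2_norm \<nu> (\<lambda>x. gs m x - g x) + L2_norm \<nu> (\<lambda>x. gs n x - g x)" for m n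
    unfolding nrm using L2_norm_triangle3[OF cont_L2[OF gs(1)] g cont_L2[OF gs(1)], of m n]
    by (simp add: L2_norm_minus_commute[of \<nu> g])
  have small: "\<exists>N. \<forall>m\<ge>N. \<forall>n\<ge>N. simple_norm q (\<lambda>p. a m p - a n p) < e" if "e > 0" for e
  proof -
    obtain N where "\<And>n. n \<ge> N \<Longrightarrow> L2_norm \<nu> (\<lambda>x. gs n x - g x) < e / 2"
      using LIMSEQ_D[OF gs(2), of "e/2"] \<open>e > 0\<close> by auto
    then show ?thesis using tri by (intro exI[of _ N]) (smt (verit) field_sum_of_halves)
  qed
  have aH: "a \<in> \<H> q" unfolding \<H>_def using as small by blast
  have cH: "(\<lambda>_. a n) \<in> \<H> q" for n by (rule \<H>_const[OF as])
  have "(\<lambda>n. \<H>_dist q (mult_deriv (gs n) h) a) \<longlonglongrightarrow> 0"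
  proof (rule LIMSEQ_I)
    fix e :: real assume "e > 0"
    then obtain N where N: "\<And>m n. m \<ge> N \<Longrightarrow> n \<ge> N \<Longrightarrow> simple_norm q (\<lambda>p. a m p - a n p) < e / 2"
      using small[of "e/2"] by auto
    have le: "\<H>_dist q (mult_deriv (gs n) h) a \<le> e / 2" if "n \<ge> N" for n
      unfolding mult_deriv_def a_def[symmetric]
      by (rule LIMSEQ_le_const2[OF \<H>_dist_lim[OF cH aH]]) (use N that in \<open>auto intro!: exI[of _ N] less_imp_le\<close>)
    have ge: "0 \<le> \<H>_dist q (mult_deriv (gs n) h) a" for n
      by (rule \<H>_dist_nonneg[OF mult_deriv_h_\<H>[OF gs(1)] aH])
    have "norm (\<H>_dist q (mult_deriv (gs n) h) a - 0) < e" if "n \<ge> N" for n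
      using le[OF that] ge[of n] \<open>e > 0\<close> by simp
    then show "\<exists>no. \<forall>n\<ge>no. norm (\<H>_dist q (mult_deriv (gs n) h) a - 0) < e" by blast
  qed
  then show ?thesis unfolding star_spec_def using aH gs by blast
qed

lemma star_spec: "g \<in> L2 \<nu> \<Longrightarrow> star_spec g (star q h g)"
  unfolding star_def star_spec_def by (rule someI_ex[OF star_spec_exists[unfolded star_spec_def]])

lemma star_\<H>: "g \<in> L2 \<nu> \<Longrightarrow> star q h g \<in> \<H> q"
  using star_spec unfolding star_spec_def by blast

text \<open>The specification of \<open>star\<close> provides only some approximating sequence; by
  the isometry every other one has the same limit.\<close>

lemma star_dist_lim:
  assumes g: "g \<in> L2 \<nu>" and fs: "\<And>n. continuous_on K (fs n)" "(\<lambda>n. L2_norm \<nu> (\<lambda>x. fs n x - g x)) \<longlonglongrightarrow> 0"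
  shows "(\<lambda>n. \<H>_dist q (mult_deriv (fs n) h) (star q h g)) \<longlonglongrightarrow> 0"
proof -
  obtain gs where gs: "\<And>n. continuous_on K (gs n)" "(\<lambda>n. L2_norm \<nu> (\<lambda>x. gs n x - g x)) \<longlonglongrightarrow> 0"
    "(\<lambda>n. \<H>_dist q (mult_deriv (gs n) h) (star q h g)) \<longlonglongrightarrow> 0"
    using star_spec[OF g] unfolding star_spec_def by blast
  have le: "\<H>_dist q (mult_deriv (fs n) h) (star q h g) \<le>
      (L2_norm \<nu> (\<lambda>x. fs n x - g x) + L2_norm \<nu> (\<lambda>x. gs n x - g x)) + \<H>_dist q (mult_deriv (gs n) h) (star q h g)" for n
  proof -
    have "\<H>_dist q (mult_deriv (fs n) h) (mult_deriv (gs n) h) \<le> L2_norm \<nu> (\<lambda>x. fs n x - g x) + L2_norm \<nu> (\<lambda>x. gs n x - g x)"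
      unfolding \<H>_dist_mult_deriv[OF fs(1) gs(1) h_\<C>]
      using L2_norm_triangle3[OF cont_L2[OF fs(1)] g cont_L2[OF gs(1)], of n n] by (simp add: L2_norm_minus_commute[of \<nu> g])
    then show ?thesis using \<H>_dist_triangle[OF mult_deriv_h_\<H>[OF fs(1)] mult_deriv_h_\<H>[OF gs(1)] star_\<H>[OF g], of n n] by linarith
  qed
  have "(\<lambda>n. (L2_norm \<nu> (\<lambda>x. fs n x - g x) + L2_norm \<nu> (\<lambda>x. gs n x - g x)) + \<H>_dist q (mult_deriv (gs n) h) (star q h g)) \<longlonglongrightarrow> 0 + 0 + 0"
    by (intro tendsto_add fs(2) gs(2,3))
  then have lim: "(\<lambda>n. (L2_norm \<nu> (\<lambda>x. fs n x - g x) + L2_norm \<nu> (\<lambda>x. gs n x - g x)) + \<H>_dist q (mult_deriv (gs n) h) (star q h g)) \<longlonglongrightarrow> 0" by simp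
  show ?thesis
    by (rule tendsto_sandwich[OF _ _ tendsto_const lim])
       (auto intro!: always_eventually le \<H>_dist_nonneg mult_deriv_h_\<H> fs(1) star_\<H> g)
qed

lemma star_inner_lim:
  assumes g: "g \<in> L2 \<nu>" and fs: "\<And>n. continuous_on K (fs n)" "(\<lambda>n. L2_norm \<nu> (\<lambda>x. fs n x - g x)) \<longlonglongrightarrow> 0"
    and u: "u \<in> \<H> q"
  shows "(\<lambda>n. \<H>_inner q (mult_deriv (fs n) h) u) \<longlonglongrightarrow> \<H>_inner q (star q h g) u"
proof -
  have "(\<lambda>n. \<H>_dist q (mult_deriv (fs n) h) (star q h g) * sqrt (\<H>_inner q u u)) \<longlonglongrightarrow> 0 * sqrt (\<H>_inner q u u)"
    by (intro tendsto_mult star_dist_lim[OF g fs] tendsto_const)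
  then have lim: "(\<lambda>n. \<H>_dist q (mult_deriv (fs n) h) (star q h g) * sqrt (\<H>_inner q u u)) \<longlonglongrightarrow> 0" by simp
  have "(\<lambda>n. \<H>_inner q (mult_deriv (fs n) h) u - \<H>_inner q (star q h g) u) \<longlonglongrightarrow> 0"
    by (rule Lim_null_comparison[OF _ lim])
       (auto intro!: always_eventually \<H>_inner_diff_le mult_deriv_h_\<H> fs(1) star_\<H> g u)
  then show ?thesis by (simp add: LIM_zero_iff)
qed

lemma star_cont_eq:
  assumes "continuous_on K g" shows "\<H>_eq q (mult_deriv g h) (star q h g)"
  using star_dist_lim[OF cont_L2[OF assms], of "\<lambda>_. g"] assms
  unfolding \<H>_eq_def by (simp add: L2_norm_def LIMSEQ_const_iff)

lemma star_inner_cont: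
  assumes "continuous_on K g" "u \<in> \<H> q" shows "\<H>_inner q (star q h g) u = \<H>_inner q (mult_deriv g h) u"
  using \<H>_inner_cong[OF mult_deriv_h_\<H> star_\<H> assms(2) star_cont_eq] assms(1) cont_L2 by simp

text \<open>\<open>star\<close> chooses a representative for each function separately, so it need
  not be linear as a map to sequences. Its scalar products are.\<close>

lemma star_inner_lin:
  assumes f: "f \<in> L2 \<nu>" and g: "g \<in> L2 \<nu>" and u: "u \<in> \<H> q"
  shows "\<H>_inner q (star q h (\<lambda>x. a * f x + b * g x)) u = a * \<H>_inner q (star q h f) u + b * \<H>_inner q (star q h g) u"
proof -
  obtain fs where fs: "\<And>n. continuous_on K (fs n)" "(\<lambda>n. L2_norm \<nu> (\<lambda>x. fs n x - f x)) \<longlonglongrightarrow> 0"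
    using L2_approx_seq[OF f] by blast
  obtain gs where gs: "\<And>n. continuous_on K (gs n)" "(\<lambda>n. L2_norm \<nu> (\<lambda>x. gs n x - g x)) \<longlonglongrightarrow> 0"
    using L2_approx_seq[OF g] by blast
  have ks: "continuous_on K (\<lambda>x. a * fs n x + b * gs n x)" for n by (intro continuous_intros fs gs)
  have le: "L2_norm \<nu> (\<lambda>x. (a * fs n x + b * gs n x) - (a * f x + b * g x))
      \<le> \<bar>a\<bar> * L2_norm \<nu> (\<lambda>x. fs n x - f x) + \<bar>b\<bar> * L2_norm \<nu> (\<lambda>x. gs n x - g x)" for n
    using L2_norm_triangle[OF L2_cmult[OF L2_diff[OF cont_L2[OF fs(1)] f], of a n] L2_cmult[OF L2_diff[OF cont_L2[OF gs(1)] g], of b n]]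
    unfolding L2_norm_cmult by (simp add: algebra_simps)
  have "(\<lambda>n. \<bar>a\<bar> * L2_norm \<nu> (\<lambda>x. fs n x - f x) + \<bar>b\<bar> * L2_norm \<nu> (\<lambda>x. gs n x - g x)) \<longlonglongrightarrow> \<bar>a\<bar> * 0 + \<bar>b\<bar> * 0"
    by (intro tendsto_intros fs(2) gs(2))
  then have l0: "(\<lambda>n. \<bar>a\<bar> * L2_norm \<nu> (\<lambda>x. fs n x - f x) + \<bar>b\<bar> * L2_norm \<nu> (\<lambda>x. gs n x - g x)) \<longlonglongrightarrow> 0" by simp
  have kl: "(\<lambda>n. L2_norm \<nu> (\<lambda>x. (a * fs n x + b * gs n x) - (a * f x + b * g x))) \<longlonglongrightarrow> 0"
    by (rule tendsto_sandwich[OF _ _ tendsto_const l0]) (auto intro!: always_eventually le)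
  have eq: "\<H>_inner q (mult_deriv (\<lambda>x. a * fs n x + b * gs n x) h) u
      = a * \<H>_inner q (mult_deriv (fs n) h) u + b * \<H>_inner q (mult_deriv (gs n) h) u" for n
  proof -
    have z: "mult_deriv (\<lambda>_. 0) h \<in> \<H> q" by (rule mult_deriv_h_\<H>) simp
    have 1: "\<H>_inner q (mult_deriv (\<lambda>_. 0) h) u = 0" by (rule mult_deriv_0_inner[OF u])
    have 2: "(\<lambda>m p. mult_deriv (\<lambda>_. 0) h m p + a * mult_deriv (fs n) h m p) \<in> \<H> q"
      by (rule \<H>_lin[OF z mult_deriv_h_\<H>[OF fs(1)]])
    have "mult_deriv (\<lambda>x. a * fs n x + b * gs n x) h =
        (\<lambda>m p. (mult_deriv (\<lambda>_. 0) h m p + a * mult_deriv (fs n) h m p) + b * mult_deriv (gs n) h m p)"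
      by (auto simp: mult_deriv_def avg_def fun_eq_iff field_simps)
    then show ?thesis
      using \<H>_inner_lin[OF 2 mult_deriv_h_\<H>[OF gs(1)] u, of b n] \<H>_inner_lin[OF z mult_deriv_h_\<H>[OF fs(1)] u, of a n] 1 by simp
  qed
  have "(\<lambda>n. a * \<H>_inner q (mult_deriv (fs n) h) u + b * \<H>_inner q (mult_deriv (gs n) h) u) \<longlonglongrightarrow>
     a * \<H>_inner q (star q h f) u + b * \<H>_inner q (star q h g) u"
    by (intro tendsto_intros star_inner_lim f g fs gs u)
  then show ?thesis
    using star_inner_lim[OF L2_lin[OF f g] ks kl u] LIMSEQ_unique unfolding eq by blast
qed

lemma star_inner_AE_0:
  assumes "g \<in> L2 \<nu>" "AE x in \<nu>. g x = 0" "u \<in> \<H> q" shows "\<H>_inner q (star q h g) u = 0"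
proof -
  have "L2_norm \<nu> (\<lambda>x. 0 - g x) = L2_norm \<nu> (\<lambda>x. 0)"
    by (rule L2_norm_cong_AE) (use assms L2_meas[OF assms(1)] in auto)
  then have "L2_norm \<nu> (\<lambda>x. 0 - g x) = 0" by (simp add: L2_norm_def)
  then have "(\<lambda>n. L2_norm \<nu> (\<lambda>x. 0 - g x)) \<longlonglongrightarrow> 0" by simp
  from star_inner_lim[OF assms(1) _ this assms(3)]
  have "\<H>_inner q (star q h g) u = \<H>_inner q (mult_deriv (\<lambda>x. 0) h) u" by (simp add: LIMSEQ_const_iff)
  also have "\<dots> = 0" by (rule mult_deriv_0_inner[OF assms(3)])
  finally show ?thesis .
qed

text \<open>Testing against multiples of \<partial>h recovers the coefficient; injectivity of
  \<open>star\<close> rests on this.\<close>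

lemma star_inner_mult:
  assumes g: "g \<in> L2 \<nu>" and k: "continuous_on K k"
  shows "\<H>_inner q (star q h g) (mult_deriv k h) = (\<integral>x. g x * k x \<partial>\<nu>)"
proof -
  obtain gs where gs: "\<And>n. continuous_on K (gs n)" "(\<lambda>n. L2_norm \<nu> (\<lambda>x. gs n x - g x)) \<longlonglongrightarrow> 0"
    using L2_approx_seq[OF g] by blast
  have eq: "\<H>_inner q (mult_deriv (gs n) h) (mult_deriv k h) = (\<integral>x. gs n x * k x \<partial>\<nu>)" for n
    unfolding \<H>_inner_mult_deriv2[OF gs(1) h_\<C> k h_\<C>]
    by (rule nu_integral_self[OF h_\<C>]) (intro continuous_intros gs k)
  have le: "\<bar>(\<integral>x. gs n x * k x \<partial>\<nu>) - (\<integral>x. g x * k x \<partial>\<nu>)\<bar> \<le> L2_norm \<nu> (\<lambda>x. gs n x - g x) * L2_norm \<nu> k" for n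
  proof -
    note L = cont_L2[OF gs(1), of n] cont_L2[OF k]
    have "(\<integral>x. gs n x * k x \<partial>\<nu>) - (\<integral>x. g x * k x \<partial>\<nu>) = (\<integral>x. (gs n x - g x) * k x \<partial>\<nu>)"
      using L2_prod[OF L] L2_prod[OF g L(2)] by (simp add: left_diff_distrib)
    also have "\<bar>\<dots>\<bar> \<le> sqrt ((\<integral>x. (gs n x - g x)\<^sup>2 \<partial>\<nu>) * (\<integral>x. (k x)\<^sup>2 \<partial>\<nu>))"
      using L2_Cauchy_Schwarz[OF L2_diff[OF L(1) g] L(2)] by (intro real_le_rsqrt) simp
    finally show ?thesis unfolding L2_norm_def real_sqrt_mult .
  qed
  have "(\<lambda>n. L2_norm \<nu> (\<lambda>x. gs n x - g x) * L2_norm \<nu> k) \<longlonglongrightarrow> 0 * L2_norm \<nu> k"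
    by (intro tendsto_mult gs(2) tendsto_const)
  then have lim: "(\<lambda>n. L2_norm \<nu> (\<lambda>x. gs n x - g x) * L2_norm \<nu> k) \<longlonglongrightarrow> 0" by simp
  have "(\<lambda>n. (\<integral>x. gs n x * k x \<partial>\<nu>) - (\<integral>x. g x * k x \<partial>\<nu>)) \<longlonglongrightarrow> 0"
    by (rule Lim_null_comparison[OF _ lim]) (auto intro!: always_eventually le)
  then have "(\<lambda>n. \<integral>x. gs n x * k x \<partial>\<nu>) \<longlonglongrightarrow> (\<integral>x. g x * k x \<partial>\<nu>)" by (simp add: LIM_zero_iff)
  then show ?thesis using star_inner_lim[OF g gs mult_deriv_h_\<H>[OF k]] LIMSEQ_unique unfolding eq by blast
qed

section \<open>Density of test functions and null sets of the energy measure\<close>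

lemma orth_\<C>_AE_0:
  assumes k: "k \<in> L2 \<nu>" and orth: "\<And>\<phi>. \<phi> \<in> \<C> q \<Longrightarrow> (\<integral>x. k x * \<phi> x \<partial>\<nu>) = 0"
  shows "AE x in \<nu>. k x = 0"
proof -
  interpret finite_measure \<nu> by (rule finite_nu)
  \<comment> \<open>Adding 1 keeps this divisor positive even for total mass zero.\<close>
  let ?m = "sqrt (measure \<nu> (space \<nu>)) + 1"
  have m: "?m > 0" by (simp add: add_nonneg_pos)
  have le: "(L2_norm \<nu> k)\<^sup>2 \<le> L2_norm \<nu> k * e" if e0: "e > 0" for e
  proof -
    obtain c where c: "continuous_on K c" "L2_norm \<nu> (\<lambda>x. c x - k x) < e / 2"
      using L2_approx[OF K_nu k, of "e/2"] e0 by auto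
    obtain f where f: "f \<in> \<C> q" "\<And>x. x \<in> K \<Longrightarrow> \<bar>c x - f x\<bar> < e / 2 / ?m"
      using Stone_Weierstrass_basic[OF c(1), of "e / 2 / ?m"] e0 m by auto
    have fc: "L2_norm \<nu> (\<lambda>x. f x - c x) \<le> e / 2 / ?m * sqrt (measure \<nu> (space \<nu>))"
      by (rule bounded_L2(2))
         (use f(2) c(1) L2_meas[OF \<C>_L2[OF f(1)]] L2_meas[OF cont_L2[OF c(1)]] space_nu in
            \<open>auto simp: abs_minus_commute intro: less_imp_le\<close>)
    also have "\<dots> \<le> e / 2 / ?m * ?m" using e0 m by (intro mult_left_mono) auto
    also have "\<dots> = e / 2"
    proof -
      have "e / 2 / r * r = e / 2" if "r > 0" for r :: real using that by simp
      then show ?thesis using m by blast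
    qed
    finally have "L2_norm \<nu> (\<lambda>x. f x - k x) \<le> e"
      using L2_norm_triangle3[OF \<C>_L2[OF f(1)] cont_L2[OF c(1)] k] c(2) by linarith
    then have fk: "L2_norm \<nu> (\<lambda>x. k x - f x) \<le> e" by (subst L2_norm_minus_commute)
    \<comment> \<open>By orthogonality \<open>f\<close> may be subtracted from one factor, so the
      square of the norm is bounded by the norm times the distance from \<open>k\<close> to
      \<open>f\<close>.\<close>
    have "(L2_norm \<nu> k)\<^sup>2 = (\<integral>x. (k x)\<^sup>2 \<partial>\<nu>)" unfolding L2_norm_def by simp
    also have "\<dots> = (\<integral>x. k x * (k x - f x) \<partial>\<nu>)"
    proof -
      have "(\<integral>x. k x * (k x - f x) \<partial>\<nu>) = (\<integral>x. (k x)\<^sup>2 - k x * f x \<partial>\<nu>)"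
        by (simp add: power2_eq_square algebra_simps)
      also have "\<dots> = (\<integral>x. (k x)\<^sup>2 \<partial>\<nu>) - (\<integral>x. k x * f x \<partial>\<nu>)"
        by (rule Bochner_Integration.integral_diff[OF L2_int[OF k] L2_prod[OF k \<C>_L2[OF f(1)]]])
      finally show ?thesis using orth[OF f(1)] by simp
    qed
    also have "\<dots> \<le> sqrt ((\<integral>x. (k x)\<^sup>2 \<partial>\<nu>) * (\<integral>x. (k x - f x)\<^sup>2 \<partial>\<nu>))"
      by (rule real_le_rsqrt[OF L2_Cauchy_Schwarz[OF k L2_diff[OF k \<C>_L2[OF f(1)]]]])
    also have "\<dots> = L2_norm \<nu> k * L2_norm \<nu> (\<lambda>x. k x - f x)" unfolding L2_norm_def real_sqrt_mult ..
    also have "\<dots> \<le> L2_norm \<nu> k * e" using fk by (intro mult_left_mono) auto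
    finally show ?thesis .
  qed
  have "L2_norm \<nu> k = 0"
  proof (rule ccontr)
    assume "L2_norm \<nu> k \<noteq> 0"
    then have p: "L2_norm \<nu> k > 0" using L2_norm_nonneg[of \<nu> k] by linarith
    then show False using le[of "L2_norm \<nu> k / 2"] by (simp add: power2_eq_square)
  qed
  then show ?thesis by (rule L2_norm_0_imp[OF k])
qed

text \<open>The chain rule turns the integral into an energy with \<open>h\<close>, and harmonicity
  into boundary values. Hence the integral of \<phi>'(h) is small whenever \<phi> is small at the
  boundary values of \<open>h\<close>, however \<phi>' behaves.\<close>

lemma energy_comp_h:
  assumes d: "\<And>s::real. (\<phi> has_real_derivative \<phi>' s) (at s)" and c: "continuous_on UNIV \<phi>'"
  shows "(\<integral>x. \<phi>' (h x) \<partial>\<nu>) = En 0 h (\<lambda>x. \<phi> (h x))"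
proof -
  have F: "(\<lambda>x. \<phi> (h x)) \<in> \<C> q" by (rule chain_\<C>[OF h_\<C> d c])
  have cont: "continuous_on K (\<lambda>x. \<phi>' (h x))"
    using continuous_on_compose2[OF c \<C>_cont[OF h_\<C>]] by auto
  have "(\<integral>x. \<phi>' (h x) \<partial>\<nu>) = \<H>_inner q (mult_deriv (\<lambda>x. \<phi>' (h x)) h) (deriv1 h)"
    using \<H>_inner_mult_deriv[OF cont h_\<C> h_\<C>] nu_integral_self[OF h_\<C> cont] by simp
  also have "\<dots> = \<H>_inner q (deriv1 (\<lambda>x. \<phi> (h x))) (deriv1 h)"
    by (rule \<H>_inner_cong[OF mult_deriv_h_\<H>[OF cont] deriv1_\<H>[OF F] deriv1_\<H>[OF h_\<C>] chain_rule[OF h_\<C> d c]])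
  also have "\<dots> = energy q (\<lambda>x. \<phi> (h x)) h" by (rule \<H>_inner_deriv1[OF F h_\<C>])
  also have "\<dots> = energy q h (\<lambda>x. \<phi> (h x))"
    using energy_lim[OF F h_\<C>] energy_lim[OF h_\<C> F] En_commute[of _ h "\<lambda>x. \<phi> (h x)"] LIMSEQ_unique by simp
  also have "\<dots> = En 0 h (\<lambda>x. \<phi> (h x))" by (rule energy_harmonic[OF harmonic F])
  finally show ?thesis .
qed

text \<open>
  The functions $\arctan(k(s-c))/k$ tend to $0$ uniformly, while their derivatives are bounded and
  tend to the indicator function of $c$.
\<close>

lemma level_set_null: "AE x in \<nu>. h x \<noteq> c"
proof -
  interpret finite_measure \<nu> by (rule finite_nu)
  let ?d = "\<lambda>k s. 1 / (1 + (real k * (s - c))\<^sup>2)"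
  let ?F = "\<lambda>k s. arctan (real k * (s - c)) / real k"
  note [measurable] = L2_meas[OF \<C>_L2[OF h_\<C>]]
  have pos: "1 + (real k * (s - c))\<^sup>2 > 0" for k s by (simp add: add_pos_nonneg)
  have A: "{x \<in> space \<nu>. h x = c} \<in> sets \<nu>" by measurable
  have int: "(\<integral>x. ?d k (h x) \<partial>\<nu>) = En 0 h (\<lambda>x. ?F k (h x))" if "k > 0" for k
  proof (rule energy_comp_h)
    show "(?F k has_real_derivative ?d k s) (at s)" for s
    proof -
      have "((\<lambda>s. arctan (real k * (s - c))) has_real_derivative inverse (1 + (real k * (s - c))\<^sup>2) * real k) (at s)"
        by (rule DERIV_chain2[OF DERIV_arctan]) (auto intro!: derivative_eq_intros)
      from DERIV_cdivide[OF this, of "real k"] show ?thesis using that by (simp add: inverse_eq_divide)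
    qed
    show "continuous_on UNIV (?d k)" using pos by (intro continuous_intros) (metis less_irrefl)
  qed
  have "(\<lambda>k. \<integral>x. ?d k (h x) \<partial>\<nu>) \<longlonglongrightarrow> (\<integral>x. indicator {x \<in> space \<nu>. h x = c} x \<partial>\<nu>)"
  proof (rule integral_dominated_convergence[where w = "\<lambda>_. 1"])
    show "AE x in \<nu>. (\<lambda>k. ?d k (h x)) \<longlonglongrightarrow> indicator {x \<in> space \<nu>. h x = c} x"
    proof (rule AE_I2)
      fix x assume x: "x \<in> space \<nu>"
      show "(\<lambda>k. ?d k (h x)) \<longlonglongrightarrow> indicator {x \<in> space \<nu>. h x = c} x"
      proof (cases "h x = c")
        case True then show ?thesis using x by simp
      next
        case False
        let ?a = "h x - c"
        have a: "?a\<^sup>2 > 0" using False by simp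
        have "(\<lambda>k. 1 / ?a\<^sup>2 * (1 / real k)) \<longlonglongrightarrow> 1 / ?a\<^sup>2 * 0"
          by (intro tendsto_mult tendsto_const lim_1_over_n)
        then have l: "(\<lambda>k. 1 / ?a\<^sup>2 * (1 / real k)) \<longlonglongrightarrow> 0" by simp
        have "(\<lambda>k. ?d k (h x)) \<longlonglongrightarrow> 0"
        proof (rule Lim_null_comparison[OF _ l])
          have "norm (?d k (h x)) \<le> 1 / ?a\<^sup>2 * (1 / real k)" if "k \<ge> 1" for k
          proof -
            have "?a\<^sup>2 * real k \<le> ?a\<^sup>2 * (real k * real k)"
              using that by (intro mult_left_mono) (auto simp: mult_le_cancel_left1)
            then have "?a\<^sup>2 * real k \<le> 1 + (real k * ?a)\<^sup>2" by (simp add: power_mult_distrib power2_eq_square mult_ac)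
            then have "1 / (1 + (real k * ?a)\<^sup>2) \<le> 1 / (?a\<^sup>2 * real k)"
              using a that by (intro divide_left_mono) (auto intro!: mult_pos_pos pos)
            then show ?thesis using pos[of k "h x"] by (simp add: less_imp_le)
          qed
          then show "\<forall>\<^sub>F k in sequentially. norm (?d k (h x)) \<le> 1 / ?a\<^sup>2 * (1 / real k)"
            by (auto simp: eventually_sequentially)
        qed
        then show ?thesis using False by simp
      qed
    qed
    show "AE x in \<nu>. norm (?d k (h x)) \<le> 1" for k
      using pos by (intro AE_I2) (simp add: less_imp_le)
  qed (use A in auto)
  then have "(\<lambda>k. \<integral>x. ?d k (h x) \<partial>\<nu>) \<longlonglongrightarrow> measure \<nu> {x \<in> space \<nu>. h x = c}"
    using A by (simp add: Int_absorb2 subset_eq)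
  moreover have "(\<lambda>k. \<integral>x. ?d k (h x) \<partial>\<nu>) \<longlonglongrightarrow> 0"
  proof -
    have F0: "(\<lambda>k. ?F k s) \<longlonglongrightarrow> 0" for s
    proof (rule Lim_null_comparison)
      have "\<bar>arctan y\<bar> \<le> 2" for y using arctan_lbound[of y] arctan_ubound[of y] pi_half_less_two by (auto simp: abs_le_iff)
      then show "\<forall>\<^sub>F k in sequentially. norm (?F k s) \<le> 2 / real k"
        by (intro always_eventually allI) (simp add: divide_right_mono abs_divide)
      show "(\<lambda>k. 2 / real k) \<longlonglongrightarrow> 0"
        using tendsto_mult[OF tendsto_const[of 2] lim_1_over_n] by simp
    qed
    have "(\<lambda>k. En 0 h (\<lambda>x. ?F k (h x))) \<longlonglongrightarrow>
      (h (q 0) - h (q 1)) * (0 - 0) + (h (q 0) - h (q 2)) * (0 - 0) + (h (q 1) - h (q 2)) * (0 - 0)"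
      unfolding En_0 by (intro tendsto_intros F0)
    then have "(\<lambda>k. En 0 h (\<lambda>x. ?F k (h x))) \<longlonglongrightarrow> 0" by simp
    then show ?thesis
      by (rule Lim_transform_eventually) (use int in \<open>auto simp: eventually_at_top_dense intro!: exI[of _ 0]\<close>)
  qed
  ultimately have "measure \<nu> {x \<in> space \<nu>. h x = c} = 0" using LIMSEQ_unique by blast
  then have "emeasure \<nu> {x \<in> space \<nu>. h x = c} = 0" by (simp add: emeasure_eq_measure)
  then show ?thesis using A by (intro AE_I[of _ _ "{x \<in> space \<nu>. h x = c}"]) auto
qed

text \<open>
  The product of the functions \<open>h - h (q i)\<close> belongs to \<open>\<C>\<^sub>B\<close>, and its zero set is a union of
  level sets of \<open>h\<close>, hence null.
\<close>

lemma orth_\<C>\<^sub>B_AE_0: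
  assumes k: "k \<in> L2 \<nu>" and orth: "\<And>\<phi>. \<phi> \<in> \<C>\<^sub>B q \<Longrightarrow> (\<integral>x. k x * \<phi> x \<partial>\<nu>) = 0"
  shows "AE x in \<nu>. k x = 0"
proof -
  define P where "P x = (h x - h (q 0)) * (h x - h (q 1)) * (h x - h (q 2))" for x
  have P: "P \<in> \<C> q" unfolding P_def by (intro \<C>_mult \<C>_diff h_\<C> \<C>_const)
  have Pq: "P (q i) = 0" for i using exhaust_3'[of i] by (auto simp: P_def)
  obtain B where B: "\<And>x. x \<in> K \<Longrightarrow> \<bar>P x\<bar> \<le> B" using cont_bounded[OF \<C>_cont[OF P]] by blast
  have kP: "(\<lambda>x. k x * P x) \<in> L2 \<nu>"
    unfolding L2_def mem_Collect_eq
  proof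
    show m: "(\<lambda>x. k x * P x) \<in> borel_measurable \<nu>"
      by (intro borel_measurable_times L2_meas k \<C>_L2 P)
    show "integrable \<nu> (\<lambda>x. (k x * P x)\<^sup>2)"
    proof (rule Bochner_Integration.integrable_bound)
      show "integrable \<nu> (\<lambda>x. B\<^sup>2 * (k x)\<^sup>2)" using L2_int[OF k] by simp
      show "(\<lambda>x. (k x * P x)\<^sup>2) \<in> borel_measurable \<nu>" using m by simp
      show "AE x in \<nu>. norm ((k x * P x)\<^sup>2) \<le> norm (B\<^sup>2 * (k x)\<^sup>2)"
      proof (rule AE_I2)
        fix x assume "x \<in> space \<nu>"
        then have "(P x)\<^sup>2 \<le> B\<^sup>2" using power_mono[OF B, of x 2] space_nu by simp
        then have "(k x)\<^sup>2 * (P x)\<^sup>2 \<le> (k x)\<^sup>2 * B\<^sup>2" by (rule mult_left_mono) simp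
        then show "norm ((k x * P x)\<^sup>2) \<le> norm (B\<^sup>2 * (k x)\<^sup>2)"
          by (simp add: power_mult_distrib mult.commute)
      qed
    qed
  qed
  have "AE x in \<nu>. k x * P x = 0"
  proof (rule orth_\<C>_AE_0[OF kP])
    fix \<phi> assume "\<phi> \<in> \<C> q"
    then have "(\<lambda>x. P x * \<phi> x) \<in> \<C>\<^sub>B q" unfolding \<C>\<^sub>B_def using P Pq by (auto intro: \<C>_mult)
    from orth[OF this] show "(\<integral>x. k x * P x * \<phi> x \<partial>\<nu>) = 0" by (simp add: mult.assoc)
  qed
  then show ?thesis
    using level_set_null[of "h (q 0)"] level_set_null[of "h (q 1)"] level_set_null[of "h (q 2)"]
    by eventually_elim (auto simp: P_def)
qed

section \<open>Integration by parts and the inverse of \<open>star\<close>\<close>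

lemma integration_by_parts:
  assumes d: "\<And>s::real. (\<phi> has_real_derivative \<phi>' s) (at s)" and c: "continuous_on UNIV \<phi>'" and u: "u \<in> \<C> q"
  shows "\<H>_inner q (star q h (\<lambda>x. \<phi> (h x))) (deriv1 u) = En 0 h (\<lambda>x. \<phi> (h x) * u x) - (\<integral>x. \<phi>' (h x) * u x \<partial>\<nu>)"
proof -
  let ?f = "\<lambda>x. \<phi> (h x)" and ?g = "\<lambda>x. \<phi>' (h x)"
  have f: "?f \<in> \<C> q" by (rule chain_\<C>[OF h_\<C> d c])
  have g: "continuous_on K ?g" using continuous_on_compose2[OF c \<C>_cont[OF h_\<C>]] by auto
  have fu: "(\<lambda>x. ?f x * u x) \<in> \<C> q" by (rule \<C>_mult[OF f u])
  \<comment> \<open>The product rule with endpoint averages is exact on an edge: avg(f) du = d(f u)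
    - avg(u) df. The first term leads to the boundary term, the second to the chain rule.\<close>
  have "Q n (wgt2 ?f h u) = En n h (\<lambda>x. ?f x * u x) - Q n (wgt2 u ?f h)" for n
    unfolding En_def Q_diff[symmetric] wgt2_def by (rule Q_cong) (simp add: field_simps)
  then have "(\<lambda>n. Q n (wgt2 ?f h u)) \<longlonglongrightarrow> energy q h (\<lambda>x. ?f x * u x) - nu_integral q ?f h u"
    using tendsto_diff[OF energy_lim[OF h_\<C> fu] nu_integral_lim[OF f h_\<C> \<C>_cont[OF u]]] by simp
  then have 1: "nu_integral q h u ?f = energy q h (\<lambda>x. ?f x * u x) - nu_integral q ?f h u"
    using nu_integral_lim[OF h_\<C> u \<C>_cont[OF f]] LIMSEQ_unique by blast
  have "nu_integral q ?f h u = \<H>_inner q (deriv1 ?f) (mult_deriv u h)"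
    unfolding deriv1_eq_mult_deriv using \<H>_inner_mult_deriv2[OF _ f \<C>_cont[OF u] h_\<C>, of "\<lambda>_. 1"] by simp
  also have "\<dots> = \<H>_inner q (mult_deriv ?g h) (mult_deriv u h)"
    using \<H>_inner_cong[OF mult_deriv_h_\<H>[OF g] deriv1_\<H>[OF f] mult_deriv_h_\<H>[OF \<C>_cont[OF u]] chain_rule[OF h_\<C> d c]] by simp
  also have "\<dots> = (\<integral>x. ?g x * u x \<partial>\<nu>)"
    unfolding \<H>_inner_mult_deriv2[OF g h_\<C> \<C>_cont[OF u] h_\<C>]
    by (rule nu_integral_self[OF h_\<C>]) (intro continuous_intros g \<C>_cont u)
  finally have 2: "nu_integral q ?f h u = (\<integral>x. ?g x * u x \<partial>\<nu>)" .
  have "\<H>_inner q (star q h ?f) (deriv1 u) = nu_integral q h u ?f"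
    using star_inner_cont[OF \<C>_cont[OF f] deriv1_\<H>[OF u]] \<H>_inner_mult_deriv[OF \<C>_cont[OF f] h_\<C> u] by simp
  then show ?thesis unfolding 1 2 energy_harmonic[OF harmonic fu] .
qed

text \<open>\<open>star_inv\<close> picks some preimage; pairing with
  \<open>mult_deriv \<phi> h\<close> shows that any two preimages have the same integrals against
  \<open>\<C>\<close>, hence agree almost everywhere.\<close>

lemma star_inv_eqI:
  assumes g: "g \<in> L2 \<nu>" and v: "v \<in> \<H> q" and e: "\<H>_eq q (star q h g) v"
  shows "star_inv q h v \<in> L2 \<nu>" "AE x in \<nu>. star_inv q h v x = g x"
proof -
  have s: "star_inv q h v \<in> L2 \<nu> \<and> \<H>_eq q (star q h (star_inv q h v)) v"
    unfolding star_inv_def by (rule someI[of _ g]) (use g e in simp)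
  then show i: "star_inv q h v \<in> L2 \<nu>" by simp
  have "AE x in \<nu>. star_inv q h v x - g x = 0"
  proof (rule orth_\<C>_AE_0[OF L2_diff[OF i g]])
    fix \<phi> assume p: "\<phi> \<in> \<C> q"
    note pc = \<C>_cont[OF p]
    have "(\<integral>x. star_inv q h v x * \<phi> x \<partial>\<nu>) = \<H>_inner q v (mult_deriv \<phi> h)"
      using star_inner_mult[OF i pc] \<H>_inner_cong[OF star_\<H>[OF i] v mult_deriv_h_\<H>[OF pc]] s by simp
    moreover have "(\<integral>x. g x * \<phi> x \<partial>\<nu>) = \<H>_inner q v (mult_deriv \<phi> h)"
      using star_inner_mult[OF g pc] \<H>_inner_cong[OF star_\<H>[OF g] v mult_deriv_h_\<H>[OF pc] e] by simp
    ultimately show "(\<integral>x. (star_inv q h v x - g x) * \<phi> x \<partial>\<nu>) = 0"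
      using L2_prod[OF i \<C>_L2[OF p]] L2_prod[OF g \<C>_L2[OF p]] by (simp add: left_diff_distrib)
  qed
  then show "AE x in \<nu>. star_inv q h v x = g x" by eventually_elim simp
qed

lemma star_inv_deriv1:
  assumes d: "\<And>s::real. (\<phi> has_real_derivative \<phi>' s) (at s)" and c: "continuous_on UNIV \<phi>'"
  shows "star_inv q h (deriv1 (\<lambda>x. \<phi> (h x))) \<in> L2 \<nu>"
    "AE x in \<nu>. star_inv q h (deriv1 (\<lambda>x. \<phi> (h x))) x = \<phi>' (h x)"
proof -
  let ?f = "\<lambda>x. \<phi> (h x)" and ?g = "\<lambda>x. \<phi>' (h x)"
  have f: "?f \<in> \<C> q" by (rule chain_\<C>[OF h_\<C> d c])
  have g: "continuous_on K ?g" using continuous_on_compose2[OF c \<C>_cont[OF h_\<C>]] by auto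
  note H = star_\<H>[OF cont_L2[OF g]] mult_deriv_h_\<H>[OF g] deriv1_\<H>[OF f]
  have e: "\<H>_eq q (star q h ?g) (deriv1 ?f)"
    by (rule \<H>_eq_trans[OF H \<H>_eq_sym[OF H(2,1) star_cont_eq[OF g]] chain_rule[OF h_\<C> d c]])
  show "star_inv q h (deriv1 ?f) \<in> L2 \<nu>" "AE x in \<nu>. star_inv q h (deriv1 ?f) x = ?g x"
    using star_inv_eqI[OF cont_L2[OF g] H(3) e] by auto
qed

section \<open>Boundary values\<close>

text \<open>Two adjoint values differ by a function orthogonal to \<open>\<C>\<^sub>B\<close>. This
  is where the absence of mass on level sets of \<open>h\<close> is decisive.\<close>

lemma adj_AE_unique:
  assumes "is_adj q h (\<C>\<^sub>B q) v k"
  shows "adj q h (\<C>\<^sub>B q) v \<in> L2 \<nu>" "AE x in \<nu>. adj q h (\<C>\<^sub>B q) v x = k x"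
proof -
  have a: "is_adj q h (\<C>\<^sub>B q) v (adj q h (\<C>\<^sub>B q) v)"
    unfolding adj_def by (rule someI[of _ k]) (rule assms)
  then show aL: "adj q h (\<C>\<^sub>B q) v \<in> L2 \<nu>" unfolding is_adj_def by simp
  have kL: "k \<in> L2 \<nu>" using assms unfolding is_adj_def by simp
  have "AE x in \<nu>. adj q h (\<C>\<^sub>B q) v x - k x = 0"
  proof (rule orth_\<C>\<^sub>B_AE_0[OF L2_diff[OF aL kL]])
    fix \<phi> assume p: "\<phi> \<in> \<C>\<^sub>B q"
    then have pL: "\<phi> \<in> L2 \<nu>" using \<C>_L2 unfolding \<C>\<^sub>B_def by simp
    have "(\<integral>x. adj q h (\<C>\<^sub>B q) v x * \<phi> x \<partial>\<nu>) = (\<integral>x. k x * \<phi> x \<partial>\<nu>)"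
      using a assms p unfolding is_adj_def by auto
    then show "(\<integral>x. (adj q h (\<C>\<^sub>B q) v x - k x) * \<phi> x \<partial>\<nu>) = 0"
      using L2_prod[OF aL pL] L2_prod[OF kL pL] by (simp add: left_diff_distrib)
  qed
  then show "AE x in \<nu>. adj q h (\<C>\<^sub>B q) v x = k x" by eventually_elim simp
qed

lemma integral_AE_0:
  assumes "k \<in> L2 \<nu>" "\<phi> \<in> L2 \<nu>" "AE x in \<nu>. k x = 0" shows "(\<integral>x. k x * \<phi> x \<partial>\<nu>) = 0"
proof -
  have "AE x in \<nu>. k x * \<phi> x = 0" using assms(3) by eventually_elim simp
  then show ?thesis
    using integral_cong_AE[of "\<lambda>x. k x * \<phi> x" \<nu> "\<lambda>x. 0"] borel_measurable_times[OF L2_meas L2_meas, OF assms(1,2)] by simp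
qed

lemma basis_\<C>: "harmonic_basis q i \<in> \<C> q"
  using harmonic_basis(1) unfolding harmonic_def by blast

lemma nB_eq:
  assumes "is_adj q h (\<C>\<^sub>B q) v k"
  shows "nB q h v i = \<H>_inner q v (deriv1 (harmonic_basis q i)) - (\<integral>x. k x * harmonic_basis q i x \<partial>\<nu>)"
proof -
  note a = adj_AE_unique[OF assms]
  have kL: "k \<in> L2 \<nu>" using assms unfolding is_adj_def by simp
  note bL = \<C>_L2[OF basis_\<C>, of i]
  have "AE x in \<nu>. adj q h (\<C>\<^sub>B q) v x * harmonic_basis q i x = k x * harmonic_basis q i x"
    using a(2) by eventually_elim simp
  then have "(\<integral>x. adj q h (\<C>\<^sub>B q) v x * harmonic_basis q i x \<partial>\<nu>) = (\<integral>x. k x * harmonic_basis q i x \<partial>\<nu>)"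
    by (intro integral_cong_AE borel_measurable_times L2_meas a(1) kL bL)
  then show ?thesis unfolding nB_def by simp
qed

text \<open>Removes the chosen adjoint from the definition: the kernel consists of those
  \<open>w\<close> for which w \<partial>h is orthogonal to all gradients.\<close>

lemma ker_perp_iff: "w \<in> ker_perp q h \<longleftrightarrow> w \<in> L2 \<nu> \<and> (\<forall>\<phi>\<in>\<C> q. \<H>_inner q (star q h w) (deriv1 \<phi>) = 0)"
proof
  assume w: "w \<in> ker_perp q h"
  then have wL: "w \<in> L2 \<nu>" and ex: "\<exists>f. is_adj q h (\<C> q) (star q h w) f"
    and AE: "AE x in \<nu>. adj q h (\<C> q) (star q h w) x = 0"
    unfolding ker_perp_def perp_dom_def adj_dom_def perp_def by auto
  have a: "is_adj q h (\<C> q) (star q h w) (adj q h (\<C> q) (star q h w))"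
    unfolding adj_def by (rule someI_ex[OF ex])
  have "\<H>_inner q (star q h w) (deriv1 \<phi>) = 0" if "\<phi> \<in> \<C> q" for \<phi>
    using a that integral_AE_0[OF _ \<C>_L2[OF that] AE] unfolding is_adj_def by simp
  then show "w \<in> L2 \<nu> \<and> (\<forall>\<phi>\<in>\<C> q. \<H>_inner q (star q h w) (deriv1 \<phi>) = 0)" using wL by blast
next
  assume w: "w \<in> L2 \<nu> \<and> (\<forall>\<phi>\<in>\<C> q. \<H>_inner q (star q h w) (deriv1 \<phi>) = 0)"
  then have z: "is_adj q h (\<C> q) (star q h w) (\<lambda>x. 0)" unfolding is_adj_def by simp
  have a: "is_adj q h (\<C> q) (star q h w) (adj q h (\<C> q) (star q h w))"
    unfolding adj_def by (rule someI[of _ "\<lambda>x. 0"]) (rule z)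
  have "AE x in \<nu>. adj q h (\<C> q) (star q h w) x = 0"
    by (rule orth_\<C>_AE_0) (use a w in \<open>auto simp: is_adj_def\<close>)
  then show "w \<in> ker_perp q h"
    using w z star_\<H> unfolding ker_perp_def perp_dom_def adj_dom_def perp_def by auto
qed

lemma ker_perp_lin:
  assumes "w \<in> ker_perp q h" "w' \<in> ker_perp q h" shows "(\<lambda>x. a * w x + b * w' x) \<in> ker_perp q h"
  using assms unfolding ker_perp_iff by (auto simp: L2_lin star_inner_lin deriv1_\<H>)

lemma ker_perp_AE_0: "z \<in> L2 \<nu> \<Longrightarrow> AE x in \<nu>. z x = 0 \<Longrightarrow> z \<in> ker_perp q h"
  unfolding ker_perp_iff using star_inner_AE_0 deriv1_\<H> by blast

text \<open>For harmonic \<open>h\<close> the adjoint value of \<partial>h on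
  \<open>\<C>\<^sub>B\<close> is 0, so the normal part is the energy with the basis function, a
  boundary expression.\<close>

lemma nb_eq: "nb q h i = En 0 h (harmonic_basis q i)"
proof -
  have "is_adj q h (\<C>\<^sub>B q) (deriv1 h) (\<lambda>x. 0)"
    unfolding is_adj_def using \<H>_inner_deriv1[OF h_\<C>] harmonic unfolding harmonic_def \<C>\<^sub>B_def by auto
  from nB_eq[OF this] show ?thesis unfolding nb_def
    using \<H>_inner_deriv1[OF h_\<C> basis_\<C>] energy_harmonic[OF harmonic basis_\<C>] by simp
qed

lemma nb_values:
  "nb q h 0 = 2 * h (q 0) - h (q 1) - h (q 2)"
  "nb q h 1 = 2 * h (q 1) - h (q 0) - h (q 2)"
  "nb q h 2 = 2 * h (q 2) - h (q 0) - h (q 1)"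
  unfolding nb_eq En_0 harmonic_basis(2) by simp_all

lemma nB_zero: "nB q h (deriv1 (\<lambda>x. 0)) i = 0"
proof -
  have e: "\<H>_inner q (deriv1 (\<lambda>x. 0)) (deriv1 \<phi>) = 0" if "\<phi> \<in> \<C> q" for \<phi>
  proof -
    have "energy q (\<lambda>x. 0) \<phi> = 0"
      using energy_lim[OF \<C>_const that, of 0] by (simp add: En_def LIMSEQ_const_iff)
    then show ?thesis using \<H>_inner_deriv1[OF \<C>_const that] by simp
  qed
  then have "is_adj q h (\<C>\<^sub>B q) (deriv1 (\<lambda>x. 0)) (\<lambda>x. 0)"
    unfolding is_adj_def \<C>\<^sub>B_def by simp
  from nB_eq[OF this] show ?thesis using e basis_\<C> by simp
qed

section \<open>Functions of the form \<phi>(h) + w\<close>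

context
  fixes \<phi> \<phi>' :: "real \<Rightarrow> real" and w :: "pt \<Rightarrow> real"
  assumes d: "\<And>s. (\<phi> has_real_derivative \<phi>' s) (at s)" and c: "continuous_on UNIV \<phi>'"
    and w: "w \<in> ker_perp q h"
begin

abbreviation "fw \<equiv> \<lambda>x. \<phi> (h x) + w x"

lemma phi_h: "(\<lambda>x. \<phi> (h x)) \<in> \<C> q" "continuous_on K (\<lambda>x. \<phi>' (h x))"
  using chain_\<C>[OF h_\<C> d c] continuous_on_compose2[OF c \<C>_cont[OF h_\<C>]] by auto

lemma fw_L2: "fw \<in> L2 \<nu>"
  using L2_add[OF \<C>_L2[OF phi_h(1)]] w unfolding ker_perp_iff by blast

text \<open>Only \<phi>(h) contributes, since \<open>w\<close> is orthogonal to gradients.\<close>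

lemma star_fw_inner:
  assumes u: "u \<in> \<C> q"
  shows "\<H>_inner q (star q h fw) (deriv1 u) = En 0 h (\<lambda>x. \<phi> (h x) * u x) - (\<integral>x. \<phi>' (h x) * u x \<partial>\<nu>)"
  using star_inner_lin[OF \<C>_L2[OF phi_h(1)] _ deriv1_\<H>[OF u], of w 1 1] w u integration_by_parts[OF d c u]
  unfolding ker_perp_iff by simp

lemma fw_adj: "is_adj q h (\<C>\<^sub>B q) (star q h fw) (\<lambda>x. - \<phi>' (h x))"
  unfolding is_adj_def
proof (intro conjI ballI)
  show "(\<lambda>x. - \<phi>' (h x)) \<in> L2 \<nu>" by (intro cont_L2 continuous_intros phi_h)
  fix u assume "u \<in> \<C>\<^sub>B q"
  then have u: "u \<in> \<C> q" and "u (q i) = 0" for i unfolding \<C>\<^sub>B_def by auto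
  then have "En 0 h (\<lambda>x. \<phi> (h x) * u x) = 0" unfolding En_0 by simp
  then show "\<H>_inner q (star q h fw) (deriv1 u) = (\<integral>x. - \<phi>' (h x) * u x \<partial>\<nu>)"
    using star_fw_inner[OF u] by simp
qed

lemma fw_perp_dom: "fw \<in> perp_dom q h (\<C>\<^sub>B q)"
  unfolding perp_dom_def adj_dom_def using fw_L2 star_\<H> fw_adj by blast

lemma fw_perp: "perp q h (\<C>\<^sub>B q) fw \<in> L2 \<nu>" "AE x in \<nu>. perp q h (\<C>\<^sub>B q) fw x = \<phi>' (h x)"
proof -
  note a = adj_AE_unique[OF fw_adj]
  show "perp q h (\<C>\<^sub>B q) fw \<in> L2 \<nu>" unfolding perp_def using L2_cmult[OF a(1), of "-1"] by simp
  show "AE x in \<nu>. perp q h (\<C>\<^sub>B q) fw x = \<phi>' (h x)" using a(2) unfolding perp_def by eventually_elim simp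
qed

text \<open>The two integrals of \<phi>'(h) cancel. What remains is a level 0 energy with a function
  that vanishes at the other two vertices, so \<phi>(h) enters only through its value at
  \<open>q i\<close>.\<close>

lemma fw_nB: "nB q h (star q h fw) i = \<phi> (h (q i)) * nb q h i"
proof -
  have "nB q h (star q h fw) i = En 0 h (\<lambda>x. \<phi> (h x) * harmonic_basis q i x)"
    unfolding nB_eq[OF fw_adj] star_fw_inner[OF basis_\<C>] by simp
  also have "\<dots> = \<phi> (h (q i)) * En 0 h (harmonic_basis q i)"
    using exhaust_3'[of i] unfolding En_0 harmonic_basis(2) by (elim disjE) (simp_all add: algebra_simps)
  finally show ?thesis unfolding nb_eq .
qed

abbreviation "zw \<equiv> z_part q h fw (\<lambda>x. \<phi> (h x))"

text \<open>Both terms of \<open>z_part\<close> equal \<phi>'(h), but only almost everywhere because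
  each is a chosen representative. Hence the last component of the boundary data is compared almost
  everywhere too.\<close>

lemma zw_L2: "zw \<in> L2 \<nu>" and zw_AE: "AE x in \<nu>. zw x = 0"
proof -
  show "zw \<in> L2 \<nu>" unfolding z_part_def by (rule L2_diff[OF fw_perp(1) star_inv_deriv1(1)[OF d c]])
  show "AE x in \<nu>. zw x = 0"
    using fw_perp(2) star_inv_deriv1(2)[OF d c] unfolding z_part_def by eventually_elim simp
qed

lemma zw_ker: "zw \<in> ker_perp q h"
  by (rule ker_perp_AE_0[OF zw_L2 zw_AE])

text \<open>By \<open>fw_nB\<close> the Neumann datum for \<open>u\<close> is identically zero, and
  so is \<open>z\<close> almost everywhere; the zero function solves the weak problem.\<close>

lemma fw_canonical: "canonical_rep q h fw (\<lambda>x. \<phi> (h x)) (\<lambda>x. 0) w"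
  unfolding canonical_rep_def
proof (intro conjI)
  show "weak_solution q h (\<lambda>x. 0) zw (\<lambda>i. nB q h (star q h fw) i - \<phi> (h (q i)) * nb q h i)"
    unfolding weak_solution_def fw_nB
  proof (intro conjI ballI)
    fix u assume u: "u \<in> \<C> q"
    have "energy q (\<lambda>x. 0) u = 0"
      using energy_lim[OF \<C>_const u, of 0] by (simp add: En_def LIMSEQ_const_iff)
    then show "energy q (\<lambda>x. 0) u = (\<Sum>i\<in>UNIV. (\<phi> (h (q i)) * nb q h i - \<phi> (h (q i)) * nb q h i) * u (q i)) - (\<integral>x. zw x * u x \<partial>\<nu>)"
      using integral_AE_0[OF zw_L2 \<C>_L2[OF u] zw_AE] by simp
  qed simp
  have "AE x in \<nu>. star_inv q h (deriv1 (\<lambda>x. 0)) x = 0"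
    using star_inv_deriv1(2)[of "\<lambda>s. 0" "\<lambda>s. 0"] by simp
  then show "AE x in \<nu>. fw x = \<phi> (h x) + star_inv q h (deriv1 (\<lambda>x. 0)) x + w x"
    by eventually_elim simp
qed (use phi_h zw_ker w in auto)

lemma A_op_fw: "AE x in \<nu>. A_op q h fw x = - \<phi>' (h x)"
  using fw_perp(2) unfolding A_op_def by eventually_elim simp

lemma A_dom_fw:
  assumes "(h (q 0) = 0 \<and> h (q 1) = 1 \<and> h (q 2) = 1 \<and>
           (\<forall>x w. (x, w) \<in> H_minus q h \<longrightarrow>
              \<Theta> (x, w) = (\<lambda>i. if i = 0 then - (1/2) * (x 1 + x 2) else 0, w)))
       \<or> (h (q 0) = 1/2 \<and> h (q 1) = 0 \<and> h (q 2) = 1 \<and>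
           (\<forall>x w. (x, w) \<in> H_minus q h \<longrightarrow>
              \<Theta> (x, w) = (\<lambda>i. if i = 0 then x 0 else if i = 1 then - x 2 else - x 1, w)))"
    and per: "\<phi> 0 = \<phi> 1"
  shows "fw \<in> A_dom q h \<Theta>"
proof -
  let ?Gm = "G_minus q h fw (\<lambda>x. \<phi> (h x)) (\<lambda>x. 0) w"
  let ?Gp = "G_plus q h fw (\<lambda>x. \<phi> (h x)) (\<lambda>x. 0) w"
  let ?zp = "\<lambda>y. (w y + zw y) / sqrt 2" and ?zm = "\<lambda>y. (w y - zw y) / sqrt 2"
  have zp: "?zp \<in> ker_perp q h"
    using ker_perp_lin[OF w zw_ker, of "1 / sqrt 2" "1 / sqrt 2"] by (simp add: add_divide_distrib)
  have AE: "AE y in \<nu>. ?zp y = ?zm y" using zw_AE by eventually_elim simp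
  note G = G_minus_def G_plus_def orth_proj_def bdry_inner_def e_minus_def e_plus_def bdry_weight_def sum_3' Let_def
  have "bdry_eq q h (\<Theta> ?Gm) ?Gp"
    using assms(1)
  proof
    assume A: "h (q 0) = 0 \<and> h (q 1) = 1 \<and> h (q 2) = 1 \<and>
           (\<forall>x w. (x, w) \<in> H_minus q h \<longrightarrow>
              \<Theta> (x, w) = (\<lambda>i. if i = 0 then - (1/2) * (x 1 + x 2) else 0, w))"
    then have n: "nb q h 0 = -2" "nb q h 1 = 1" "nb q h 2 = 1" unfolding nb_values by simp_all
    \<comment> \<open>Here \<open>e_minus\<close> is supported at \<open>q 0\<close> and
      \<open>e_plus\<close> at the other two vertices. The components on these supports come from
      \<open>u = 0\<close>, so the projections leave the vectors unchanged. The entries of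
      \<open>G_plus\<close> and \<open>G_minus\<close> are values of \<phi> with the sign of
      \<open>nb\<close>.\<close>
    have Gm: "?Gm = (\<lambda>i. if i = 0 then 0 else \<phi> 1, ?zp)"
      using A exhaust_3' by (auto simp: G n fw_nB nB_zero fun_eq_iff forall_3')
    have Gp: "?Gp = (\<lambda>i. if i = 0 then - \<phi> 0 else 0, ?zm)"
      using A exhaust_3' by (auto simp: G n fw_nB nB_zero fun_eq_iff forall_3')
    \<comment> \<open>\<open>\<Theta>\<close> is prescribed on \<open>H_minus\<close> only.\<close>
    have "?Gm \<in> H_minus q h"
      unfolding H_minus_def orth_compl_def Gm using zp by (simp add: G n)
    then have "\<Theta> ?Gm = (\<lambda>i. if i = 0 then - \<phi> 1 else 0, ?zp)" using A unfolding Gm by (auto simp: fun_eq_iff)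
    then show ?thesis unfolding Gp bdry_eq_def using AE by (simp add: per fun_eq_iff)
  next
    assume A: "h (q 0) = 1/2 \<and> h (q 1) = 0 \<and> h (q 2) = 1 \<and>
           (\<forall>x w. (x, w) \<in> H_minus q h \<longrightarrow>
              \<Theta> (x, w) = (\<lambda>i. if i = 0 then x 0 else if i = 1 then - x 2 else - x 1, w))"
    then have n: "nb q h 0 = 0" "nb q h 1 = -3/2" "nb q h 2 = 3/2" unfolding nb_values by simp_all
    have hv: "h (q 0) = 1/2" "h (q 1) = 0" "h (q 2) = 1" using A by simp_all
    \<comment> \<open>Both \<open>e_minus\<close> and \<open>e_plus\<close> have squared norm 1/2 +
      3/2 = 2, and both unprojected vectors have product \<phi>(1/2) / 2 with them. So \<phi>(1/2) /
      4 times \<open>e_minus\<close> or \<open>e_plus\<close> is subtracted, which turns \<phi>(1/2)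
      / sqrt 2 at \<open>q 0\<close> into \<open>?a\<close>. The remaining contributions of
      \<phi>(1/2) are matched by the swap in \<open>\<Theta>\<close>.\<close>
    let ?a = "3 * \<phi> (1/2) / (4 * sqrt 2)"
    have Gm: "?Gm = (\<lambda>i. if i = 0 then ?a else if i = 1 then - \<phi> (1/2) / 4 else \<phi> 1, ?zp)"
      by (simp add: G n fw_nB nB_zero hv fun_eq_iff forall_3')
    have Gp: "?Gp = (\<lambda>i. if i = 0 then ?a else if i = 1 then - \<phi> 0 else \<phi> (1/2) / 4, ?zm)"
      by (simp add: G n fw_nB nB_zero hv fun_eq_iff forall_3')
    have "?Gm \<in> H_minus q h"
      unfolding H_minus_def orth_compl_def Gm using zp by (simp add: G n field_simps)
    then have "\<Theta> ?Gm = (\<lambda>i. if i = 0 then ?a else if i = 1 then - \<phi> 1 else \<phi> (1/2) / 4, ?zp)"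
      using A unfolding Gm by (auto simp: fun_eq_iff)
    then show ?thesis unfolding Gp bdry_eq_def using AE by (simp add: per fun_eq_iff)
  qed
  then show ?thesis unfolding A_dom_def using fw_perp_dom fw_canonical by blast
qed

end

end

section \<open>Uniqueness for the abstract Cauchy problem\<close>

locale generated_semigroup =
  fixes M :: "'a measure" and D A T
  assumes semigroup: "contraction_semigroup M T" and generator: "is_generator M D A T"
begin

lemma T_L2: "0 \<le> t \<Longrightarrow> f \<in> L2 M \<Longrightarrow> T t f \<in> L2 M"
  using semigroup unfolding contraction_semigroup_def by blast

lemma T_diff_norm:
  assumes "0 \<le> t" "f \<in> L2 M" "g \<in> L2 M"
  shows "L2_norm M (\<lambda>x. T t f x - T t g x) \<le> L2_norm M (\<lambda>x. f x - g x)"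
proof -
  have d: "(\<lambda>x. f x + (-1) * g x) \<in> L2 M" using L2_lin[OF assms(2,3), of 1 "-1"] by simp
  have "AE x in M. T t (\<lambda>x. f x + (-1) * g x) x = T t f x + (-1) * T t g x"
    using semigroup assms unfolding contraction_semigroup_def by blast
  then have "AE x in M. T t f x - T t g x = T t (\<lambda>x. f x + (-1) * g x) x" by eventually_elim simp
  then have "L2_norm M (\<lambda>x. T t f x - T t g x) = L2_norm M (T t (\<lambda>x. f x + (-1) * g x))"
    using assms T_L2 d by (intro L2_norm_cong_AE L2_meas L2_diff) auto
  also have "\<dots> \<le> L2_norm M (\<lambda>x. f x + (-1) * g x)"
    using semigroup assms(1) d unfolding contraction_semigroup_def by blast
  finally show ?thesis by simp
qed

lemma T_continuous_0: "f \<in> L2 M \<Longrightarrow> ((\<lambda>t. L2_norm M (\<lambda>x. T t f x - f x)) \<longlongrightarrow> 0) (at_right 0)"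
  using semigroup unfolding contraction_semigroup_def by blast

lemma T_generator:
  assumes "f \<in> D" "k \<in> L2 M" "AE x in M. A f x = k x"
  shows "((\<lambda>t. L2_norm M (\<lambda>x. (T t f x - f x) / t - k x)) \<longlongrightarrow> 0) (at_right 0)"
proof -
  have "AE x in M. k x = A f x" using assms(3) by eventually_elim simp
  moreover have "f \<in> L2 M" using assms(1) generator unfolding is_generator_def by blast
  ultimately show ?thesis using generator assms unfolding is_generator_def by blast
qed

text \<open>
  The distance between \<open>T s (u 0)\<close> and \<open>u s\<close> has vanishing upper right Dini derivative, because
  \<open>T\<close> is contractive and both curves move infinitesimally by the generator.
\<close>

theorem unique_solution:
  assumes t: "0 \<le> t"
    and u: "\<And>s. 0 \<le> s \<Longrightarrow> s \<le> t \<Longrightarrow> u s \<in> D"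
    and u': "\<And>s. 0 \<le> s \<Longrightarrow> s \<le> t \<Longrightarrow> u' s \<in> L2 M"
    and ode: "\<And>s. 0 \<le> s \<Longrightarrow> s \<le> t \<Longrightarrow> AE x in M. A (u s) x = u' s x"
    and deriv: "\<And>s. 0 \<le> s \<Longrightarrow> s < t \<Longrightarrow>
      ((\<lambda>\<delta>. L2_norm M (\<lambda>x. (u (s + \<delta>) x - u s x) / \<delta> - u' s x)) \<longlongrightarrow> 0) (at_right 0)"
    and lip: "\<And>s r. 0 \<le> s \<Longrightarrow> s \<le> t \<Longrightarrow> 0 \<le> r \<Longrightarrow> r \<le> t \<Longrightarrow> L2_norm M (\<lambda>x. u s x - u r x) \<le> L * \<bar>s - r\<bar>"
  shows "AE x in M. T t (u 0) x = u t x"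
proof -
  have uL: "u s \<in> L2 M" if "0 \<le> s" "s \<le> t" for s
    using u[OF that] generator unfolding is_generator_def by blast
  define \<phi> where "\<phi> s = L2_norm M (\<lambda>x. T s (u 0) x - u s x)" for s
  \<comment> \<open>The one-step defect: starting from \<open>u s\<close>, the semigroup is compared
    with the curve after time \<delta>. By contractivity, errors made earlier do not grow.\<close>
  define r where "r s \<delta> = L2_norm M (\<lambda>x. T \<delta> (u s) x - u (s + \<delta>) x)" for s \<delta>
  note u0 = uL[OF order_refl t]
  have \<phi>0: "\<phi> 0 = 0"
  proof -
    have "AE x in M. T 0 (u 0) x = u 0 x" using semigroup u0 unfolding contraction_semigroup_def by blast
    then have "AE x in M. T 0 (u 0) x - u 0 x = 0" by eventually_elim simp
    then have "L2_norm M (\<lambda>x. T 0 (u 0) x - u 0 x) = L2_norm M (\<lambda>x. 0)"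
      by (intro L2_norm_cong_AE) (use L2_meas[OF L2_diff[OF T_L2[OF _ u0] u0]] in auto)
    then show ?thesis unfolding \<phi>_def by (simp add: L2_norm_def)
  qed
  have step: "\<phi> (s + \<delta>) \<le> \<phi> s + r s \<delta>" if s: "0 \<le> s" "0 \<le> \<delta>" "s + \<delta> \<le> t" for s \<delta>
  proof -
    have us: "u s \<in> L2 M" "u (s + \<delta>) \<in> L2 M" "T s (u 0) \<in> L2 M" using s uL T_L2 u0 by auto
    have TT: "T \<delta> (T s (u 0)) \<in> L2 M" "T \<delta> (u s) \<in> L2 M" "T (s + \<delta>) (u 0) \<in> L2 M" using s us T_L2 u0 by auto
    have "AE x in M. T (\<delta> + s) (u 0) x = T \<delta> (T s (u 0)) x"
      using semigroup s u0 unfolding contraction_semigroup_def by blast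
    then have "AE x in M. T (s + \<delta>) (u 0) x - u (s + \<delta>) x = T \<delta> (T s (u 0)) x - u (s + \<delta>) x"
      by (simp add: add.commute)
    then have "\<phi> (s + \<delta>) = L2_norm M (\<lambda>x. T \<delta> (T s (u 0)) x - u (s + \<delta>) x)"
      unfolding \<phi>_def using TT us by (intro L2_norm_cong_AE L2_meas L2_diff)
    also have "\<dots> \<le> L2_norm M (\<lambda>x. T \<delta> (T s (u 0)) x - T \<delta> (u s) x) + r s \<delta>"
      unfolding r_def by (rule L2_norm_triangle3[OF TT(1,2) us(2)])
    also have "\<dots> \<le> \<phi> s + r s \<delta>"
      unfolding \<phi>_def using T_diff_norm[OF s(2) us(3,1)] by simp
    finally show ?thesis .
  qed
  have small_right: "\<exists>\<delta>>0. s + \<delta> \<le> t \<and> r s \<delta> \<le> e * \<delta>" if s: "0 \<le> s" "s < t" and e: "0 < e" for s e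
  proof -
    have s': "s \<le> t" using s by simp
    have "\<forall>\<^sub>F \<delta> in at_right 0. L2_norm M (\<lambda>x. (T \<delta> (u s) x - u s x) / \<delta> - u' s x) < e / 2"
      using order_tendstoD(2)[OF T_generator[OF u u' ode], OF s(1) s' s(1) s' s(1) s', of "e/2"] e by simp
    moreover have "\<forall>\<^sub>F \<delta> in at_right 0. L2_norm M (\<lambda>x. (u (s + \<delta>) x - u s x) / \<delta> - u' s x) < e / 2"
      using order_tendstoD(2)[OF deriv[OF s], of "e/2"] e by simp
    moreover have "\<forall>\<^sub>F \<delta> in at_right 0. \<delta> < t - s" using s by (intro order_tendstoD(2)[where y = 0] tendsto_ident_at) auto
    moreover have "\<forall>\<^sub>F \<delta>::real in at_right 0. 0 < \<delta>" by (simp add: eventually_at_right_less)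
    ultimately have "\<forall>\<^sub>F \<delta> in at_right 0. 0 < \<delta> \<and> s + \<delta> \<le> t \<and> r s \<delta> \<le> e * \<delta>"
    proof eventually_elim
      fix \<delta> :: real assume a: "L2_norm M (\<lambda>x. (T \<delta> (u s) x - u s x) / \<delta> - u' s x) < e / 2"
        "L2_norm M (\<lambda>x. (u (s + \<delta>) x - u s x) / \<delta> - u' s x) < e / 2" "\<delta> < t - s" "0 < \<delta>"
      let ?a = "\<lambda>x. (T \<delta> (u s) x - u s x) / \<delta>" and ?b = "\<lambda>x. (u (s + \<delta>) x - u s x) / \<delta>"
      have L: "?a \<in> L2 M" "?b \<in> L2 M" "u' s \<in> L2 M"
        using L2_cmult[OF L2_diff[OF T_L2[OF less_imp_le[OF a(4)] uL[OF s(1) s']] uL[OF s(1) s']], of "1/\<delta>"]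
          L2_cmult[OF L2_diff[OF uL[of "s + \<delta>"] uL[OF s(1) s']], of "1/\<delta>"] a s u'[OF s(1) s'] by auto
      have "r s \<delta> = L2_norm M (\<lambda>x. \<delta> * (?a x - ?b x))"
      proof -
        have "\<delta> * (y / \<delta> - z / \<delta>) = y - z" for y z using a(4) by (simp add: field_simps)
        then show ?thesis unfolding r_def by simp
      qed
      also have "\<dots> = \<delta> * L2_norm M (\<lambda>x. ?a x - ?b x)" unfolding L2_norm_cmult using a(4) by simp
      also have "\<dots> \<le> \<delta> * (L2_norm M (\<lambda>x. ?a x - u' s x) + L2_norm M (\<lambda>x. u' s x - ?b x))"
        using a(4) by (intro mult_left_mono L2_norm_triangle3 L) auto
      also have "\<dots> \<le> \<delta> * e"
        using a L2_norm_minus_commute[of M "u' s" ?b] by (intro mult_left_mono) auto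
      finally show "0 < \<delta> \<and> s + \<delta> \<le> t \<and> r s \<delta> \<le> e * \<delta>" using a by (simp add: mult.commute)
    qed
    then show ?thesis using eventually_happens' trivial_limit_at_right_real by (metis (no_types, lifting))
  qed
  \<comment> \<open>Used at a supremum approached from below. Contractivity and the Lipschitz bound
    move the starting point from s - \<delta> to s; strong continuity at 0 handles the rest.\<close>
  have small_left: "\<exists>\<delta>\<^sub>0>0. \<forall>\<delta>. 0 < \<delta> \<and> \<delta> < \<delta>\<^sub>0 \<and> \<delta> \<le> s \<longrightarrow> r (s - \<delta>) \<delta> \<le> e" if s: "0 \<le> s" "s \<le> t" and e: "0 < e" for s e
  proof -
    have "\<forall>\<^sub>F \<delta> in at_right 0. L2_norm M (\<lambda>x. T \<delta> (u s) x - u s x) < e / 2"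
      using order_tendstoD(2)[OF T_continuous_0[OF uL[OF s]], of "e/2"] e by simp
    moreover have "\<forall>\<^sub>F \<delta> in at_right 0. \<bar>L\<bar> * \<delta> < e / 2"
    proof (rule order_tendstoD(2))
      show "((\<lambda>\<delta>. \<bar>L\<bar> * \<delta>) \<longlongrightarrow> \<bar>L\<bar> * 0) (at_right 0)" by (intro tendsto_intros)
    qed (use e in simp)
    ultimately have "\<forall>\<^sub>F \<delta> in at_right 0. L2_norm M (\<lambda>x. T \<delta> (u s) x - u s x) < e / 2 \<and> \<bar>L\<bar> * \<delta> < e / 2"
      by eventually_elim simp
    then obtain \<delta>\<^sub>0 where d0: "\<delta>\<^sub>0 > 0" "\<And>\<delta>. 0 < \<delta> \<Longrightarrow> \<delta> < \<delta>\<^sub>0 \<Longrightarrow> L2_norm M (\<lambda>x. T \<delta> (u s) x - u s x) < e / 2 \<and> \<bar>L\<bar> * \<delta> < e / 2"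
      unfolding eventually_at_right_field by auto
    have "r (s - \<delta>) \<delta> \<le> e" if d: "0 < \<delta>" "\<delta> < \<delta>\<^sub>0" "\<delta> \<le> s" for \<delta>
    proof -
      have us: "u s \<in> L2 M" "u (s - \<delta>) \<in> L2 M" using s d uL by auto
      have TT: "T \<delta> (u (s - \<delta>)) \<in> L2 M" "T \<delta> (u s) \<in> L2 M" using d us T_L2 by auto
      have "r (s - \<delta>) \<delta> \<le> L2_norm M (\<lambda>x. T \<delta> (u (s - \<delta>)) x - T \<delta> (u s) x) + L2_norm M (\<lambda>x. T \<delta> (u s) x - u s x)"
        unfolding r_def using L2_norm_triangle3[OF TT us(1)] by simp
      also have "\<dots> \<le> L2_norm M (\<lambda>x. u (s - \<delta>) x - u s x) + e / 2"
        using T_diff_norm[OF _ us(2,1), of \<delta>] d d0(2)[OF d(1,2)] by simp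
      also have "L2_norm M (\<lambda>x. u (s - \<delta>) x - u s x) \<le> L * \<bar>(s - \<delta>) - s\<bar>"
        using s d by (intro lip) auto
      also have "L * \<bar>(s - \<delta>) - s\<bar> \<le> \<bar>L\<bar> * \<delta>" using d by (simp add: mult_right_mono)
      finally show ?thesis using d0(2)[OF d(1,2)] by simp
    qed
    then show ?thesis using d0(1) by blast
  qed
  have lin: "\<phi> t \<le> e * t" if e: "0 < e" for e
  proof -
    \<comment> \<open>Continuous induction: the left estimate shows that the supremum of
      \<open>S\<close> satisfies the inequality, and the right estimate produces a larger element as
      long as the supremum is below \<open>t\<close>.\<close>
    define S where "S = {s \<in> {0..t}. \<phi> s \<le> e * s}"
    have S0: "0 \<in> S" unfolding S_def using t \<phi>0 by simp
    have bdd: "bdd_above S" unfolding S_def by (intro bdd_aboveI[of _ t]) auto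
    define \<sigma> where "\<sigma> = Sup S"
    have "0 \<le> \<sigma>" unfolding \<sigma>_def by (rule cSup_upper[OF S0 bdd])
    moreover have "\<sigma> \<le> t" unfolding \<sigma>_def by (rule cSup_least) (use S0 in \<open>auto simp: S_def\<close>)
    ultimately have \<sigma>: "0 \<le> \<sigma>" "\<sigma> \<le> t" .
    have "\<phi> \<sigma> \<le> e * \<sigma>"
    proof (rule field_le_epsilon)
      fix \<eta> :: real assume "\<eta> > 0"
      obtain \<delta>\<^sub>0 where d0: "\<delta>\<^sub>0 > 0" "\<And>\<delta>. 0 < \<delta> \<Longrightarrow> \<delta> < \<delta>\<^sub>0 \<Longrightarrow> \<delta> \<le> \<sigma> \<Longrightarrow> r (\<sigma> - \<delta>) \<delta> \<le> \<eta>"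
        using small_left[OF \<sigma> \<open>\<eta> > 0\<close>] by blast
      obtain s where s: "s \<in> S" "\<sigma> - \<delta>\<^sub>0 < s"
        using less_cSup_iff[of S "\<sigma> - \<delta>\<^sub>0"] S0 bdd d0(1) unfolding \<sigma>_def by auto
      have s\<sigma>: "s \<le> \<sigma>" unfolding \<sigma>_def by (rule cSup_upper[OF s(1) bdd])
      show "\<phi> \<sigma> \<le> e * \<sigma> + \<eta>"
      proof (cases "s = \<sigma>")
        case True
        then show ?thesis using s(1) \<open>\<eta> > 0\<close> unfolding S_def by simp
      next
        case False
        have s0: "0 \<le> s" "\<phi> s \<le> e * s" using s(1) unfolding S_def by auto
        have "\<phi> \<sigma> \<le> \<phi> s + r s (\<sigma> - s)" using step[of s "\<sigma> - s"] s0 s\<sigma> \<sigma> by simp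
        also have "r s (\<sigma> - s) \<le> \<eta>" using d0(2)[of "\<sigma> - s"] s s\<sigma> s0 False by simp
        also have "\<phi> s \<le> e * \<sigma>" using s0 s\<sigma> e by (meson mult_left_mono less_imp_le order_trans)
        finally show ?thesis by simp
      qed
    qed
    moreover have "\<sigma> = t"
    proof (rule ccontr)
      assume "\<sigma> \<noteq> t"
      then have "\<sigma> < t" using \<sigma> by simp
      then obtain \<delta> where d: "\<delta> > 0" "\<sigma> + \<delta> \<le> t" "r \<sigma> \<delta> \<le> e * \<delta>" using small_right[OF \<sigma>(1) _ e] by blast
      have "\<phi> (\<sigma> + \<delta>) \<le> e * \<sigma> + e * \<delta>"
        using step[of \<sigma> \<delta>] d \<sigma> \<open>\<phi> \<sigma> \<le> e * \<sigma>\<close> by simp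
      then have "\<sigma> + \<delta> \<in> S" unfolding S_def using d \<sigma> by (simp add: distrib_left)
      from cSup_upper[OF this bdd] have "\<sigma> + \<delta> \<le> \<sigma>" by (simp only: \<sigma>_def)
      then show False using d(1) by simp
    qed
    ultimately show ?thesis by simp
  qed
  have "\<phi> t \<le> e" if "0 < e" for e
  proof -
    have "\<phi> t \<le> e / (t + 1) * t" using lin[of "e / (t + 1)"] that t by simp
    also have "\<dots> \<le> e" using that t by (simp add: field_simps)
    finally show ?thesis .
  qed
  then have "\<phi> t \<le> 0" by (rule field_le_epsilon[where y = 0, simplified])
  then have "L2_norm M (\<lambda>x. T t (u 0) x - u t x) = 0"
    unfolding \<phi>_def using L2_norm_nonneg by (rule antisym)
  then have "AE x in M. T t (u 0) x - u t x = 0"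
    using L2_norm_0_imp L2_diff T_L2[OF t u0] uL[OF t order_refl] by blast
  then show ?thesis by eventually_elim simp
qed

end

section \<open>Translated profiles solve the Cauchy problem\<close>

theorem theorem11p3:
  fixes q :: "3 \<Rightarrow> real^2"
    and h :: "real^2 \<Rightarrow> real"
    and \<Theta> :: "(3 \<Rightarrow> real) \<times> (real^2 \<Rightarrow> real) \<Rightarrow> (3 \<Rightarrow> real) \<times> (real^2 \<Rightarrow> real)"
    and T :: "real \<Rightarrow> (real^2 \<Rightarrow> real) \<Rightarrow> real^2 \<Rightarrow> real"
    and V\<^sub>0 :: "real \<Rightarrow> real"
    and w :: "real^2 \<Rightarrow> real"
  assumes "equilateral q"
    and "harmonic q h"
    and "(h (q 0) = 0 \<and> h (q 1) = 1 \<and> h (q 2) = 1 \<and>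
           (\<forall>x w. (x, w) \<in> H_minus q h \<longrightarrow>
              \<Theta> (x, w) = (\<lambda>i. if i = 0 then - (1/2) * (x 1 + x 2) else 0, w)))
       \<or> (h (q 0) = 1/2 \<and> h (q 1) = 0 \<and> h (q 2) = 1 \<and>
           (\<forall>x w. (x, w) \<in> H_minus q h \<longrightarrow>
              \<Theta> (x, w) = (\<lambda>i. if i = 0 then x 0 else if i = 1 then - x 2 else - x 1, w)))"
    and "contraction_semigroup (nu q h) T"
    and "is_generator (nu q h) (A_dom q h \<Theta>) (A_op q h) T"
    and "V\<^sub>0 C1_differentiable_on UNIV" and "\<forall>s. V\<^sub>0 (s + 1) = V\<^sub>0 s"
    and "w \<in> ker_perp q h"
  shows "(\<lambda>x. V\<^sub>0 (h x) + w x) \<in> A_dom q h \<Theta> \<and>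
         (\<forall>t\<ge>0. AE x in nu q h. T t (\<lambda>x. V\<^sub>0 (h x) + w x) x = V\<^sub>0 (h x - t) + w x)"
proof -
  interpret harmonic_triangle q h by unfold_locales (fact assms)+
  interpret generated_semigroup "nu q h" "A_dom q h \<Theta>" "A_op q h" T by unfold_locales (fact assms)+
  interpret finite_measure "nu q h" by (rule finite_nu)
  obtain V' where V': "\<And>s. (V\<^sub>0 has_real_derivative V' s) (at s)" "continuous_on UNIV V'"
    using assms(6) unfolding C1_differentiable_on_def has_real_derivative_iff_has_vector_derivative by auto
  have d: "((\<lambda>s. V\<^sub>0 (s - a)) has_real_derivative V' (s - a)) (at s)" for a s
  proof -
    have "((\<lambda>s. s - a) has_real_derivative 1) (at s)" by (auto intro!: derivative_eq_intros)
    from DERIV_chain2[OF V'(1) this] show ?thesis by simp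
  qed
  have c: "continuous_on UNIV (\<lambda>s. V' (s - a))" for a
    by (rule continuous_on_compose2[OF V'(2)]) (auto intro!: continuous_intros)
  define u where "u s = (\<lambda>x. V\<^sub>0 (h x - s) + w x)" for s
  \<comment> \<open>Periodicity gives every translate the boundary condition, so the whole curve
    stays in the domain.\<close>
  have per: "V\<^sub>0 (0 - a) = V\<^sub>0 (1 - a)" for a
    using assms(7)[rule_format, of "0 - a"] by (simp add: add.commute)
  have dom: "u s \<in> A_dom q h \<Theta>" for s
    unfolding u_def by (rule A_dom_fw[OF d c assms(8) assms(3) per])
  have ode: "AE x in nu q h. A_op q h (u s) x = - V' (h x - s)" for s
    unfolding u_def by (rule A_op_fw[OF d c assms(8)])
  have cont: "continuous_on K (\<lambda>x. V' (h x - s))" for s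
    by (rule continuous_on_compose2[OF V'(2)]) (auto intro!: continuous_on_diff continuous_on_const \<C>_cont[OF h_\<C>])
  have uL: "u s \<in> L2 (nu q h)" for s
    unfolding u_def by (rule fw_L2[OF d c assms(8)])
  obtain B where B: "\<And>x. x \<in> K \<Longrightarrow> h x \<in> {-B..B}" using compact_range[OF h_\<C>] by blast
  have "AE x in nu q h. T t (u 0) x = u t x" if t: "0 \<le> t" for t
  proof -
    \<comment> \<open>A compact interval containing all values h(x) - s up to time \<open>t\<close>;
      on it V' is bounded and uniformly continuous. The root of the total mass converts uniform
      bounds into L2 bounds.\<close>
    let ?I = "{-B - t..B + t}" and ?m = "sqrt (measure (nu q h) (space (nu q h)))"
    have in_I: "h x - s \<in> ?I" if "x \<in> K" "0 \<le> s" "s \<le> t" for x s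
      using B[OF that(1)] that by auto
    have "compact (V' ` ?I)" by (rule compact_continuous_image[OF continuous_on_subset[OF V'(2)]]) auto
    then obtain L where L: "\<And>s. s \<in> ?I \<Longrightarrow> norm (V' s) \<le> L"
      using compact_imp_bounded[of "V' ` ?I"] unfolding bounded_iff by (meson imageI)
    show ?thesis
    proof (rule unique_solution[OF t, where u' = "\<lambda>s x. - V' (h x - s)" and L = "L * ?m"])
      fix s assume s: "0 \<le> s" "s \<le> t"
      show "u s \<in> A_dom q h \<Theta>" by (rule dom)
      show "AE x in nu q h. A_op q h (u s) x = - V' (h x - s)" by (rule ode)
      show "(\<lambda>x. - V' (h x - s)) \<in> L2 (nu q h)" by (intro cont_L2 continuous_on_minus cont)
      fix r assume r: "0 \<le> r" "r \<le> t"
      have "L2_norm (nu q h) (\<lambda>x. u s x - u r x) \<le> (L * \<bar>s - r\<bar>) * ?m"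
      proof (rule bounded_L2(2))
        show "(\<lambda>x. u s x - u r x) \<in> borel_measurable (nu q h)" by (intro L2_meas L2_diff uL)
        fix x assume "x \<in> space (nu q h)"
        then have x: "x \<in> K" using space_nu by simp
        have "norm (V\<^sub>0 (h x - s) - V\<^sub>0 (h x - r)) \<le> L * norm ((h x - s) - (h x - r))"
          by (rule field_differentiable_bound[of ?I V\<^sub>0 V' L])
             (use V'(1) L in_I[OF x s] in_I[OF x r] in \<open>auto intro: has_field_derivative_at_within\<close>)
        then show "\<bar>u s x - u r x\<bar> \<le> L * \<bar>s - r\<bar>" unfolding u_def by (simp add: abs_minus_commute)
      qed
      then show "L2_norm (nu q h) (\<lambda>x. u s x - u r x) \<le> L * ?m * \<bar>s - r\<bar>" by (simp add: mult_ac)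
    next
      fix s assume s: "0 \<le> s" "s < t"
      show "((\<lambda>\<delta>. L2_norm (nu q h) (\<lambda>x. (u (s + \<delta>) x - u s x) / \<delta> - - V' (h x - s))) \<longlongrightarrow> 0) (at_right 0)"
      proof (rule tendstoI)
        fix e :: real assume e: "e > 0"
        define e' where "e' = e / (?m + 1)"
        have m: "?m + 1 > 0" by (simp add: add_nonneg_pos)
        then have e': "e' > 0" unfolding e'_def using e by simp
        have "uniformly_continuous_on ?I V'"
          by (rule compact_uniformly_continuous[OF continuous_on_subset[OF V'(2)]]) auto
        then obtain \<delta>\<^sub>0 where d0: "\<delta>\<^sub>0 > 0" "\<And>a b. a \<in> ?I \<Longrightarrow> b \<in> ?I \<Longrightarrow> dist b a < \<delta>\<^sub>0 \<Longrightarrow> dist (V' b) (V' a) < e'"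
          unfolding uniformly_continuous_on_def using e' by metis
        have "dist (L2_norm (nu q h) (\<lambda>x. (u (s + \<delta>) x - u s x) / \<delta> - - V' (h x - s))) 0 < e"
          if dl: "0 < \<delta>" "\<delta> < min \<delta>\<^sub>0 (t - s)" for \<delta>
        proof -
          let ?f = "\<lambda>x. (u (s + \<delta>) x - u s x) / \<delta> - - V' (h x - s)"
          have "L2_norm (nu q h) ?f \<le> e' * ?m"
          proof (rule bounded_L2(2))
            show "?f \<in> borel_measurable (nu q h)"
              by (intro borel_measurable_diff borel_measurable_divide borel_measurable_uminus borel_measurable_const
                  L2_meas uL cont_L2 cont)
            fix x assume "x \<in> space (nu q h)"
            then have x: "x \<in> K" using space_nu by simp
            \<comment> \<open>By the mean value theorem the difference quotient in time is -V'(z)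
              with z within \<delta> of h(x) - s, so uniform continuity of V' bounds the error
              uniformly in \<open>x\<close>.\<close>
            obtain z where z: "h x - (s + \<delta>) < z" "z < h x - s"
              "V\<^sub>0 (h x - s) - V\<^sub>0 (h x - (s + \<delta>)) = ((h x - s) - (h x - (s + \<delta>))) * V' z"
              using MVT2[of "h x - (s + \<delta>)" "h x - s" V\<^sub>0 V'] dl V'(1) by auto
            have "(u (s + \<delta>) x - u s x) / \<delta> = - V' z"
            proof -
              have "u (s + \<delta>) x - u s x = - (\<delta> * V' z)" using z(3) unfolding u_def by simp
              then show ?thesis using dl by simp
            qed
            moreover have "dist (V' z) (V' (h x - s)) < e'"
            proof (rule d0(2))
              show "h x - s \<in> ?I" "z \<in> ?I" using in_I[OF x, of s] in_I[OF x, of "s + \<delta>"] s dl z by auto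
              show "dist z (h x - s) < \<delta>\<^sub>0" using z dl by (simp add: dist_real_def)
            qed
            ultimately show "\<bar>?f x\<bar> \<le> e'" by (simp add: dist_real_def abs_minus_commute)
          qed
          also have "\<dots> < e' * (?m + 1)" using e' by simp
          also have "\<dots> = e"
          proof -
            have "e / r * r = e" if "r > 0" for r :: real using that by simp
            from this[OF m] show ?thesis unfolding e'_def .
          qed
          finally show ?thesis by simp
        qed
        then show "\<forall>\<^sub>F \<delta> in at_right 0. dist (L2_norm (nu q h) (\<lambda>x. (u (s + \<delta>) x - u s x) / \<delta> - - V' (h x - s))) 0 < e"
          unfolding eventually_at_right_field using d0(1) s by (intro exI[of _ "min \<delta>\<^sub>0 (t - s)"]) auto
      qed
    qed
  qed
  then show ?thesis using dom[of 0] unfolding u_def by simp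
qed

end
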